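(* Let $S=NA$ be a harmonic $NA$ group with Laplace--Beltrami operator $\mathcal{L}$. Let $\beta>0$, let $u$ be a positive eigenfunction of $\mathcal{L}$ on $S$ with eigenvalue $\beta^2-\rho^2$, let $n_0\in N$ and $L\in[0,\infty)$, and let $\mu$ be the boundary measure of $u$. Then: (i) If there exists $\theta>0$ such that $$\lim_{\substack{a\to 0\\ (n,a)\in\Gamma_\theta(n_0)}} a^{\beta-\rho}u(n,a)=L,$$ then the strong derivative of $\mu$ at $n_0$ exists and $D\mu(n_0)=L$. (ii) If $D\mu(n_0)=L$, then the function $(n,a)\mapsto a^{\beta-\rho}u(n,a)$ has admissible limit $L$ at $n_0$.
   Context: Group $N$. Let $\mathfrak n$ be a two-step (in particular noncommutative) real nilpotent Lie algebra with inner product $\langle\cdot,\cdot\rangle$, centre $\mathfrak z$, and $\mathfrak v=\mathfrak z^{\perp}$. Assume $\mathfrak n$ is of $H$-type: for every $Z\in\mathfrak z$ the map $J_Z:\mathfrak v\to\mathfrak v$ defined by $\langle J_ZX,Y\rangle=\langle[X,Y],Z\rangle$ satisfies $J_Z^2=-|Z|^2 I_{\mathfrak v}$. Let $N$ be the connected simply connected Lie group with Lie algebra $\mathfrak n$, identified via $\exp$ with $\mathfrak v\times\mathfrak z$ with law $(X,Z)(X',Z')=(X+X',Z+Z'+\frac12[X,X'])$; its identity is $\underline 0$. Write $\dim\mathfrak v=2p$, $\dim\mathfrak z=k$, $Q=p+k$, $\rho=Q/2$. Let $m$ be Lebesgue measure $dX\,dZ$, a Haar measure on $N$. For $a\in A=(0,\infty)$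 put $\delta_a(X,Z)=(\sqrt a X,aZ)$. Put $d(X,Z)=(\|X\|^4+16\|Z\|^2)^{1/2}$, $\mathbf d(n_1,n_2)=d(n_1^{-1}n_2)$, and $B(n,r)=\{n_1\in N: \mathbf d(n,n_1)<r\}$ (a $d$-ball, $n\in N$, $r>0$). Group $S$. $S=NA$ is $N\times A$ with the product $(X,Z,a)(X',Z',a')=(X+\sqrt aX',\,Z+aZ'+\frac12\sqrt a[X,X'],\,aa')$, with the left-invariant Riemannian metric given at the identity on $\mathfrak v\oplus\mathfrak z\oplus\mathbb R$ by $\langle X,X'\rangle+\langle Z,Z'\rangle+uu'$. Its Laplace--Beltrami operator is, with $\{e_i\}_{1\le i\le 2p}$, $\{e_r\}_{2p+1\le r\le 2p+k}$ orthonormal bases of $\mathfrak v$, $\mathfrak z$ and $\partial_i,\partial_r,\partial_a$ the corresponding partial derivatives in coordinates $(X,Z,a)$, $$\mathcal L=a^2\partial_a^2+\mathcal L_a+(1-Q)a\partial_a,\quad \mathcal L_a=a\Big(a+\tfrac14\|X\|^2\Big)\sum_r\partial_r^2+a\sum_i\partial_i^2+a\sum_r\sum_i\langle[X,e_i],e_r\rangle\partial_r\partial_i.$$ An eigenfunction with eigenvalue $\beta^2-\rho^2$ is a smooth function $u$ with $\mathcal Lu=(\beta^2-\rho^2)u$; positive means $u>0$ everywhere on $S$. Measures and kernels. A positive measure on $N$ is a nonnegative Borel measure finite on compact sets. Let $P(X,Z)=c_{p,k}\big((1+\|X\|^2/4)^2+\|Z\|^2\big)^{-Q}$, with $c_{p,k}>0$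 such that $\int_NP\,dm=1$. For $\beta>0$ let $q^{i\beta}(n)=C_{i\beta}[P(n)/P(\underline0)]^{\frac12+\frac\beta Q}$, with $C_{i\beta}>0$ such that $\int_Nq^{i\beta}\,dm=1$, and $q_a^{i\beta}(n)=a^{-Q}q^{i\beta}(\delta_{a^{-1}}(n))$. For a measure $\mu$ on $N$ put $\mathcal Q_{i\beta}[\mu](n,a)=\int_Nq_a^{i\beta}(n_1^{-1}n)\,d\mu(n_1)$ and $\mathcal P_{i\beta}[\mu](n,a)=a^{\rho-\beta}\mathcal Q_{i\beta}[\mu](n,a)$, when the integral converges absolutely for every $(n,a)\in S$. Boundary measure. By a theorem of Damek and Ricci, for a positive eigenfunction $u$ of $\mathcal L$ with eigenvalue $\beta^2-\rho^2$, $\beta>0$, there are a unique positive measure $\mu$ on $N$ and a unique constant $C\ge0$ with $u(n,a)=Ca^{\beta+\rho}+\mathcal P_{i\beta}[\mu](n,a)$ for all $(n,a)\in S$; $\mu$ is called the boundary measure of $u$. Limits. For $\alpha>0$, $\Gamma_\alpha(n_0)=\{(n,a)\in S: \mathbf d(n_0,n)<\alpha a\}$. A function $v$ on $S$ has admissible limit $L$ at $n_0$ if for each $\alpha>0$, $\lim_{a\to0,\,(n,a)\in\Gamma_\alpha(n_0)}v(n,a)=L$ (i.e. for every $\epsilon>0$ there is $a_0>0$ with $|v(n,a)-L|<\epsilon$ for all $(n,a)\in\Gamma_\alpha(n_0)$ with $a<a_0$). A measure $\mu$ has strong derivative $L\in[0,\infty)$ at $n_0$, written $D\mu(n_0)=L$,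 if $\lim_{r\to0}\mu(n_0\delta_r(B))/m(n_0\delta_r(B))=L$ for every $d$-ball $B\subset N$. *)

theory Defs
  imports "HOL-Analysis.Analysis"
begin

section \<open>Lie algebras of H-type\<close>

text \<open>
  The Lie algebra is carried by the Euclidean space \<open>'v \<times> 'z\<close>, whose inner product makes the two
  factors orthogonal. Requiring the centre to be the second factor forces the first factor to be its
  orthogonal complement. Every Lie algebra of H-type is of this form up to an isometric isomorphism.
  Both dimensions are positive because the algebra is noncommutative.
\<close>

type_synonym ('v, 'z) bracket = "'v \<times> 'z \<Rightarrow> 'v \<times> 'z \<Rightarrow> 'v \<times> 'z"

definition lie_bracket :: "('a::euclidean_space \<Rightarrow> 'a \<Rightarrow> 'a) \<Rightarrow> bool" where
  "lie_bracket br \<longleftrightarrow> bilinear br \<and> (\<forall>x. br x x = 0) \<and>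
     (\<forall>x y z. br x (br y z) + br y (br z x) + br z (br x y) = 0)"

definition two_step :: "('a::euclidean_space \<Rightarrow> 'a \<Rightarrow> 'a) \<Rightarrow> bool" where
  "two_step br \<longleftrightarrow> (\<forall>x y z. br (br x y) z = 0) \<and> (\<exists>x y. br x y \<noteq> 0)"

definition lie_centre :: "('a::euclidean_space \<Rightarrow> 'a \<Rightarrow> 'a) \<Rightarrow> 'a set" where
  "lie_centre br = {z. \<forall>x. br z x = 0}"

text \<open>The bracket of two elements of \<open>\<vv>\<close>, as an element of \<open>\<zz>\<close>; for two-step
  algebras whose centre is the second factor, brackets have no component in \<open>\<vv>\<close>.\<close>

definition vbr :: "('v::euclidean_space, 'z::euclidean_space) bracket \<Rightarrow> 'v \<Rightarrow> 'v \<Rightarrow> 'z" where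
  "vbr br X Y = snd (br (X, 0) (Y, 0))"

definition J :: "('v::euclidean_space, 'z::euclidean_space) bracket \<Rightarrow> 'z \<Rightarrow> 'v \<Rightarrow> 'v" where
  "J br Z X = (THE W. \<forall>Y. W \<bullet> Y = vbr br X Y \<bullet> Z)"

definition H_type :: "('v::euclidean_space, 'z::euclidean_space) bracket \<Rightarrow> bool" where
  "H_type br \<longleftrightarrow> lie_bracket br \<and> two_step br \<and> lie_centre br = {0} \<times> UNIV \<and>
     (\<forall>Z X. J br Z (J br Z X) = - ((norm Z)\<^sup>2 *\<^sub>R X))"


section \<open>The group \<open>N\<close>\<close>

text \<open>With \<open>dim \<vv> = 2p\<close> and \<open>dim \<zz> = k\<close>, \<open>hdim\<close> is \<open>Q = p + k\<close>.\<close>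

definition hdim :: "('v::euclidean_space \<times> 'z::euclidean_space) itself \<Rightarrow> real" where
  "hdim _ = real DIM('v) / 2 + real DIM('z)"

definition rho :: "('v::euclidean_space \<times> 'z::euclidean_space) itself \<Rightarrow> real" where
  "rho T = hdim T / 2"

definition nmul :: "('v::euclidean_space, 'z::euclidean_space) bracket \<Rightarrow> 'v \<times> 'z \<Rightarrow> 'v \<times> 'z \<Rightarrow> 'v \<times> 'z"
  where
  "nmul br = (\<lambda>(X, Z) (X', Z'). (X + X', Z + Z' + (1/2) *\<^sub>R vbr br X X'))"

text \<open>The inverse for \<open>nmul\<close>, since the bracket is alternating.\<close>

definition ninv :: "'v::euclidean_space \<times> 'z::euclidean_space \<Rightarrow> 'v \<times> 'z" where
  "ninv = (\<lambda>(X, Z). (- X, - Z))"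

definition dil :: "real \<Rightarrow> 'v::euclidean_space \<times> 'z::euclidean_space \<Rightarrow> 'v \<times> 'z" where
  "dil a = (\<lambda>(X, Z). (sqrt a *\<^sub>R X, a *\<^sub>R Z))"

definition hgauge :: "'v::euclidean_space \<times> 'z::euclidean_space \<Rightarrow> real" where
  "hgauge = (\<lambda>(X, Z). sqrt (norm X ^ 4 + 16 * (norm Z)\<^sup>2))"

definition hdist :: "('v::euclidean_space, 'z::euclidean_space) bracket \<Rightarrow> 'v \<times> 'z \<Rightarrow> 'v \<times> 'z \<Rightarrow> real"
  where
  "hdist br n1 n2 = hgauge (nmul br (ninv n1) n2)"

definition hball :: "('v::euclidean_space, 'z::euclidean_space) bracket \<Rightarrow> 'v \<times> 'z \<Rightarrow> real \<Rightarrow> ('v \<times> 'z) set"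
  where
  "hball br n r = {n1. hdist br n n1 < r}"


section \<open>The group \<open>S = NA\<close>, its Laplacian and positive eigenfunctions\<close>

definition S_dom :: "(('v::euclidean_space \<times> 'z::euclidean_space) \<times> real) set" where
  "S_dom = UNIV \<times> {0<..}"

definition dir_deriv :: "'a::euclidean_space \<Rightarrow> ('a \<Rightarrow> real) \<Rightarrow> 'a \<Rightarrow> real" where
  "dir_deriv e f x = deriv (\<lambda>t. f (x + t *\<^sub>R e)) 0"

fun Ck_on :: "nat \<Rightarrow> 'a::euclidean_space set \<Rightarrow> ('a \<Rightarrow> real) \<Rightarrow> bool" where
  "Ck_on 0 U f \<longleftrightarrow> continuous_on U f"
| "Ck_on (Suc k) U f \<longleftrightarrow> f differentiable_on U \<and> (\<forall>e\<in>Basis. Ck_on k U (dir_deriv e f))"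

text \<open>Only meant for open \<open>U\<close>.\<close>

definition smooth_on :: "'a::euclidean_space set \<Rightarrow> ('a \<Rightarrow> real) \<Rightarrow> bool" where
  "smooth_on U f \<longleftrightarrow> (\<forall>k. Ck_on k U f)"

abbreviation d_v :: "'v::euclidean_space \<Rightarrow> (('v \<times> 'z::euclidean_space) \<times> real \<Rightarrow> real)
    \<Rightarrow> ('v \<times> 'z) \<times> real \<Rightarrow> real" where
  "d_v e \<equiv> dir_deriv ((e, 0), 0)"

abbreviation d_z :: "'z::euclidean_space \<Rightarrow> (('v::euclidean_space \<times> 'z) \<times> real \<Rightarrow> real)
    \<Rightarrow> ('v \<times> 'z) \<times> real \<Rightarrow> real" where
  "d_z e \<equiv> dir_deriv ((0, e), 0)"

abbreviation d_a :: "(('v::euclidean_space \<times> 'z::euclidean_space) \<times> real \<Rightarrow> real)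
    \<Rightarrow> ('v \<times> 'z) \<times> real \<Rightarrow> real" where
  "d_a \<equiv> dir_deriv ((0, 0), 1)"

definition lap_a :: "('v::euclidean_space, 'z::euclidean_space) bracket
    \<Rightarrow> (('v \<times> 'z) \<times> real \<Rightarrow> real) \<Rightarrow> ('v \<times> 'z) \<times> real \<Rightarrow> real" where
  "lap_a br u = (\<lambda>((X, Z), a).
       a * (a + (norm X)\<^sup>2 / 4) * (\<Sum>f\<in>Basis. d_z f (d_z f u) ((X, Z), a))
     + a * (\<Sum>e\<in>Basis. d_v e (d_v e u) ((X, Z), a))
     + a * (\<Sum>f\<in>Basis. \<Sum>e\<in>Basis. (vbr br X e \<bullet> f) * d_z f (d_v e u) ((X, Z), a)))"

text \<open>The Laplace--Beltrami operator of the left-invariant metric on \<open>S\<close>, in the global coordinates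
  \<open>((X, Z), a)\<close> and the standard orthonormal bases of \<open>\<vv>\<close> and \<open>\<zz>\<close>. With the orthonormal
  left-invariant frame \<open>E\<^sub>e = \<surd>a (\<partial>\<^sub>e + 1/2 \<Sum>\<^sub>f \<langle>[X,e],f\<rangle> \<partial>\<^sub>f)\<close>,
  \<open>E\<^sub>f = a \<partial>\<^sub>f\<close>, \<open>E\<^sub>0 = a \<partial>\<^sub>a\<close> it is
  \<open>\<Sum>\<^sub>e E\<^sub>e\<^sup>2 + \<Sum>\<^sub>f E\<^sub>f\<^sup>2 + E\<^sub>0\<^sup>2 - Q E\<^sub>0\<close>.\<close>

definition laplacian :: "('v::euclidean_space, 'z::euclidean_space) bracket
    \<Rightarrow> (('v \<times> 'z) \<times> real \<Rightarrow> real) \<Rightarrow> ('v \<times> 'z) \<times> real \<Rightarrow> real" where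
  "laplacian br u = (\<lambda>(n, a).
       a\<^sup>2 * d_a (d_a u) (n, a) + lap_a br u (n, a)
     + (1 - hdim TYPE('v \<times> 'z)) * a * d_a u (n, a))"

definition positive_eigenfunction :: "('v::euclidean_space, 'z::euclidean_space) bracket
    \<Rightarrow> real \<Rightarrow> (('v \<times> 'z) \<times> real \<Rightarrow> real) \<Rightarrow> bool" where
  "positive_eigenfunction br ev u \<longleftrightarrow>
     smooth_on S_dom u \<and> (\<forall>x\<in>S_dom. laplacian br u x = ev * u x) \<and> (\<forall>x\<in>S_dom. u x > 0)"


section \<open>Poisson kernels and boundary measures\<close>

definition positive_measure :: "'a::euclidean_space measure \<Rightarrow> bool" where
  "positive_measure \<mu> \<longleftrightarrow> sets \<mu> = sets borel \<and> (\<forall>K. compact K \<longrightarrow> emeasure \<mu> K < \<infinity>)"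

definition P_unnorm :: "'v::euclidean_space \<times> 'z::euclidean_space \<Rightarrow> real" where
  "P_unnorm = (\<lambda>(X, Z). ((1 + (norm X)\<^sup>2 / 4)\<^sup>2 + (norm Z)\<^sup>2) powr (- hdim TYPE('v \<times> 'z)))"

definition P_kernel :: "'v::euclidean_space \<times> 'z::euclidean_space \<Rightarrow> real" where
  "P_kernel n = P_unnorm n / (LINT n'|(lborel :: ('v \<times> 'z) measure). P_unnorm n')"

definition q_unnorm :: "real \<Rightarrow> 'v::euclidean_space \<times> 'z::euclidean_space \<Rightarrow> real" where
  "q_unnorm \<beta> n = (P_kernel n / P_kernel (0 :: 'v \<times> 'z)) powr (1/2 + \<beta> / hdim TYPE('v \<times> 'z))"

text \<open>The kernel with parameter \<open>i\<beta>\<close>, \<open>\<beta>\<close> real.\<close>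

definition q_kernel :: "real \<Rightarrow> 'v::euclidean_space \<times> 'z::euclidean_space \<Rightarrow> real" where
  "q_kernel \<beta> n = q_unnorm \<beta> n / (LINT n'|(lborel :: ('v \<times> 'z) measure). q_unnorm \<beta> n')"

definition q_dil :: "real \<Rightarrow> real \<Rightarrow> 'v::euclidean_space \<times> 'z::euclidean_space \<Rightarrow> real" where
  "q_dil \<beta> a n = a powr (- hdim TYPE('v \<times> 'z)) * q_kernel \<beta> (dil (1 / a) n)"

definition Q_transform :: "('v::euclidean_space, 'z::euclidean_space) bracket \<Rightarrow> real
    \<Rightarrow> ('v \<times> 'z) measure \<Rightarrow> ('v \<times> 'z) \<times> real \<Rightarrow> real" where
  "Q_transform br \<beta> \<mu> = (\<lambda>(n, a). LINT n1|\<mu>. q_dil \<beta> a (nmul br (ninv n1) n))"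

definition P_transform :: "('v::euclidean_space, 'z::euclidean_space) bracket \<Rightarrow> real
    \<Rightarrow> ('v \<times> 'z) measure \<Rightarrow> ('v \<times> 'z) \<times> real \<Rightarrow> real" where
  "P_transform br \<beta> \<mu> = (\<lambda>(n, a). a powr (rho TYPE('v \<times> 'z) - \<beta>) * Q_transform br \<beta> \<mu> (n, a))"

text \<open>\<open>P_transform\<close> is meaningful only if its integral converges absolutely at every point, which is
  what \<open>P_defined\<close> says.\<close>

definition P_defined :: "('v::euclidean_space, 'z::euclidean_space) bracket \<Rightarrow> real
    \<Rightarrow> ('v \<times> 'z) measure \<Rightarrow> bool" where
  "P_defined br \<beta> \<mu> \<longleftrightarrow>
     (\<forall>n. \<forall>a>0. integrable \<mu> (\<lambda>n1. q_dil \<beta> a (nmul br (ninv n1) n)))"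

text \<open>\<open>\<mu>\<close> is the boundary measure of \<open>u\<close>, for the eigenvalue \<open>\<beta>\<^sup>2 - \<rho>\<^sup>2\<close>. By a theorem of Damek and
  Ricci, every positive eigenfunction has exactly one such \<open>\<mu>\<close>, with exactly one constant \<open>C\<close>.\<close>

definition boundary_measure :: "('v::euclidean_space, 'z::euclidean_space) bracket \<Rightarrow> real
    \<Rightarrow> (('v \<times> 'z) \<times> real \<Rightarrow> real) \<Rightarrow> ('v \<times> 'z) measure \<Rightarrow> bool" where
  "boundary_measure br \<beta> u \<mu> \<longleftrightarrow> positive_measure \<mu> \<and> P_defined br \<beta> \<mu> \<and>
     (\<exists>C\<ge>0. \<forall>n. \<forall>a>0.
        u (n, a) = C * a powr (\<beta> + rho TYPE('v \<times> 'z)) + P_transform br \<beta> \<mu> (n, a))"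


section \<open>Limits at the boundary and the strong derivative\<close>

definition cone :: "('v::euclidean_space, 'z::euclidean_space) bracket \<Rightarrow> real \<Rightarrow> 'v \<times> 'z
    \<Rightarrow> (('v \<times> 'z) \<times> real) set" where
  "cone br \<alpha> n0 = {(n, a). a > 0 \<and> hdist br n0 n < \<alpha> * a}"

definition cone_limit :: "('v::euclidean_space, 'z::euclidean_space) bracket \<Rightarrow> real
    \<Rightarrow> (('v \<times> 'z) \<times> real \<Rightarrow> real) \<Rightarrow> 'v \<times> 'z \<Rightarrow> real \<Rightarrow> bool" where
  "cone_limit br \<alpha> v n0 L \<longleftrightarrow>
     (\<forall>\<epsilon>>0. \<exists>a0>0. \<forall>(n, a)\<in>cone br \<alpha> n0. a < a0 \<longrightarrow> \<bar>v (n, a) - L\<bar> < \<epsilon>)"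

definition admissible_limit :: "('v::euclidean_space, 'z::euclidean_space) bracket
    \<Rightarrow> (('v \<times> 'z) \<times> real \<Rightarrow> real) \<Rightarrow> 'v \<times> 'z \<Rightarrow> real \<Rightarrow> bool" where
  "admissible_limit br v n0 L \<longleftrightarrow> (\<forall>\<alpha>>0. cone_limit br \<alpha> v n0 L)"

definition strong_derivative :: "('v::euclidean_space, 'z::euclidean_space) bracket
    \<Rightarrow> ('v \<times> 'z) measure \<Rightarrow> 'v \<times> 'z \<Rightarrow> real \<Rightarrow> bool" where
  "strong_derivative br \<mu> n0 L \<longleftrightarrow>
     (\<forall>n1. \<forall>s>0.
        ((\<lambda>r. measure \<mu> (nmul br n0 ` dil r ` hball br n1 s)
            / measure lborel (nmul br n0 ` dil r ` hball br n1 s)) \<longlongrightarrow> L) (at_right 0))"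

end

theory Submission
  imports Defs "HOL-Complex_Analysis.Complex_Analysis"
begin

text \<open>
  Up to the term \<open>C a\<^sup>2\<^sup>\<beta>\<close>, the normalised eigenfunction is the Poisson integral of \<open>\<mu>\<close>. Its values along
  the cone at \<open>n\<^sub>0\<close> are the values at fixed points of the Poisson integrals of the rescaled measures
  \<open>\<mu>\<^sub>r(E) = r\<^sup>-\<^sup>Q \<mu>(n\<^sub>0 \<delta>\<^sub>r E)\<close>, and the strong derivative is \<open>L\<close> iff \<open>\<mu>\<^sub>r(B) \<rightarrow> L m(B)\<close> for every ball \<open>B\<close>.

  For the first implication, fix \<open>n\<close>. The Poisson integral of \<open>\<mu>\<^sub>r\<close> at \<open>(n, a)\<close> extends holomorphically to
  \<open>Re a > 0\<close>, locally boundedly in \<open>r\<close>, and converges for all large real \<open>a\<close>, since these lie in the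
  cone. By Vitali's theorem it converges for all \<open>a > 0\<close>, hence for every \<open>(n, a)\<close> in \<open>S\<close>. Integrating
  over slightly smaller and larger balls and letting \<open>a \<rightarrow> 0\<close> gives the convergence of \<open>\<mu>\<^sub>r(B)\<close>.

  Conversely, by a Harnack inequality the Poisson kernel hardly changes when it is averaged over small
  balls, and the averaged integrals only involve \<open>\<mu>\<^sub>r(B)\<close>; the growth of \<open>\<mu>\<close> near \<open>n\<^sub>0\<close> controls the tails.
\<close>

section \<open>Lebesgue integrals and holomorphic functions\<close>

text \<open>Up to the factor \<open>a powr (2 * \<beta>)\<close> and a constant, the kernel is the
  power \<open>- (Q + 2 * \<beta>)\<close> of the Euclidean norm of the vector (a + |X|^2/4, Z). The
  triangle inequality for such vectors yields every comparison between kernels, and |w|^2 = w * cnj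
  w yields the extension to complex heights. In the first implication the hypothesis concerns a
  single aperture: after rescaling, the cone reaches (n, a) only for a >
  \<open>hg n / \<theta>\<close>, while the masses of balls are recovered from a near 0.
  Continuation in a bridges this gap. The local bounds it requires come from the vertical line over
  \<open>n0\<close>: boundedness of the Poisson integral there bounds all small-scale blow-ups
  against the single weight \<open>pgauge 1 x powr - (Q + 2 * \<beta>)\<close>. In the second
  implication the derivative controls \<mu> only near \<open>n0\<close>. The part of \<mu> near
  \<open>n0\<close> has growth t^Q with one constant at all scales, and the remaining part
  contributes a multiple of r^(2\<beta>), by absolute convergence of the Poisson integral. Limits as
  r tends to 0 are tested along sequences, the form in which Montel's theorem and dominated
  convergence apply.\<close>

lemma nn_integral_lborel_translate:
  fixes f :: "'a::euclidean_space \<Rightarrow> ennreal"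
  assumes "f \<in> borel_measurable borel"
  shows "(\<integral>\<^sup>+x. f (c + x) \<partial>lborel) = integral\<^sup>N lborel f"
proof -
  have "integral\<^sup>N lborel f = integral\<^sup>N (distr lborel borel ((+) c)) f"
    by (simp only: lborel_distr_plus)
  also have "\<dots> = (\<integral>\<^sup>+x. f (c + x) \<partial>lborel)"
    using assms by (subst nn_integral_distr) auto
  finally show ?thesis by simp
qed

lemma nn_integral_lborel_scaleR:
  fixes f :: "'a::euclidean_space \<Rightarrow> ennreal"
  assumes [measurable]: "f \<in> borel_measurable borel" and c: "c > 0"
  shows "(\<integral>\<^sup>+x. f (c *\<^sub>R x) \<partial>lborel) = ennreal (c powr - real DIM('a)) * integral\<^sup>N lborel f"
proof -
  have "integral\<^sup>N lborel f
      = integral\<^sup>N (density (distr lborel borel (\<lambda>x::'a. 0 + c *\<^sub>R x)) (\<lambda>_. ennreal (\<bar>c\<bar> ^ DIM('a)))) f"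
    using arg_cong[OF lborel_affine[of c "0::'a"], of "\<lambda>M. integral\<^sup>N M f"] c by simp
  also have "\<dots> = ennreal (c ^ DIM('a)) * (\<integral>\<^sup>+x. f (c *\<^sub>R x) \<partial>lborel)"
    using c by (simp add: nn_integral_density nn_integral_distr nn_integral_cmult)
  finally have "ennreal (c powr - real DIM('a)) * integral\<^sup>N lborel f
      = ennreal (c powr - real DIM('a)) * ennreal (c ^ DIM('a)) * (\<integral>\<^sup>+x. f (c *\<^sub>R x) \<partial>lborel)"
    by (simp add: mult.assoc)
  also have "ennreal (c powr - real DIM('a)) * ennreal (c ^ DIM('a)) = 1"
    using c by (simp add: ennreal_mult[symmetric] powr_realpow[symmetric] powr_add[symmetric] del: powr_minus)
  finally show ?thesis by simp
qed

lemma nn_integral_lborel_Pair: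
  fixes f :: "'a::euclidean_space \<times> 'b::euclidean_space \<Rightarrow> ennreal"
  assumes [measurable]: "f \<in> borel_measurable borel"
  shows "integral\<^sup>N lborel f = (\<integral>\<^sup>+x. \<integral>\<^sup>+y. f (x, y) \<partial>lborel \<partial>lborel)"
proof -
  have "f \<in> borel_measurable (lborel \<Otimes>\<^sub>M lborel)"
    using assms by (simp add: lborel_prod)
  from lborel.nn_integral_fst[OF this] show ?thesis by (simp add: lborel_prod)
qed

text \<open>The bound comes from the dyadic shells \<open>2\<^sup>k T \<le> g < 2\<^sup>k\<^sup>+\<^sup>1 T\<close>.\<close>

lemma nn_integral_tail_le:
  fixes g :: "'a \<Rightarrow> real" and q \<tau> B T :: real
  assumes [measurable]: "g \<in> borel_measurable M"
    and growth: "\<And>t. t > 0 \<Longrightarrow> emeasure M {x \<in> space M. g x < t} \<le> ennreal (B * t powr q)"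
    and pos: "\<tau> > 0" "q \<ge> 0" "B \<ge> 0" "T > 0"
  shows "(\<integral>\<^sup>+x. indicator {x. T \<le> g x} x * ennreal (g x powr - (q + \<tau>)) \<partial>M)
      \<le> ennreal (B * 2 powr q / (1 - 2 powr - \<tau>) * T powr - \<tau>)"
proof -
  define a where "a k = T * 2 ^ k" for k :: nat
  have a: "a k > 0" "a (Suc k) = 2 * a k" for k using pos by (auto simp: a_def)
  \<comment> \<open>Each term charges a whole sublevel set instead of a shell, because
    \<open>growth\<close> bounds only sublevel sets. The outer radius is twice the inner one, which
    costs the factor \<open>2 powr q\<close> and leaves a geometric series of ratio
    \<open>2 powr - \<tau>\<close>.\<close>
  define F where "F x k = ennreal (a k powr - (q + \<tau>)) * indicator {x \<in> space M. g x < a (Suc k)} x" for x k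
  have pw: "indicator {x. T \<le> g x} x * ennreal (g x powr - (q + \<tau>)) \<le> (\<Sum>k. F x k)"
    if x: "x \<in> space M" for x
  proof (cases "T \<le> g x")
    case True
    obtain n where "g x / T < 2 ^ n" using real_arch_pow[of 2] by auto
    then have n: "g x < a n" using pos by (simp add: a_def field_simps)
    obtain k where k: "\<not> g x < a k" "g x < a (Suc k)"
      using ex_least_nat_less[of "\<lambda>n. g x < a n" n] n True by (auto simp: a_def)
    have "indicator {x. T \<le> g x} x * ennreal (g x powr - (q + \<tau>)) \<le> F x k"
      unfolding F_def using k a[of k] x pos True by (auto intro!: ennreal_leI powr_mono2')
    also have "F x k = sum (F x) {k}" by simp
    also have "\<dots> \<le> (\<Sum>k. F x k)"
      by (rule sum_le_suminf) auto
    finally show ?thesis .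
  qed simp
  have geo: "(\<lambda>k. B * 2 powr q * T powr - \<tau> * (2 powr - \<tau>) ^ k) sums (B * 2 powr q * T powr - \<tau> * (1 / (1 - 2 powr - \<tau>)))"
    using pos by (intro sums_mult geometric_sums) (auto simp: powr_minus field_simps)
  have "(\<integral>\<^sup>+x. indicator {x. T \<le> g x} x * ennreal (g x powr - (q + \<tau>)) \<partial>M)
      \<le> (\<integral>\<^sup>+x. (\<Sum>k. ennreal (a k powr - (q + \<tau>)) * indicator {x \<in> space M. g x < a (Suc k)} x) \<partial>M)"
    by (rule nn_integral_mono) (rule pw [unfolded F_def])
  also have "\<dots> = (\<Sum>k. \<integral>\<^sup>+x. ennreal (a k powr - (q + \<tau>)) * indicator {x \<in> space M. g x < a (Suc k)} x \<partial>M)"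
    by (rule nn_integral_suminf) measurable
  also have "\<dots> = (\<Sum>k. ennreal (a k powr - (q + \<tau>)) * emeasure M {x \<in> space M. g x < a (Suc k)})"
    by (subst nn_integral_cmult_indicator) auto
  also have "\<dots> \<le> (\<Sum>k. ennreal (B * 2 powr q * T powr - \<tau> * (2 powr - \<tau>) ^ k))"
  proof (intro suminf_le)
    fix k
    have "ennreal (a k powr - (q + \<tau>)) * emeasure M {x \<in> space M. g x < a (Suc k)}
        \<le> ennreal (a k powr - (q + \<tau>)) * ennreal (B * a (Suc k) powr q)"
      using growth[OF a(1), of "Suc k"] by (intro mult_left_mono) auto
    also have "\<dots> = ennreal (B * 2 powr q * (a k powr - (q + \<tau>) * a k powr q))"
      using a pos by (simp add: ennreal_mult[symmetric] powr_mult mult_ac less_imp_le)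
    also have "a k powr - (q + \<tau>) * a k powr q = a k powr - \<tau>"
      by (simp add: powr_add[symmetric])
    also have "\<dots> = T powr - \<tau> * (2 powr - \<tau>) ^ k"
      using pos by (simp add: a_def powr_mult powr_realpow[symmetric] powr_powr mult.commute)
    finally show "ennreal (a k powr - (q + \<tau>)) * emeasure M {x \<in> space M. g x < a (Suc k)}
        \<le> ennreal (B * 2 powr q * T powr - \<tau> * (2 powr - \<tau>) ^ k)" by (simp add: mult.assoc)
  qed auto
  also have "\<dots> = ennreal (B * 2 powr q * T powr - \<tau> * (1 / (1 - 2 powr - \<tau>)))"
    using pos geo by (intro suminf_ennreal_eq) auto
  finally show ?thesis by (simp add: mult_ac)
qed

text \<open>A local integrable bound on the functions themselves suffices: Cauchy's inequality turns
  it into a bound on the derivatives in a disc of half the radius, hence on the difference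
  quotients, and dominated convergence differentiates under the integral.\<close>

lemma holomorphic_on_lebesgue_integral:
  fixes f :: "complex \<Rightarrow> 'a \<Rightarrow> complex"
  assumes S: "open S"
    and hol: "\<And>x. x \<in> space M \<Longrightarrow> (\<lambda>z. f z x) holomorphic_on S"
    and meas: "\<And>z. z \<in> S \<Longrightarrow> f z \<in> borel_measurable M"
    and dom: "\<And>z0. z0 \<in> S \<Longrightarrow> \<exists>r>0. \<exists>g. cball z0 r \<subseteq> S \<and> integrable M g \<and>
                (\<forall>z\<in>cball z0 r. \<forall>x\<in>space M. norm (f z x) \<le> g x)"
  shows "(\<lambda>z. LINT x|M. f z x) holomorphic_on S"
  unfolding holomorphic_on_open[OF S]
proof
  fix z0 assume z0: "z0 \<in> S"
  from dom[OF z0] obtain r g where r: "r > 0" "cball z0 r \<subseteq> S" and g: "integrable M g"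
    and fg: "\<And>z x. z \<in> cball z0 r \<Longrightarrow> x \<in> space M \<Longrightarrow> norm (f z x) \<le> g x" by blast
  have int: "integrable M (f z)" if "z \<in> cball z0 r" for z
  proof (rule Bochner_Integration.integrable_bound[OF g])
    show "f z \<in> borel_measurable M" using that r by (intro meas) auto
    show "AE x in M. norm (f z x) \<le> norm (g x)"
      using fg[OF that] by (intro AE_I2) (auto intro: order_trans[OF _ abs_ge_self])
  qed
  \<comment> \<open>A disc of radius \<open>r / 2\<close> about a point of
    \<open>ball z0 (r / 2)\<close> stays inside \<open>cball z0 r\<close>, where g
    dominates.\<close>
  have deriv_le: "norm (deriv (\<lambda>z. f z x) w) \<le> g x / (r / 2)" if w: "w \<in> ball z0 (r / 2)" and x: "x \<in> space M" for w x
  proof -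
    have sub: "cball w (r / 2) \<subseteq> cball z0 r"
    proof
      fix v assume "v \<in> cball w (r / 2)"
      then show "v \<in> cball z0 r" using w dist_triangle[of z0 v w] by (auto simp: dist_commute)
    qed
    have h: "(\<lambda>z. f z x) holomorphic_on cball w (r / 2)"
      by (rule holomorphic_on_subset[OF hol[OF x]]) (use sub r in blast)
    have "norm ((deriv ^^ 1) (\<lambda>z. f z x) w) \<le> fact 1 * g x / (r / 2) ^ 1"
    proof (rule Cauchy_inequality)
      show "norm (f y x) \<le> g x" if "norm (w - y) = r / 2" for y
        using sub x that by (intro fg) (auto simp: dist_norm)
    qed (use h r holomorphic_on_subset[OF h ball_subset_cball] in \<open>auto intro: holomorphic_on_imp_continuous_on\<close>)
    then show ?thesis by simp
  qed
  define B where "B = ball z0 (r / 2)"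
  have B: "open B" "z0 \<in> B" "B \<subseteq> cball z0 r" "convex B" using r by (auto simp: B_def)
  have lip: "norm (f w x - f z0 x) \<le> g x / (r / 2) * norm (w - z0)" if "w \<in> B" "x \<in> space M" for w x
  proof (rule field_differentiable_bound[OF B(4)])
    fix z assume z: "z \<in> B"
    show "((\<lambda>z. f z x) has_field_derivative deriv (\<lambda>z. f z x) z) (at z within B)"
      by (rule has_field_derivative_at_within[OF holomorphic_derivI[OF hol[OF that(2)] S]])
         (use z B r in blast)
    show "norm (deriv (\<lambda>z. f z x) z) \<le> g x / (r / 2)"
      using z deriv_le that by (simp add: B_def)
  qed (use that B in auto)
  have lim: "(\<lambda>i. (f (X i) x - f z0 x) / (X i - z0)) \<longlonglongrightarrow> deriv (\<lambda>z. f z x) z0"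
    if X: "\<And>i. X i \<in> B - {z0}" "X \<longlonglongrightarrow> z0" and x: "x \<in> space M" for X x
  proof -
    have "((\<lambda>z. f z x) has_field_derivative deriv (\<lambda>z. f z x) z0) (at z0 within B)"
      by (rule has_field_derivative_at_within[OF holomorphic_derivI[OF hol[OF x] S z0]])
    then have "((\<lambda>y. (f y x - f z0 x) / (y - z0)) \<longlongrightarrow> deriv (\<lambda>z. f z x) z0) (at z0 within B)"
      by (simp add: has_field_derivative_iff)
    then show ?thesis using X unfolding tendsto_at_iff_sequentially by (auto simp: comp_def)
  qed
  have "((\<lambda>y. ((LINT x|M. f y x) - (LINT x|M. f z0 x)) / (y - z0)) \<longlongrightarrow> (LINT x|M. deriv (\<lambda>z. f z x) z0)) (at z0 within B)"
    unfolding tendsto_at_iff_sequentially comp_def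
  proof (intro allI impI)
    fix X assume X: "\<forall>i. X i \<in> B - {z0}" "X \<longlonglongrightarrow> z0"
    have XB: "X i \<in> cball z0 r" "X i \<in> S" "X i \<noteq> z0" for i using X B r by auto
    have m: "(\<lambda>x. (f (X i) x - f z0 x) / (X i - z0)) \<in> borel_measurable M" for i
      using meas[OF XB(2)[of i]] meas[OF z0] by measurable
    have "(\<lambda>i. LINT x|M. (f (X i) x - f z0 x) / (X i - z0)) \<longlonglongrightarrow> (LINT x|M. deriv (\<lambda>z. f z x) z0)"
    proof (rule integral_dominated_convergence)
      \<comment> \<open>Measurability of the derivative in x is inherited from the difference
        quotients, of which it is the pointwise limit along \<open>X\<close>.\<close>
      show "(\<lambda>x. deriv (\<lambda>z. f z x) z0) \<in> borel_measurable M"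
        by (rule borel_measurable_LIMSEQ_metric[OF m lim[OF X(1)[rule_format] X(2)]])
      show "integrable M (\<lambda>x. g x / (r / 2))" using g by simp
      show "AE x in M. norm ((f (X i) x - f z0 x) / (X i - z0)) \<le> g x / (r / 2)" for i
      proof (rule AE_I2)
        fix x assume x: "x \<in> space M"
        have "X i \<in> B" using X by auto
        from lip[OF this x] show "norm ((f (X i) x - f z0 x) / (X i - z0)) \<le> g x / (r / 2)"
          using XB(3)[of i] by (simp add: norm_divide pos_divide_le_eq)
      qed
      show "AE x in M. (\<lambda>i. (f (X i) x - f z0 x) / (X i - z0)) \<longlonglongrightarrow> deriv (\<lambda>z. f z x) z0"
        by (intro AE_I2 lim[OF X(1)[rule_format] X(2)])
    qed (rule m)
    moreover have "(LINT x|M. (f (X i) x - f z0 x) / (X i - z0)) = ((LINT x|M. f (X i) x) - (LINT x|M. f z0 x)) / (X i - z0)" for i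
      using int[OF XB(1)] int[of z0] r by simp
    ultimately show "(\<lambda>i. ((LINT x|M. f (X i) x) - (LINT x|M. f z0 x)) / (X i - z0)) \<longlonglongrightarrow> (LINT x|M. deriv (\<lambda>z. f z x) z0)"
      by (simp only:)
  qed
  then have "((\<lambda>z. LINT x|M. f z x) has_field_derivative (LINT x|M. deriv (\<lambda>z. f z x) z0)) (at z0 within B)"
    by (simp add: has_field_derivative_iff)
  then show "\<exists>f'. ((\<lambda>z. LINT x|M. f z x) has_field_derivative f') (at z0)"
    using B at_within_open[of z0 B] by auto
qed

text \<open>If convergence failed at w, some subsequence would stay at distance e from
  \<open>G w\<close>. Montel's theorem extracts from it a further subsequence with a holomorphic
  limit, which agrees with \<open>G\<close> on \<open>U\<close> and therefore on all of
  \<open>S\<close> by the identity theorem, a contradiction at w.\<close>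

lemma vitali_convergence:
  fixes H :: "nat \<Rightarrow> complex \<Rightarrow> complex"
  assumes S: "open S" "connected S" and hol: "\<And>j. H j holomorphic_on S" "G holomorphic_on S"
    and bnd: "\<And>K. compact K \<Longrightarrow> K \<subseteq> S \<Longrightarrow> \<exists>B. \<forall>j. \<forall>z\<in>K. norm (H j z) \<le> B"
    and U: "U \<subseteq> S" "\<xi> \<in> S" "\<xi> islimpt U" and lim: "\<And>z. z \<in> U \<Longrightarrow> (\<lambda>j. H j z) \<longlonglongrightarrow> G z"
    and w: "w \<in> S"
  shows "(\<lambda>j. H j w) \<longlonglongrightarrow> G w"
proof (rule ccontr)
  assume "\<not> ?thesis"
  then obtain e where e: "e > 0" "\<not> eventually (\<lambda>j. dist (H j w) (G w) < e) sequentially"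
    unfolding tendsto_iff by blast
  from not_eventually_sequentiallyD[OF e(2)] obtain q :: "nat \<Rightarrow> nat"
    where q: "strict_mono q" "\<And>n. \<not> dist (H (q n) w) (G w) < e" by auto
  obtain h r where h: "h holomorphic_on S" and r: "strict_mono r"
    and hlim: "\<And>x. x \<in> S \<Longrightarrow> ((\<lambda>n. (H \<circ> q) (r n) x) \<longlongrightarrow> h x) sequentially"
  proof (rule Montel[of S "range H" "H \<circ> q"])
    show "\<And>h. h \<in> range H \<Longrightarrow> h holomorphic_on S" using hol by auto
    show "\<exists>B. \<forall>h\<in>range H. \<forall>z\<in>K. norm (h z) \<le> B" if "compact K" "K \<subseteq> S" for K
      using bnd[OF that] by auto
  qed (use S in auto)
  have qr: "strict_mono (q \<circ> r)" using q r by (simp add: strict_mono_o)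
  have eq: "h z - G z = 0" if "z \<in> U" for z
  proof -
    have "(\<lambda>n. H ((q \<circ> r) n) z) \<longlonglongrightarrow> G z"
      using LIMSEQ_subseq_LIMSEQ[OF lim[OF that] qr] by (simp add: comp_def)
    moreover have "(\<lambda>n. H ((q \<circ> r) n) z) \<longlonglongrightarrow> h z"
      using hlim[of z] that U by (auto simp: comp_def)
    ultimately have "h z = G z" using LIMSEQ_unique by blast
    then show ?thesis by simp
  qed
  have "h w - G w = 0"
    using analytic_continuation[of "\<lambda>z. h z - G z" S U \<xi> w] h hol S U w eq
    by (auto intro!: holomorphic_intros)
  then have "(\<lambda>n. H (q (r n)) w) \<longlonglongrightarrow> G w" using hlim[OF w] by (simp add: comp_def)
  then have "eventually (\<lambda>n. dist (H (q (r n)) w) (G w) < e) sequentially"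
    using e by (auto simp: tendsto_iff)
  then show False using q(2) by (auto simp: eventually_sequentially)
qed

section \<open>The Poisson kernel at complex heights\<close>

definition ckernel :: "real \<Rightarrow> real \<Rightarrow> real \<Rightarrow> complex \<Rightarrow> complex" where
  "ckernel \<sigma> c d z = (z + Complex c d) powr - of_real (\<sigma> / 2) * (z + Complex c (- d)) powr - of_real (\<sigma> / 2)"

text \<open>For c \<ge> 0 both bases have positive real part on the right half plane, so they avoid
  the branch cut of the principal power.\<close>

lemma ckernel_holomorphic: "c \<ge> 0 \<Longrightarrow> ckernel \<sigma> c d holomorphic_on {z. Re z > 0}"
  unfolding ckernel_def by (intro holomorphic_intros) (auto simp: complex_nonpos_Reals_iff)

text \<open>At a real height the two factors are complex conjugates, so their product is the squared
  modulus of either. Splitting the norm this way is what replaces the non-holomorphic modulus in the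
  kernel by holomorphic powers.\<close>

lemma ckernel_of_real:
  assumes "c \<ge> 0" "a > 0"
  shows "ckernel \<sigma> c d (of_real a) = of_real (norm (a + c, d) powr - \<sigma>)"
proof -
  define w where "w = of_real a + Complex c d"
  have w: "Re w > 0" "norm w = norm (a + c, d)" using assms by (auto simp: w_def norm_Pair cmod_def)
  have "of_real a + Complex c (- d) = cnj w" by (simp add: w_def complex_eq_iff)
  then have "ckernel \<sigma> c d (of_real a) = w powr - of_real (\<sigma> / 2) * cnj (w powr - of_real (\<sigma> / 2))"
    using w by (simp add: ckernel_def w_def cnj_powr)
  also have "\<dots> = of_real ((norm (w powr - of_real (\<sigma> / 2)))\<^sup>2)"
    by (rule complex_norm_square[symmetric])
  also have "norm (w powr - of_real (\<sigma> / 2)) = norm w powr - (\<sigma> / 2)"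
    by (subst norm_powr_real_powr') auto
  also have "(norm w powr - (\<sigma> / 2))\<^sup>2 = norm w powr - \<sigma>"
    using w by (simp add: power2_eq_square powr_add[symmetric])
  finally show ?thesis by (simp add: w)
qed

text \<open>Compares the kernel on Re z \<ge> x0, |Im z| \<le> Y with the real kernel at height 1,
  uniformly in c and d, so that one integrable weight dominates a whole compact set of heights. With
  w = z + c \<plusminus> id one has 1 + c + d \<le> (1 + Y) + Re w + |Im w|; the last two terms cost
  2|w|, and 1 + Y costs (1 + Y)/x0 times |w| because |w| \<ge> x0. This is the origin of the
  constant.\<close>

lemma ckernel_bound:
  assumes "c \<ge> 0" "d \<ge> 0" "\<sigma> > 0" "x0 > 0" "Re z \<ge> x0" "\<bar>Im z\<bar> \<le> Y"
  shows "norm (ckernel \<sigma> c d z) \<le> ((1 + Y) / x0 + 2) powr \<sigma> * norm (1 + c, d) powr - \<sigma>"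
proof -
  define g where "g = (1 + Y) / x0 + 2"
  have Y: "Y \<ge> 0" using assms by simp
  have g: "g > 0" using assms Y by (simp add: g_def add_nonneg_pos)
  have n0: "norm (1 + c, d) > 0" using assms by (simp add: norm_Pair add_pos_nonneg)
  have *: "norm (1 + c, d) / g \<le> norm (z + Complex c e)" if "\<bar>e\<bar> = d" for e
  proof -
    let ?w = "z + Complex c e"
    have "norm (1 + c, d) \<le> (1 + c) + d" using norm_Pair_le[of "1 + c" d] assms by simp
    moreover have "d \<le> \<bar>Im ?w\<bar> + Y"
    proof -
      have "Im ?w = Im z + e" by simp
      then show ?thesis using that assms(6) by linarith
    qed
    moreover have "\<bar>Im ?w\<bar> \<le> norm ?w" by (rule abs_Im_le_cmod)
    moreover have "Re ?w \<le> norm ?w" by (rule complex_Re_le_cmod)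
    moreover have "x0 \<le> Re ?w" "c \<le> Re ?w" using assms by auto
    moreover have "1 + Y \<le> (1 + Y) / x0 * norm ?w"
    proof -
      have "x0 \<le> norm ?w" using calculation by linarith
      then have "(1 + Y) / x0 * x0 \<le> (1 + Y) / x0 * norm ?w"
        using Y assms by (intro mult_left_mono) auto
      then show ?thesis using assms by simp
    qed
    ultimately have "norm (1 + c, d) \<le> g * norm ?w" by (simp add: g_def distrib_right)
    then show ?thesis using g by (simp add: pos_divide_le_eq mult.commute)
  qed
  have **: "norm ((z + Complex c e) powr - of_real (\<sigma> / 2)) \<le> (norm (1 + c, d) / g) powr - (\<sigma> / 2)" if "\<bar>e\<bar> = d" for e
  proof -
    have "norm ((z + Complex c e) powr - of_real (\<sigma> / 2)) = norm (z + Complex c e) powr - (\<sigma> / 2)"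
      by (subst norm_powr_real_powr') auto
    also have "\<dots> \<le> (norm (1 + c, d) / g) powr - (\<sigma> / 2)"
      using *[OF that] n0 g assms by (intro powr_mono2') auto
    finally show ?thesis .
  qed
  have "norm (ckernel \<sigma> c d z) \<le> (norm (1 + c, d) / g) powr - (\<sigma> / 2) * (norm (1 + c, d) / g) powr - (\<sigma> / 2)"
    unfolding ckernel_def norm_mult using assms by (intro mult_mono **) auto
  also have "\<dots> = (norm (1 + c, d) / g) powr - \<sigma>" by (simp add: powr_add[symmetric])
  also have "\<dots> = g powr \<sigma> * norm (1 + c, d) powr - \<sigma>"
    using g by (simp add: powr_divide powr_minus field_simps)
  finally show ?thesis by (simp add: g_def)
qed

lemma tendsto_divide_const_iff:
  fixes f :: "'a \<Rightarrow> real"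
  assumes "k > 0"
  shows "((\<lambda>x. f x / k) \<longlongrightarrow> L) F \<longleftrightarrow> (f \<longlongrightarrow> L * k) F"
  using assms tendsto_mult[OF _ tendsto_const[of k], of "\<lambda>x. f x / k" L F]
    tendsto_divide[OF _ tendsto_const[of k], of f "L * k" F] by auto


section \<open>Two-step groups\<close>

text \<open>Bilinearity and alternation of \<open>vbr\<close> make \<open>nmul\<close> a group law
  with inverse \<open>ninv\<close> and make the \<open>dil\<close> automorphisms. \<open>Q\<close>
  is a parameter tied by an equation to \<open>hdim TYPE('v \<times> 'z)\<close>, which keeps the
  type argument out of all exponents.\<close>

locale step_two_group =
  fixes br :: "('v::euclidean_space, 'z::euclidean_space) bracket"
  assumes bounded_bilinear_vbr: "bounded_bilinear (vbr br)"
    and vbr_self [simp]: "vbr br X X = 0"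
  fixes Q :: real
  assumes Q_def: "Q = hdim TYPE('v \<times> 'z)"
begin

sublocale vbr: bounded_bilinear "vbr br"
  by (rule bounded_bilinear_vbr)

abbreviation mul :: "'v \<times> 'z \<Rightarrow> 'v \<times> 'z \<Rightarrow> 'v \<times> 'z" (infixl \<open>\<cdot>\<close> 70)
  where "x \<cdot> y \<equiv> nmul br x y"

text \<open>The gauge at the type of the group; otherwise its type is not inferred under integrals.\<close>

abbreviation hg :: "'v \<times> 'z \<Rightarrow> real" where "hg \<equiv> hgauge"

lemma Q_pos: "Q > 0"
  by (simp add: Q_def hdim_def add_pos_pos)

section \<open>Group laws, inverses and dilations in coordinates\<close>

lemma fst_mul [simp]: "fst (x \<cdot> y) = fst x + fst y"
  and snd_mul [simp]: "snd (x \<cdot> y) = snd x + snd y + (1/2) *\<^sub>R vbr br (fst x) (fst y)"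
  by (simp_all add: nmul_def split_beta)

lemma fst_ninv [simp]: "fst (ninv x) = - fst x" and snd_ninv [simp]: "snd (ninv x) = - snd x"
  for x :: "'v \<times> 'z"
  by (simp_all add: ninv_def split_beta)

lemma fst_dil [simp]: "fst (dil a x) = sqrt a *\<^sub>R fst x" and snd_dil [simp]: "snd (dil a x) = a *\<^sub>R snd x"
  for x :: "'v \<times> 'z"
  by (simp_all add: dil_def split_beta)

lemma mul_assoc: "x \<cdot> y \<cdot> z = x \<cdot> (y \<cdot> z)"
  by (rule prod_eqI) (simp_all add: vbr.add_left vbr.add_right algebra_simps)

lemma mul_0_left [simp]: "0 \<cdot> x = x" and mul_0_right [simp]: "x \<cdot> 0 = x"
  by (auto intro!: prod_eqI simp: vbr.zero_left vbr.zero_right)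

lemma ninv_mul_cancel [simp]: "ninv x \<cdot> x = 0" and mul_ninv_cancel [simp]: "x \<cdot> ninv x = 0"
  by (auto intro!: prod_eqI simp: vbr.minus_left vbr.minus_right)

lemma ninv_mul_cancel_left [simp]: "ninv x \<cdot> (x \<cdot> y) = y"
  and mul_ninv_cancel_left [simp]: "x \<cdot> (ninv x \<cdot> y) = y"
  by (simp_all add: mul_assoc [symmetric])

lemma ninv_ninv [simp]: "ninv (ninv x) = x" for x :: "'v \<times> 'z"
  by (auto intro!: prod_eqI)

lemma ninv_0 [simp]: "ninv (0 :: 'v \<times> 'z) = 0"
  by (auto intro!: prod_eqI)

lemma ninv_unique: "x \<cdot> y = 0 \<Longrightarrow> y = ninv x"
  by (metis ninv_mul_cancel_left mul_0_right)

lemma ninv_mul: "ninv (x \<cdot> y) = ninv y \<cdot> ninv x"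
  by (rule ninv_unique [symmetric]) (simp add: mul_assoc)

lemma dil_mul: "a \<ge> 0 \<Longrightarrow> dil a (x \<cdot> y) = dil a x \<cdot> dil a y"
  by (rule prod_eqI) (simp_all add: vbr.scaleR_left vbr.scaleR_right algebra_simps)

lemma dil_ninv: "dil a (ninv x) = ninv (dil a x)" for x :: "'v \<times> 'z"
  by (auto intro!: prod_eqI)

lemma dil_dil: "dil a (dil b x) = dil (a * b) x" for x :: "'v \<times> 'z"
  by (auto intro!: prod_eqI simp: real_sqrt_mult)

lemma dil_1 [simp]: "dil 1 x = x" for x :: "'v \<times> 'z"
  by (auto intro!: prod_eqI)

lemma dil_0 [simp]: "dil a 0 = (0 :: 'v \<times> 'z)"
  by (auto intro!: prod_eqI)

lemma continuous_on_mul [continuous_intros]: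
  "continuous_on A f \<Longrightarrow> continuous_on A g \<Longrightarrow> continuous_on A (\<lambda>x. f x \<cdot> g x)"
  unfolding nmul_def split_beta by (intro continuous_intros vbr.continuous_on)

lemma continuous_on_ninv [continuous_intros]:
  fixes f :: "_ \<Rightarrow> 'v \<times> 'z"
  shows "continuous_on A f \<Longrightarrow> continuous_on A (\<lambda>x. ninv (f x))"
  unfolding ninv_def split_beta by (intro continuous_intros)

lemma continuous_on_dil [continuous_intros]:
  fixes f :: "_ \<Rightarrow> 'v \<times> 'z"
  shows "continuous_on A f \<Longrightarrow> continuous_on A (\<lambda>x. dil a (f x))"
  unfolding dil_def split_beta by (intro continuous_intros)

lemma measurable_mul [measurable (raw)]:
  "f \<in> borel_measurable M \<Longrightarrow> g \<in> borel_measurable M \<Longrightarrow> (\<lambda>x. f x \<cdot> g x) \<in> borel_measurable M"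
  by (rule borel_measurable_continuous_Pair) (auto intro!: continuous_intros)

lemma measurable_ninv [measurable]: "ninv \<in> borel_measurable (borel :: ('v \<times> 'z) measure)"
  by (rule borel_measurable_continuous_onI) (auto intro!: continuous_intros)

lemma measurable_dil [measurable]: "dil a \<in> borel_measurable (borel :: ('v \<times> 'z) measure)"
  by (rule borel_measurable_continuous_onI) (auto intro!: continuous_intros)


subsection \<open>The Poisson gauges\<close>

text \<open>\<open>pgauge 0\<close> is a multiple of the homogeneous gauge, and the Poisson kernels are powers of
  \<open>pgauge a\<close>.\<close>

definition pgauge :: "real \<Rightarrow> 'v \<times> 'z \<Rightarrow> real" where
  "pgauge a x = norm (a + (norm (fst x))\<^sup>2 / 4, snd x)"

lemma hgauge_eq_pgauge: "hg x = 4 * pgauge 0 x"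
proof -
  have "norm (fst x) ^ 4 + 16 * (norm (snd x))\<^sup>2 = 4\<^sup>2 * (((norm (fst x))\<^sup>2 / 4)\<^sup>2 + (norm (snd x))\<^sup>2)"
    by (simp add: power_divide flip: power_mult)
  then show ?thesis
    unfolding hgauge_def pgauge_def norm_Pair split_beta
    by (simp only: real_sqrt_mult) (simp add: real_sqrt_abs)
qed

lemma continuous_on_pgauge [continuous_intros]:
  "continuous_on A f \<Longrightarrow> continuous_on A (\<lambda>x. pgauge a (f x))"
  unfolding pgauge_def by (intro continuous_intros) auto

lemma measurable_pgauge [measurable]: "pgauge a \<in> borel_measurable borel"
  by (rule borel_measurable_continuous_onI) (auto intro!: continuous_intros)

lemma pgauge_nonneg [simp]: "pgauge a x \<ge> 0"
  by (simp add: pgauge_def)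

lemma pgauge_ninv [simp]: "pgauge a (ninv x) = pgauge a x"
  by (simp add: pgauge_def norm_Pair)

lemma pgauge_dil: "r > 0 \<Longrightarrow> pgauge a (dil r x) = r * pgauge (a / r) x"
proof -
  assume r: "r > 0"
  have "(a + (norm (fst (dil r x)))\<^sup>2 / 4, snd (dil r x)) = r *\<^sub>R (a / r + (norm (fst x))\<^sup>2 / 4, snd x)"
    using r by (simp add: power_mult_distrib distrib_left)
  then show ?thesis
    unfolding pgauge_def using r by (simp only: norm_scaleR abs_of_pos)
qed

lemma pgauge_zero [simp]: "pgauge a 0 = \<bar>a\<bar>"
  by (simp add: pgauge_def norm_Pair)

lemma norm_fst_le_pgauge: "a \<ge> 0 \<Longrightarrow> a + (norm (fst x))\<^sup>2 / 4 \<le> pgauge a x"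
  unfolding pgauge_def using norm_fst_le[of "(a + (norm (fst x))\<^sup>2 / 4)" "snd x"] by simp

lemma norm_snd_le_pgauge: "norm (snd x) \<le> pgauge a x"
  unfolding pgauge_def using norm_snd_le[of "snd x" "(a + (norm (fst x))\<^sup>2 / 4)"] by simp

lemma pgauge_ge: "a \<ge> 0 \<Longrightarrow> pgauge a x \<ge> a"
  using norm_fst_le_pgauge[of a x] zero_le_power2[of "norm (fst x)"] by linarith

lemma pgauge_mono: "0 \<le> a \<Longrightarrow> a \<le> b \<Longrightarrow> pgauge a x \<le> pgauge b x"
  unfolding pgauge_def norm_Pair by (intro real_sqrt_le_mono add_mono power_mono) auto

lemma pgauge_add_le: "0 \<le> b \<Longrightarrow> pgauge (a + b) x \<le> pgauge a x + b"
proof -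
  assume b: "0 \<le> b"
  have "(a + b + (norm (fst x))\<^sup>2 / 4, snd x) = (a + (norm (fst x))\<^sup>2 / 4, snd x) + (b, 0)"
    by simp
  then have "pgauge (a + b) x \<le> pgauge a x + norm (b, 0 :: 'z)"
    unfolding pgauge_def by (metis norm_triangle_ineq)
  then show ?thesis using b by (simp add: norm_Pair)
qed

lemma norm_fst_le_pgauge1: "norm (fst x) \<le> pgauge 1 x"
proof -
  have "0 \<le> (norm (fst x) / 2 - 1)\<^sup>2" by simp
  then have "norm (fst x) \<le> 1 + (norm (fst x))\<^sup>2 / 4"
    by (simp add: power2_eq_square algebra_simps)
  then show ?thesis using norm_fst_le_pgauge[of 1 x] by linarith
qed

lemma norm_fst_le_pgauge0: "norm (fst x) \<le> 2 * sqrt (pgauge 0 x)"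
proof -
  have "(norm (fst x))\<^sup>2 \<le> 4 * pgauge 0 x" using norm_fst_le_pgauge[of 0 x] by simp
  then have "norm (fst x) \<le> sqrt (4 * pgauge 0 x)" by (simp add: real_le_rsqrt)
  then show ?thesis by (simp add: real_sqrt_mult)
qed

text \<open>\<open>pgauge a\<close> is the norm of (a + |X|^2/4, Z), and right multiplication by y
  adds to this vector an increment independent of a: half an inner product plus |Y|^2/4 in the first
  slot, \<open>snd y\<close> plus half a bracket in the second. The increment is only linear in
  \<open>fst x\<close>, whereas \<open>pgauge\<close> is quadratic in it. In \<open>K\<close>, the 1
  pays for the inner product and \<open>K0\<close> for the bracket.\<close>

lemma pgauge_mul_le:
  obtains K where "K \<ge> 1"
    and "\<And>a x y. pgauge a (x \<cdot> y) \<le> pgauge a x + K * norm (fst x) * norm (fst y) + (norm (fst y))\<^sup>2 / 4 + norm (snd y)"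
proof -
  obtain K0 where K0: "\<And>X Y. norm (vbr br X Y) \<le> norm X * norm Y * K0" "K0 \<ge> 0"
    using vbr.nonneg_bounded by blast
  show ?thesis
  proof
    show "1 + K0 \<ge> 1" using K0 by simp
    fix a :: real and x y :: "'v \<times> 'z"
    let ?d = "(norm (fst x + fst y))\<^sup>2 / 4 - (norm (fst x))\<^sup>2 / 4"
    have d: "?d = (fst x \<bullet> fst y) / 2 + (norm (fst y))\<^sup>2 / 4"
      by (simp add: power2_norm_eq_inner inner_simps inner_commute field_simps)
    have "pgauge a (x \<cdot> y) = norm ((a + (norm (fst x))\<^sup>2 / 4, snd x) + (?d, snd y + (1/2) *\<^sub>R vbr br (fst x) (fst y)))"
      by (simp add: pgauge_def add_ac)
    also have "\<dots> \<le> pgauge a x + norm (?d, snd y + (1/2) *\<^sub>R vbr br (fst x) (fst y))"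
      unfolding pgauge_def by (rule norm_triangle_ineq)
    also have "norm (?d, snd y + (1/2) *\<^sub>R vbr br (fst x) (fst y))
        \<le> \<bar>?d\<bar> + norm (snd y + (1/2) *\<^sub>R vbr br (fst x) (fst y))"
      using norm_Pair_le by (metis real_norm_def)
    also have "\<dots> \<le> \<bar>?d\<bar> + (norm (snd y) + norm (vbr br (fst x) (fst y)) / 2)"
      by (intro add_left_mono order_trans[OF norm_triangle_ineq]) simp
    finally have 1: "pgauge a (x \<cdot> y) \<le> pgauge a x + (\<bar>?d\<bar> + (norm (snd y) + norm (vbr br (fst x) (fst y)) / 2))"
      by simp
    have 2: "\<bar>?d\<bar> \<le> norm (fst x) * norm (fst y) / 2 + (norm (fst y))\<^sup>2 / 4"
      unfolding d using Cauchy_Schwarz_ineq2[of "fst x" "fst y"] zero_le_power2[of "norm (fst y)"]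
      by (simp only: abs_le_iff) linarith
    have 3: "norm (vbr br (fst x) (fst y)) / 2 \<le> norm (fst x) * norm (fst y) * K0"
      using K0(1)[of "fst x" "fst y"] norm_ge_zero[of "vbr br (fst x) (fst y)"] by linarith
    show "pgauge a (x \<cdot> y) \<le> pgauge a x + (1 + K0) * norm (fst x) * norm (fst y) + (norm (fst y))\<^sup>2 / 4 + norm (snd y)"
      using 1 2 3 mult_nonneg_nonneg[OF norm_ge_zero norm_ge_zero, of "fst x" "fst y"]
      by (simp only: distrib_right mult_1_left mult.assoc mult.commute[of K0])
  qed
qed

text \<open>At height 1 both gauges are at least 1, so each term of the additive estimate is bounded
  by their product: the cross term with factor \<open>K\<close>, the three others with factor
  1.\<close>

lemma pgauge1_submult:
  obtains C where "C \<ge> 1" "\<And>x y. pgauge 1 (x \<cdot> y) \<le> C * pgauge 1 x * pgauge 1 y"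
proof -
  obtain K where K: "K \<ge> 1"
    and le: "\<And>a x y. pgauge a (x \<cdot> y) \<le> pgauge a x + K * norm (fst x) * norm (fst y) + (norm (fst y))\<^sup>2 / 4 + norm (snd y)"
    using pgauge_mul_le by blast
  show ?thesis
  proof
    show "K + 3 \<ge> 1" using K by simp
    fix x y :: "'v \<times> 'z"
    have 1: "pgauge 1 x \<ge> 1" "pgauge 1 y \<ge> 1" by (auto intro: pgauge_ge)
    have "pgauge 1 x * 1 \<le> pgauge 1 x * pgauge 1 y" using 1 by (intro mult_left_mono) auto
    moreover have "1 * pgauge 1 y \<le> pgauge 1 x * pgauge 1 y" using 1 by (intro mult_right_mono) auto
    moreover have "K * (norm (fst x) * norm (fst y)) \<le> K * (pgauge 1 x * pgauge 1 y)"
      using K by (intro mult_left_mono mult_mono norm_fst_le_pgauge1) auto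
    moreover have "(norm (fst y))\<^sup>2 / 4 \<le> pgauge 1 y" using norm_fst_le_pgauge[of 1 y] by simp
    moreover have "norm (snd y) \<le> pgauge 1 y" by (rule norm_snd_le_pgauge)
    ultimately show "pgauge 1 (x \<cdot> y) \<le> (K + 3) * pgauge 1 x * pgauge 1 y"
      using le[of 1 x y] by (simp add: algebra_simps)
  qed
qed

text \<open>At height 1 the gauge dominates both 1 and \<open>norm (fst x)\<close>, so the additive
  increment is a small multiple of the gauge, uniformly in x. The radius is the square of e because
  the gauge is quadratic along the first factor; \<open>K + 2\<close> counts the cross term and the
  two terms in y alone.\<close>

lemma pgauge1_harnack:
  assumes "\<delta> > 0"
  obtains \<epsilon> where "\<epsilon> > 0" "\<And>x y. hg y < \<epsilon> \<Longrightarrow> pgauge 1 (x \<cdot> y) \<le> (1 + \<delta>) * pgauge 1 x"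
proof -
  obtain K where K: "K \<ge> 1"
    and le: "\<And>a x y. pgauge a (x \<cdot> y) \<le> pgauge a x + K * norm (fst x) * norm (fst y) + (norm (fst y))\<^sup>2 / 4 + norm (snd y)"
    using pgauge_mul_le by blast
  define e where "e = min 1 (\<delta> / (K + 2))"
  have e: "0 < e" "e \<le> 1" using K assms by (auto simp: e_def)
  have "(K + 2) * e \<le> (K + 2) * (\<delta> / (K + 2))"
    using K by (intro mult_left_mono) (auto simp: e_def)
  also have "\<dots> = \<delta>" using K by simp
  finally have e': "(K + 2) * e \<le> \<delta>" .
  show ?thesis
  proof
    show "e\<^sup>2 > 0" using e by simp
    fix x y :: "'v \<times> 'z" assume "hg y < e\<^sup>2"
    then have y: "4 * pgauge 0 y < e\<^sup>2" by (simp add: hgauge_eq_pgauge)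
    have 1: "pgauge 1 x \<ge> 1" by (auto intro: pgauge_ge)
    have ee: "e\<^sup>2 \<le> e" using e by (simp add: power2_eq_square mult_left_le)
    have f2: "(norm (fst y))\<^sup>2 \<le> e\<^sup>2" using norm_fst_le_pgauge[of 0 y] y by simp
    then have f: "norm (fst y) \<le> e" using e by (simp add: abs_le_square_iff[symmetric])
    have s: "norm (snd y) \<le> e * pgauge 1 x"
    proof -
      have "norm (snd y) \<le> e" using norm_snd_le_pgauge[of y 0] y ee pgauge_nonneg[of 0 y] by linarith
      also have "e * 1 \<le> e * pgauge 1 x" using 1 e by (intro mult_left_mono) auto
      finally show ?thesis by simp
    qed
    have g: "(norm (fst y))\<^sup>2 / 4 \<le> e * pgauge 1 x"
    proof -
      have "(norm (fst y))\<^sup>2 / 4 \<le> e" using f2 ee zero_le_power2[of "norm (fst y)"] by linarith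
      also have "e * 1 \<le> e * pgauge 1 x" using 1 e by (intro mult_left_mono) auto
      finally show ?thesis by simp
    qed
    have "K * (norm (fst x) * norm (fst y)) \<le> K * (pgauge 1 x * e)"
      using K e f by (intro mult_left_mono mult_mono norm_fst_le_pgauge1) auto
    then have "pgauge 1 (x \<cdot> y) \<le> pgauge 1 x + ((K + 2) * e) * pgauge 1 x"
      using le[of 1 x y] s g by (simp add: algebra_simps)
    also have "((K + 2) * e) * pgauge 1 x \<le> \<delta> * pgauge 1 x" using e' by (intro mult_right_mono) auto
    finally show "pgauge 1 (x \<cdot> y) \<le> (1 + \<delta>) * pgauge 1 x" by (simp add: algebra_simps)
  qed
qed

text \<open>\<open>hgauge\<close> is quadratic along the first factor and so violates the triangle
  inequality. This is the substitute used to enlarge balls: small right factors increase the gauge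
  arbitrarily little, uniformly on a given ball.\<close>

lemma hgauge_mul_small:
  assumes "\<delta> > 0"
  obtains \<epsilon> where "\<epsilon> > 0" "\<And>x y. hg x < s \<Longrightarrow> hg y < \<epsilon> \<Longrightarrow> hg (x \<cdot> y) < s + \<delta>"
proof -
  obtain K where K: "K \<ge> 1"
    and le: "\<And>a x y. pgauge a (x \<cdot> y) \<le> pgauge a x + K * norm (fst x) * norm (fst y) + (norm (fst y))\<^sup>2 / 4 + norm (snd y)"
    using pgauge_mul_le by blast
  \<comment> \<open>\<open>R\<close> bounds \<open>norm (fst x)\<close> when
    \<open>hg x < s\<close>. The absolute value keeps \<open>R\<close> nonnegative for negative s,
    where the claim is vacuous.\<close>
  define R where "R = sqrt \<bar>s\<bar>"
  have R: "R \<ge> 0" by (simp add: R_def)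
  define e where "e = min 1 (\<delta> / (4 * (K * R + 1)))"
  have KR: "K * R + 1 > 0" using K R by (simp add: add_nonneg_pos)
  have e: "0 < e" "e \<le> 1" "4 * (K * R * e + e) \<le> \<delta>"
  proof -
    show "0 < e" "e \<le> 1" using KR assms by (auto simp: e_def)
    have "e * (4 * (K * R + 1)) \<le> \<delta> / (4 * (K * R + 1)) * (4 * (K * R + 1))"
      using KR by (intro mult_right_mono) (auto simp: e_def)
    also have "\<dots> = \<delta>" using KR by simp
    finally show "4 * (K * R * e + e) \<le> \<delta>" by (simp add: algebra_simps)
  qed
  show ?thesis
  proof
    show "e\<^sup>2 > 0" using e by simp
    fix x y :: "'v \<times> 'z" assume x: "hg x < s" and "hg y < e\<^sup>2"
    then have y: "4 * pgauge 0 y < e\<^sup>2" by (simp add: hgauge_eq_pgauge)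
    have ee: "e\<^sup>2 \<le> e" using e by (simp add: power2_eq_square mult_left_le)
    have f2: "(norm (fst y))\<^sup>2 \<le> e\<^sup>2" using norm_fst_le_pgauge[of 0 y] y by simp
    then have f: "norm (fst y) \<le> e" using e by (simp add: abs_le_square_iff[symmetric])
    have "sqrt (4 * pgauge 0 x) \<le> sqrt \<bar>s\<bar>" using x by (intro real_sqrt_le_mono) (auto simp: hgauge_eq_pgauge)
    then have fx: "norm (fst x) \<le> R" using norm_fst_le_pgauge0[of x] by (simp add: R_def real_sqrt_mult)
    have "K * (norm (fst x) * norm (fst y)) \<le> K * (R * e)"
      using K e f R fx by (intro mult_left_mono mult_mono) auto
    moreover have "norm (snd y) + (norm (fst y))\<^sup>2 / 4 \<le> e"
      using norm_snd_le_pgauge[of y 0] norm_fst_le_pgauge[of 0 y] y ee pgauge_nonneg[of 0 y] by linarith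
    ultimately have "4 * pgauge 0 (x \<cdot> y) \<le> 4 * pgauge 0 x + \<delta>"
      using le[of 0 x y] e(3) by (simp add: algebra_simps)
    then show "hg (x \<cdot> y) < s + \<delta>" using x by (simp add: hgauge_eq_pgauge)
  qed
qed


subsection \<open>Haar measure and balls\<close>

text \<open>Left multiplication is a shear: for fixed X it translates Z by an amount depending on X,
  and then X is translated by a constant. Tonelli reduces invariance to translations in each
  factor.\<close>

lemma nn_integral_mul_left:
  assumes [measurable]: "f \<in> borel_measurable borel"
  shows "(\<integral>\<^sup>+y. f (x \<cdot> y) \<partial>lborel) = integral\<^sup>N lborel f"
proof -
  have "(\<integral>\<^sup>+y. f (x \<cdot> y) \<partial>lborel)
      = (\<integral>\<^sup>+X. \<integral>\<^sup>+Z. f (fst x + X, (snd x + (1/2) *\<^sub>R vbr br (fst x) X) + Z) \<partial>lborel \<partial>lborel)"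
    by (subst nn_integral_lborel_Pair)
       (auto intro!: nn_integral_cong arg_cong[of _ _ f] prod_eqI)
  also have "\<dots> = (\<integral>\<^sup>+X. \<integral>\<^sup>+Z. f (fst x + X, Z) \<partial>lborel \<partial>lborel)"
  proof (rule nn_integral_cong)
    fix X :: 'v
    show "(\<integral>\<^sup>+Z. f (fst x + X, (snd x + (1/2) *\<^sub>R vbr br (fst x) X) + Z) \<partial>lborel)
        = (\<integral>\<^sup>+Z. f (fst x + X, Z) \<partial>lborel)"
      by (rule nn_integral_lborel_translate[of "\<lambda>Z. f (fst x + X, Z)"]) measurable
  qed
  also have "\<dots> = (\<integral>\<^sup>+X. \<integral>\<^sup>+Z. f (X, Z) \<partial>lborel \<partial>lborel)"
    by (rule nn_integral_lborel_translate[of "\<lambda>X. \<integral>\<^sup>+Z. f (X, Z) \<partial>lborel"]) measurable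
  finally show ?thesis by (simp add: nn_integral_lborel_Pair)
qed

text \<open>Each coordinate of the first factor contributes r^(1/2) and each of the second
  contributes r, which add up to the homogeneous dimension \<open>Q\<close>.\<close>

lemma nn_integral_dil:
  assumes [measurable]: "f \<in> borel_measurable borel" and r: "r > 0"
  shows "(\<integral>\<^sup>+y. f (dil r y) \<partial>(lborel :: ('v \<times> 'z) measure)) = ennreal (r powr - Q) * integral\<^sup>N lborel f"
proof -
  have "(\<integral>\<^sup>+y. f (dil r y) \<partial>(lborel :: ('v \<times> 'z) measure))
      = (\<integral>\<^sup>+X. \<integral>\<^sup>+Z. f (sqrt r *\<^sub>R X, r *\<^sub>R Z) \<partial>lborel \<partial>lborel)"
    by (subst nn_integral_lborel_Pair)
       (auto intro!: nn_integral_cong arg_cong[of _ _ f] prod_eqI)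
  also have "\<dots> = (\<integral>\<^sup>+X. ennreal (r powr - real DIM('z)) * (\<integral>\<^sup>+Z. f (sqrt r *\<^sub>R X, Z) \<partial>lborel) \<partial>lborel)"
    using r by (intro nn_integral_cong, subst nn_integral_lborel_scaleR[symmetric]) auto
  also have "\<dots> = ennreal (r powr - real DIM('z)) * (\<integral>\<^sup>+X. \<integral>\<^sup>+Z. f (sqrt r *\<^sub>R X, Z) \<partial>lborel \<partial>lborel)"
    by (rule nn_integral_cmult) measurable
  also have "(\<integral>\<^sup>+X. \<integral>\<^sup>+Z. f (sqrt r *\<^sub>R X, Z) \<partial>lborel \<partial>lborel)
      = ennreal (sqrt r powr - real DIM('v)) * (\<integral>\<^sup>+X. \<integral>\<^sup>+Z. f (X, Z) \<partial>lborel \<partial>lborel)"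
    using r by (subst nn_integral_lborel_scaleR[symmetric]) auto
  also have "ennreal (r powr - real DIM('z)) * (ennreal (sqrt r powr - real DIM('v)) * (\<integral>\<^sup>+X. \<integral>\<^sup>+Z. f (X, Z) \<partial>lborel \<partial>lborel))
      = ennreal (r powr - real DIM('z) * sqrt r powr - real DIM('v)) * integral\<^sup>N lborel f"
    by (simp add: nn_integral_lborel_Pair ennreal_mult mult.assoc)
  also have "r powr - real DIM('z) * sqrt r powr - real DIM('v) = r powr (- real DIM('z) + - (real DIM('v) / 2))"
    using r by (simp only: powr_half_sqrt[symmetric] powr_powr powr_add) simp
  also have "- real DIM('z) + - (real DIM('v) / 2) = - Q" by (simp add: Q_def hdim_def)
  finally show ?thesis .
qed

lemma hdist_sym: "hdist br x y = hdist br y x"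
proof -
  have "ninv (ninv x \<cdot> y) = ninv y \<cdot> x" by (simp add: ninv_mul)
  then show ?thesis unfolding hdist_def hgauge_eq_pgauge by (metis pgauge_ninv)
qed

lemma mem_hball: "y \<in> hball br x r \<longleftrightarrow> hg (ninv x \<cdot> y) < r"
  by (simp add: hball_def hdist_def)

lemma mem_hball0 [simp]: "y \<in> hball br 0 r \<longleftrightarrow> hg y < r"
  by (simp add: mem_hball)

lemma continuous_on_hgauge [continuous_intros]:
  fixes f :: "_ \<Rightarrow> 'v \<times> 'z"
  shows "continuous_on A f \<Longrightarrow> continuous_on A (\<lambda>x. hg (f x))"
  unfolding hgauge_eq_pgauge by (intro continuous_intros)

lemma measurable_hgauge [measurable]: "hg \<in> borel_measurable (borel :: ('v \<times> 'z) measure)"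
  by (rule borel_measurable_continuous_onI) (auto intro!: continuous_intros)

lemma open_hball [simp]: "open (hball br x r)"
  unfolding hball_def hdist_def by (intro open_Collect_less continuous_intros)

lemma hball_borel [measurable]: "hball br x r \<in> sets borel"
  by simp

lemma hgauge_nonneg [simp]: "hg (x :: 'v \<times> 'z) \<ge> 0"
  by (simp add: hgauge_eq_pgauge)

lemma hgauge_dil: "r > 0 \<Longrightarrow> hg (dil r x) = r * hg (x :: 'v \<times> 'z)"
  by (simp add: hgauge_eq_pgauge pgauge_dil)

lemma norm_le_hgauge: "norm x \<le> 2 * sqrt (hg x) + hg x" for x :: "'v \<times> 'z"
proof -
  have "norm x \<le> norm (fst x) + norm (snd x)" by (metis norm_Pair_le prod.collapse)
  moreover have "sqrt (pgauge 0 x) \<le> sqrt (hg x)"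
    by (simp add: hgauge_eq_pgauge)
  moreover have "norm (snd x) \<le> hg x"
    using norm_snd_le_pgauge[of x 0] pgauge_nonneg[of 0 x] unfolding hgauge_eq_pgauge by linarith
  ultimately show ?thesis using norm_fst_le_pgauge0[of x] by linarith
qed

text \<open>Balls about 0 are bounded since the gauge controls the norm; a general ball lies in the
  continuous image, under left multiplication, of the compact closure of one of these.\<close>

lemma bounded_hball: "bounded (hball br x r)"
proof -
  have "bounded (hball br 0 r)"
  proof (rule boundedI)
    fix y :: "'v \<times> 'z" assume "y \<in> hball br 0 r"
    then have y: "hg y \<le> \<bar>r\<bar>" by simp
    then have "sqrt (hg y) \<le> sqrt \<bar>r\<bar>" by simp
    with y show "norm y \<le> 2 * sqrt \<bar>r\<bar> + \<bar>r\<bar>" using norm_le_hgauge[of y] by linarith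
  qed
  then have "compact (closure (hball br 0 r))" by simp
  then have "compact ((\<lambda>y. x \<cdot> y) ` closure (hball br 0 r))"
    by (rule compact_continuous_image[rotated]) (auto intro!: continuous_intros)
  moreover have "hball br x r \<subseteq> (\<lambda>y. x \<cdot> y) ` hball br 0 r"
  proof
    fix y assume "y \<in> hball br x r"
    then show "y \<in> (\<lambda>y. x \<cdot> y) ` hball br 0 r"
      by (intro image_eqI[of _ _ "ninv x \<cdot> y"]) (auto simp: mem_hball)
  qed
  ultimately show ?thesis
    using closure_subset by (meson bounded_subset compact_imp_bounded image_mono order_trans)
qed

definition vol :: real where "vol = measure lborel (hball br 0 1)"

lemma emeasure_hball1: "emeasure lborel (hball br 0 1) = ennreal vol"
  unfolding vol_def
  using emeasure_bounded_finite[OF bounded_hball[of 0 1]]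
  by (intro emeasure_eq_ennreal_measure) (simp add: less_top)

lemma vol_pos: "vol > 0"
proof -
  have "(0 :: 'v \<times> 'z) \<in> hball br 0 1" by (simp add: hgauge_eq_pgauge)
  then obtain e where e: "e > 0" "ball 0 e \<subseteq> hball br 0 1"
    using open_hball[of 0 1] openE by blast
  have "0 < measure lborel (ball (0 :: 'v \<times> 'z) e)" using e content_ball_pos by blast
  also have "\<dots> \<le> vol" unfolding vol_def
    using e emeasure_bounded_finite[OF bounded_hball] by (intro measure_mono_fmeasurable fmeasurableI) auto
  finally show ?thesis .
qed

lemma emeasure_lborel_hball: "r > 0 \<Longrightarrow> emeasure lborel (hball br x r) = ennreal (r powr Q * vol)"
proof -
  assume r: "r > 0"
  define f :: "'v \<times> 'z \<Rightarrow> ennreal" where "f = indicator (hball br 0 r)"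
  have [measurable]: "f \<in> borel_measurable borel" unfolding f_def by measurable
  have "emeasure lborel (hball br x r) = (\<integral>\<^sup>+y. f (ninv x \<cdot> y) \<partial>lborel)"
    unfolding f_def by (subst nn_integral_indicator[symmetric, OF hball_borel[unfolded sets_lborel[symmetric]]])
      (intro nn_integral_cong, simp add: mem_hball indicator_def)
  also have "\<dots> = integral\<^sup>N lborel f" by (rule nn_integral_mul_left) measurable
  also have "\<dots> = ennreal (r powr Q) * (ennreal (r powr - Q) * integral\<^sup>N lborel f)"
    using r by (simp add: mult.assoc[symmetric] ennreal_mult[symmetric] powr_add[symmetric])
  also have "ennreal (r powr - Q) * integral\<^sup>N lborel f = (\<integral>\<^sup>+y. f (dil r y) \<partial>lborel)"
    using r by (intro nn_integral_dil[symmetric]) auto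
  also have "\<dots> = (\<integral>\<^sup>+y. indicator (hball br 0 1) y \<partial>lborel)"
    unfolding f_def using r by (intro nn_integral_cong) (auto simp: indicator_def hgauge_dil)
  also have "\<dots> = ennreal vol" by (simp add: emeasure_hball1)
  finally show ?thesis using vol_pos by (simp add: ennreal_mult)
qed

lemma measure_lborel_hball: "r > 0 \<Longrightarrow> measure lborel (hball br x r) = r powr Q * vol"
  using vol_pos by (simp add: measure_def emeasure_lborel_hball)

text \<open>The sets in the definition of the strong derivative are again balls. Their centres move
  towards x with r, in general without coinciding with it.\<close>

lemma image_hball:
  assumes r: "r > 0"
  shows "nmul br x ` dil r ` hball br y s = hball br (x \<cdot> dil r y) (r * s)"
proof (rule set_eqI)
  fix z
  define w where "w = dil (1 / r) (ninv x \<cdot> z)"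
  have z: "z = x \<cdot> dil r w" using r by (simp add: w_def dil_dil)
  have "z \<in> nmul br x ` dil r ` hball br y s \<longleftrightarrow> w \<in> hball br y s"
  proof
    assume "z \<in> nmul br x ` dil r ` hball br y s"
    then obtain v where v: "v \<in> hball br y s" "z = x \<cdot> dil r v" by auto
    then have "w = v" using r by (simp add: w_def dil_dil)
    with v show "w \<in> hball br y s" by simp
  qed (use z in auto)
  also have "\<dots> \<longleftrightarrow> z \<in> hball br (x \<cdot> dil r y) (r * s)"
  proof -
    have "ninv (x \<cdot> dil r y) \<cdot> z = dil r (ninv y \<cdot> w)"
      using r by (simp add: z ninv_mul mul_assoc dil_mul dil_ninv)
    then show ?thesis using r by (simp add: mem_hball hgauge_dil)
  qed
  finally show "z \<in> nmul br x ` dil r ` hball br y s \<longleftrightarrow> z \<in> hball br (x \<cdot> dil r y) (r * s)" .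
qed


subsection \<open>Poisson kernels\<close>

lemma nn_integral_pgauge0_tail:
  assumes "\<tau> > 0" "T > 0"
  shows "(\<integral>\<^sup>+x. indicator {x. T \<le> hg x} x * ennreal (hg x powr - (Q + \<tau>)) \<partial>lborel)
      \<le> ennreal (vol * 2 powr Q / (1 - 2 powr - \<tau>) * T powr - \<tau>)"
proof (rule nn_integral_tail_le)
  fix t :: real assume "t > 0"
  moreover have "{x \<in> space lborel. hg x < t} = hball br 0 t" by auto
  ultimately show "emeasure lborel {x \<in> space lborel. hg x < t} \<le> ennreal (vol * t powr Q)"
    by (simp add: emeasure_lborel_hball mult.commute)
qed (use assms Q_pos vol_pos in auto)

lemma pgauge_powr_le_hgauge:
  assumes "a \<ge> 0" "\<sigma> > 0" "hg x > 0"
  shows "pgauge a x powr - \<sigma> \<le> 4 powr \<sigma> * hg x powr - \<sigma>"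
proof -
  have "pgauge a x powr - \<sigma> \<le> (hg x / 4) powr - \<sigma>"
    using assms pgauge_mono[of 0 a x] by (intro powr_mono2') (auto simp: hgauge_eq_pgauge)
  also have "\<dots> = 4 powr \<sigma> * hg x powr - \<sigma>"
    using assms by (simp add: powr_divide powr_minus field_simps)
  finally show ?thesis .
qed

text \<open>Near 0 the gauge is at least a; far away it is at least a quarter of \<open>hg\<close>,
  and any exponent beyond \<open>Q\<close> makes the dyadic tail converge.\<close>

lemma integrable_pgauge:
  assumes a: "a > 0" and \<tau>: "\<tau> > 0"
  shows "integrable lborel (\<lambda>x. pgauge a x powr - (Q + \<tau>))"
proof (rule integrableI_nonneg)
  let ?\<sigma> = "Q + \<tau>"
  have \<sigma>: "?\<sigma> > 0" using Q_pos \<tau> by simp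
  have "(\<integral>\<^sup>+x. ennreal (pgauge a x powr - ?\<sigma>) \<partial>lborel)
      \<le> (\<integral>\<^sup>+x. ennreal (a powr - ?\<sigma>) * indicator (hball br 0 1) x
            + ennreal (4 powr ?\<sigma>) * (indicator {x. 1 \<le> hg x} x * ennreal (hg x powr - ?\<sigma>)) \<partial>lborel)"
  proof (rule nn_integral_mono)
    fix x :: "'v \<times> 'z"
    show "ennreal (pgauge a x powr - ?\<sigma>) \<le> ennreal (a powr - ?\<sigma>) * indicator (hball br 0 1) x
            + ennreal (4 powr ?\<sigma>) * (indicator {x. 1 \<le> hg x} x * ennreal (hg x powr - ?\<sigma>))"
    proof (cases "hg x < 1")
      case True
      then show ?thesis using \<sigma> a pgauge_ge[of a x] by (auto intro!: ennreal_leI powr_mono2')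
    next
      case False
      then show ?thesis using \<sigma> a pgauge_powr_le_hgauge[of a ?\<sigma> x]
        by (auto simp: ennreal_mult[symmetric] intro!: ennreal_leI)
    qed
  qed
  also have "\<dots> = ennreal (a powr - ?\<sigma>) * emeasure lborel (hball br 0 1)
      + ennreal (4 powr ?\<sigma>) * (\<integral>\<^sup>+x. indicator {x. 1 \<le> hg x} x * ennreal (hg x powr - ?\<sigma>) \<partial>lborel)"
    by (subst nn_integral_add) (auto simp: nn_integral_cmult nn_integral_cmult_indicator)
  also have "\<dots> < \<infinity>"
    using order.strict_trans1[OF nn_integral_pgauge0_tail[OF \<tau>, of 1] ennreal_less_top]
    by (simp add: emeasure_hball1 ennreal_mult_less_top)
  finally show "(\<integral>\<^sup>+x. ennreal (pgauge a x powr - ?\<sigma>) \<partial>lborel) < \<infinity>" .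
qed auto

lemma pgauge_pos: "a > 0 \<Longrightarrow> pgauge a x > 0"
  using pgauge_ge[of a x] by linarith

text \<open>The kernels are defined by dividing by such integrals, so these must not vanish. A
  nonnegative integrable function with zero integral vanishes almost everywhere, but this one is
  strictly positive.\<close>

lemma integral_pgauge_pos:
  assumes "a > 0" "\<tau> > 0"
  shows "0 < (LINT x|lborel. pgauge a x powr - (Q + \<tau>))"
proof (rule ccontr)
  assume "\<not> ?thesis"
  moreover have "0 \<le> (LINT x|lborel. pgauge a x powr - (Q + \<tau>))"
    by (rule integral_nonneg_AE) simp
  ultimately have "(LINT x|lborel. pgauge a x powr - (Q + \<tau>)) = 0" by linarith
  then have "AE x in lborel. pgauge a x powr - (Q + \<tau>) = 0"
    using integral_nonneg_eq_0_iff_AE[OF integrable_pgauge[OF assms]] by simp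
  then have "AE x in (lborel :: ('v \<times> 'z) measure). False"
    by eventually_elim (use pgauge_pos[OF assms(1)] in \<open>auto simp: less_le\<close>)
  then show False
    by (simp add: eventually_False ae_filter_eq_bot_iff)
qed

definition pmass :: "real \<Rightarrow> real" where
  "pmass \<beta> = (LINT x|lborel. pgauge 1 x powr - (Q + 2 * \<beta>))"

lemma pmass_pos: "\<beta> > 0 \<Longrightarrow> pmass \<beta> > 0"
  unfolding pmass_def by (rule integral_pgauge_pos) auto

text \<open>Closed form of \<open>q_dil\<close> with the nested normalisations resolved. It shows
  the prefactor \<open>a powr (2 * \<beta>)\<close>, which is the source of all decay as a tends to
  0 off the diagonal.\<close>

definition pker :: "real \<Rightarrow> real \<Rightarrow> 'v \<times> 'z \<Rightarrow> real" where
  "pker \<beta> a x = a powr (2 * \<beta>) * pgauge a x powr - (Q + 2 * \<beta>) / pmass \<beta>"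

lemma P_unnorm_eq: "P_unnorm x = pgauge 1 x powr - (2 * Q)"
proof -
  have "(1 + (norm (fst x))\<^sup>2 / 4)\<^sup>2 + (norm (snd x))\<^sup>2 = (pgauge 1 x)\<^sup>2"
    by (simp add: pgauge_def norm_Pair)
  also have "\<dots> = pgauge 1 x powr 2" using pgauge_pos[of 1 x] by (simp add: powr_numeral)
  finally show ?thesis
    by (simp add: P_unnorm_def split_beta Q_def powr_powr del: powr_numeral)
qed

text \<open>Since \<open>pgauge 1\<close> equals 1 at the origin, dividing by the value there
  cancels the constant of \<open>P_kernel\<close>. The exponent is 2Q(1/2 + \<beta>/Q) = Q +
  2\<beta>.\<close>

lemma q_unnorm_eq:
  assumes "\<beta> > 0"
  shows "q_unnorm \<beta> x = pgauge 1 x powr - (Q + 2 * \<beta>)"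
proof -
  have "(LINT x|lborel. P_unnorm (x :: 'v \<times> 'z)) > 0"
    using integral_pgauge_pos[of 1 Q] Q_pos by (simp add: P_unnorm_eq)
  then have "P_kernel x / P_kernel (0 :: 'v \<times> 'z) = P_unnorm x"
    by (simp add: P_kernel_def P_unnorm_eq[of 0])
  then have "q_unnorm \<beta> x = pgauge 1 x powr (- (2 * Q) * (1/2 + \<beta> / Q))"
    by (simp add: q_unnorm_def P_unnorm_eq powr_powr Q_def)
  also have "- (2 * Q) * (1/2 + \<beta> / Q) = - (Q + 2 * \<beta>)"
    using Q_pos by (simp add: field_simps)
  finally show ?thesis .
qed

lemma q_dil_eq:
  assumes \<beta>: "\<beta> > 0" and a: "a > 0"
  shows "q_dil \<beta> a x = pker \<beta> a x"
proof -
  have "q_kernel \<beta> y = pgauge 1 y powr - (Q + 2 * \<beta>) / pmass \<beta>" for y :: "'v \<times> 'z"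
    using \<beta> by (simp add: q_kernel_def q_unnorm_eq pmass_def)
  then have "q_dil \<beta> a x = a powr - Q * (pgauge a x / a) powr - (Q + 2 * \<beta>) / pmass \<beta>"
    using a by (simp add: q_dil_def Q_def pgauge_dil)
  also have "(pgauge a x / a) powr - (Q + 2 * \<beta>) = pgauge a x powr - (Q + 2 * \<beta>) * a powr (Q + 2 * \<beta>)"
    using a by (simp only: powr_divide pgauge_nonneg less_imp_le powr_minus) (simp add: divide_inverse mult.commute)
  also have "a powr - Q * (pgauge a x powr - (Q + 2 * \<beta>) * a powr (Q + 2 * \<beta>))
      = (a powr - Q * a powr (Q + 2 * \<beta>)) * pgauge a x powr - (Q + 2 * \<beta>)" by simp
  also have "a powr - Q * a powr (Q + 2 * \<beta>) = a powr (2 * \<beta>)"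
    by (simp add: powr_add[symmetric])
  finally show ?thesis by (simp add: pker_def)
qed

lemma pker_nonneg [simp]: "\<beta> > 0 \<Longrightarrow> pker \<beta> a x \<ge> 0"
  using pmass_pos[of \<beta>] by (simp add: pker_def)

lemma measurable_pker [measurable]: "pker \<beta> a \<in> borel_measurable borel"
  unfolding pker_def by measurable

lemma pker_ninv [simp]: "pker \<beta> a (ninv x) = pker \<beta> a x"
  by (simp add: pker_def)

text \<open>The two arguments are inverse to each other and the gauge is invariant under inversion,
  so the kernel may be integrated in either variable.\<close>

lemma pker_swap: "pker \<beta> a (ninv x \<cdot> y) = pker \<beta> a (ninv y \<cdot> x)"
proof -
  have "ninv (ninv x \<cdot> y) = ninv y \<cdot> x" by (simp add: ninv_mul)
  then show ?thesis by (metis pker_ninv)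
qed

text \<open>Scaling the height together with the dilation multiplies the gauge by r, so the kernel
  is homogeneous of degree 2\<beta> - (Q + 2\<beta>) = -Q. This balances the scaling of Haar
  measure.\<close>

lemma pker_dil: "r > 0 \<Longrightarrow> a > 0 \<Longrightarrow> pker \<beta> (r * a) (dil r x) = r powr - Q * pker \<beta> a x"
proof -
  assume r: "r > 0" "a > 0"
  have "pker \<beta> (r * a) (dil r x)
      = (r powr (2 * \<beta>) * r powr - (Q + 2 * \<beta>)) * (a powr (2 * \<beta>) * pgauge a x powr - (Q + 2 * \<beta>) / pmass \<beta>)"
    using r by (simp add: pker_def pgauge_dil powr_mult less_imp_le mult_ac)
  also have "r powr (2 * \<beta>) * r powr - (Q + 2 * \<beta>) = r powr - Q"
    by (simp add: powr_add[symmetric])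
  finally show ?thesis by (simp add: pker_def)
qed

lemma nn_integral_pker:
  assumes \<beta>: "\<beta> > 0" and a: "a > 0"
  shows "(\<integral>\<^sup>+x. ennreal (pker \<beta> a x) \<partial>lborel) = 1"
proof -
  have 1: "(\<integral>\<^sup>+x. ennreal (pker \<beta> 1 x) \<partial>lborel) = 1"
  proof -
    have "(\<integral>\<^sup>+x. ennreal (pker \<beta> 1 x) \<partial>lborel) = ennreal (LINT x|lborel. pker \<beta> 1 x)"
    proof (intro nn_integral_eq_integral AE_I2 pker_nonneg \<beta>)
      show "integrable lborel (pker \<beta> 1)"
        using integrable_pgauge[of 1 "2 * \<beta>"] \<beta> by (simp add: pker_def [abs_def])
    qed
    also have "(LINT x|lborel. pker \<beta> 1 x) = 1"
      using pmass_pos[OF \<beta>] unfolding pker_def pmass_def by simp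
    finally show ?thesis by simp
  qed
  have "(\<integral>\<^sup>+x. ennreal (pker \<beta> a x) \<partial>lborel)
      = ennreal (a powr Q) * (ennreal (a powr - Q) * (\<integral>\<^sup>+x. ennreal (pker \<beta> a x) \<partial>lborel))"
    using a by (simp add: mult.assoc[symmetric] ennreal_mult[symmetric] powr_add[symmetric])
  also have "ennreal (a powr - Q) * (\<integral>\<^sup>+x. ennreal (pker \<beta> a x) \<partial>lborel) = (\<integral>\<^sup>+x. ennreal (pker \<beta> a (dil a x)) \<partial>lborel)"
    using a by (intro nn_integral_dil[symmetric]) auto
  also have "\<dots> = ennreal (a powr - Q) * (\<integral>\<^sup>+x. ennreal (pker \<beta> 1 x) \<partial>lborel)"
    using pker_dil[of a 1 \<beta>] a \<beta> by (simp add: ennreal_mult nn_integral_cmult)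
  finally show ?thesis using a
    by (simp add: 1 ennreal_mult[symmetric] powr_add[symmetric])
qed

text \<open>Off a ball the gauge at height a is bounded below by the gauge at height 0, so the
  height survives only in the prefactor. Hence \<open>pker\<close> is an approximate identity with
  rate a^(2\<beta>).\<close>

lemma nn_integral_pker_tail:
  assumes \<beta>: "\<beta> > 0" and T: "T > 0"
  obtains C where "C \<ge> 0" "\<And>a. a > 0 \<Longrightarrow>
    (\<integral>\<^sup>+x. indicator {x. T \<le> hg x} x * ennreal (pker \<beta> a x) \<partial>lborel) \<le> ennreal (C * a powr (2 * \<beta>))"
proof
  let ?\<sigma> = "Q + 2 * \<beta>"
  let ?t = "vol * 2 powr Q / (1 - 2 powr - (2 * \<beta>)) * T powr - (2 * \<beta>)"
  define C where "C = 4 powr ?\<sigma> / pmass \<beta> * ?t"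
  have "2 powr - (2 * \<beta>) < 2 powr 0" using \<beta> by (intro powr_less_mono) auto
  then have t: "?t \<ge> 0" using vol_pos by (intro mult_nonneg_nonneg divide_nonneg_nonneg) auto
  show "C \<ge> 0" unfolding C_def by (rule mult_nonneg_nonneg [OF _ t]) (use pmass_pos[OF \<beta>] in simp)
  fix a :: real assume a: "a > 0"
  have "(\<integral>\<^sup>+x. indicator {x. T \<le> hg x} x * ennreal (pker \<beta> a x) \<partial>lborel)
      \<le> (\<integral>\<^sup>+x. ennreal (a powr (2 * \<beta>) * 4 powr ?\<sigma> / pmass \<beta>) * (indicator {x. T \<le> hg x} x * ennreal (hg x powr - ?\<sigma>)) \<partial>lborel)"
  proof (rule nn_integral_mono)
    fix x :: "'v \<times> 'z"
    show "indicator {x. T \<le> hg x} x * ennreal (pker \<beta> a x)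
        \<le> ennreal (a powr (2 * \<beta>) * 4 powr ?\<sigma> / pmass \<beta>) * (indicator {x. T \<le> hg x} x * ennreal (hg x powr - ?\<sigma>))"
    proof (cases "T \<le> hg x")
      case True
      then have "pgauge a x powr - ?\<sigma> \<le> 4 powr ?\<sigma> * hg x powr - ?\<sigma>"
        using a T \<beta> Q_pos by (intro pgauge_powr_le_hgauge) auto
      then have "pker \<beta> a x \<le> a powr (2 * \<beta>) * (4 powr ?\<sigma> * hg x powr - ?\<sigma>) / pmass \<beta>"
        unfolding pker_def using pmass_pos[OF \<beta>] by (intro divide_right_mono mult_left_mono) auto
      then show ?thesis using True pmass_pos[OF \<beta>]
        by (simp add: ennreal_mult[symmetric] ennreal_leI mult.assoc)
    qed simp
  qed
  also have "\<dots> = ennreal (a powr (2 * \<beta>) * 4 powr ?\<sigma> / pmass \<beta>) * (\<integral>\<^sup>+x. indicator {x. T \<le> hg x} x * ennreal (hg x powr - ?\<sigma>) \<partial>lborel)"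
    by (rule nn_integral_cmult) measurable
  also have "\<dots> \<le> ennreal (a powr (2 * \<beta>) * 4 powr ?\<sigma> / pmass \<beta>) * ennreal ?t"
    using \<beta> T by (intro mult_left_mono nn_integral_pgauge0_tail) auto
  also have "\<dots> = ennreal (C * a powr (2 * \<beta>))"
    using t pmass_pos[OF \<beta>] by (simp add: ennreal_mult[symmetric] C_def mult_ac)
  finally show "(\<integral>\<^sup>+x. indicator {x. T \<le> hg x} x * ennreal (pker \<beta> a x) \<partial>lborel) \<le> ennreal (C * a powr (2 * \<beta>))" .
qed


section \<open>From cone limits to balls\<close>

lemma pgauge_eq_norm: "pgauge a x = norm (a + (norm (fst x))\<^sup>2 / 4, norm (snd x))"
  by (simp add: pgauge_def norm_Pair)

lemma pgauge_translate:
  obtains C where "C \<ge> 1" "\<And>x y. pgauge 1 x \<le> C * pgauge 1 y * pgauge 1 (ninv x \<cdot> y)"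
proof -
  obtain C where C: "C \<ge> 1" "\<And>x y. pgauge 1 (x \<cdot> y) \<le> C * pgauge 1 x * pgauge 1 y"
    using pgauge1_submult by blast
  have "pgauge 1 x \<le> C * pgauge 1 y * pgauge 1 (ninv x \<cdot> y)" for x y
  proof -
    have "ninv (ninv x \<cdot> y) = ninv y \<cdot> x" by (simp add: ninv_mul)
    then have "pgauge 1 (ninv x \<cdot> y) = pgauge 1 (ninv y \<cdot> x)" by (metis pgauge_ninv)
    then show ?thesis using C(2)[of y "ninv y \<cdot> x"] by simp
  qed
  with C(1) show ?thesis using that by blast
qed

text \<open>Moving the base point from 0 to y costs a factor that depends on y alone, so a bound on
  the weight based at 0 controls the kernels at every point. It is submultiplicativity for x = y
  (y^-1 x), together with invariance under inversion.\<close>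

lemma pgauge_powr_translate:
  obtains C where "C \<ge> 1" "\<And>\<sigma> x y. \<sigma> > 0 \<Longrightarrow>
    pgauge 1 (ninv x \<cdot> y) powr - \<sigma> \<le> (C * pgauge 1 y) powr \<sigma> * pgauge 1 x powr - \<sigma>"
proof -
  obtain C where C: "C \<ge> 1" "\<And>x y. pgauge 1 x \<le> C * pgauge 1 y * pgauge 1 (ninv x \<cdot> y)"
    using pgauge_translate by blast
  have "pgauge 1 (ninv x \<cdot> y) powr - \<sigma> \<le> (C * pgauge 1 y) powr \<sigma> * pgauge 1 x powr - \<sigma>" if "\<sigma> > 0" for \<sigma> x y
  proof -
    have p: "C * pgauge 1 y > 0" "pgauge 1 x > 0" using C(1) pgauge_pos[of 1] by auto
    have "pgauge 1 x / (C * pgauge 1 y) \<le> pgauge 1 (ninv x \<cdot> y)"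
      using C(2)[of x y] p by (simp add: pos_divide_le_eq mult.commute mult.left_commute)
    then have "pgauge 1 (ninv x \<cdot> y) powr - \<sigma> \<le> (pgauge 1 x / (C * pgauge 1 y)) powr - \<sigma>"
      using p that by (intro powr_mono2') auto
    also have "\<dots> = pgauge 1 x powr - \<sigma> / (C * pgauge 1 y) powr - \<sigma>"
      using p by (intro powr_divide)
    also have "\<dots> = (C * pgauge 1 y) powr \<sigma> * pgauge 1 x powr - \<sigma>"
      using p by (simp add: powr_minus divide_inverse)
    finally show ?thesis .
  qed
  with C(1) show ?thesis using that by blast
qed

lemma pgauge_scale: "a > 0 \<Longrightarrow> min 1 a * pgauge 1 x \<le> pgauge a x"
proof -
  assume a: "a > 0"
  have "pgauge 1 x * min 1 a = norm (min 1 a *\<^sub>R (1 + (norm (fst x))\<^sup>2 / 4, norm (snd x)))"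
    using a unfolding norm_scaleR pgauge_eq_norm by (simp add: mult.commute)
  also have "\<dots> \<le> pgauge a x"
  proof -
    have "min 1 a * (1 + (norm (fst x))\<^sup>2 / 4) \<le> a + (norm (fst x))\<^sup>2 / 4"
      using a mult_right_mono[of "min 1 a" 1 "(norm (fst x))\<^sup>2 / 4"] by (simp add: distrib_left)
    moreover have "min 1 a * norm (snd x) \<le> norm (snd x)"
      using mult_right_mono[of "min 1 a" 1 "norm (snd x)"] by simp
    ultimately show ?thesis
      unfolding pgauge_eq_norm scaleR_Pair norm_Pair using a
      by (intro real_sqrt_le_mono add_mono power_mono) (auto simp: abs_mult)
  qed
  finally show ?thesis by (simp add: mult.commute)
qed

text \<open>For fixed \<open>n\<close> the Poisson integrals extend to holomorphic functions of \<open>a\<close> in the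
  right half plane, and the cone contains \<open>(n, a)\<close> for all large \<open>a\<close>.\<close>

lemma pker_limit_extend:
  fixes \<nu> :: "nat \<Rightarrow> ('v \<times> 'z) measure"
  assumes sets: "\<And>j. sets (\<nu> j) = sets borel" and \<beta>: "\<beta> > 0"
    and bnd: "\<And>j. (\<integral>\<^sup>+x. ennreal (pgauge 1 x powr - (Q + 2 * \<beta>)) \<partial>\<nu> j) \<le> ennreal M"
    and lim: "\<And>a. a > a1 \<Longrightarrow> (\<lambda>j. LINT x|\<nu> j. pker \<beta> a (ninv x \<cdot> n)) \<longlonglongrightarrow> L"
    and a: "a > 0"
  shows "(\<lambda>j. LINT x|\<nu> j. pker \<beta> a (ninv x \<cdot> n)) \<longlonglongrightarrow> L"
proof -
  define \<sigma> where "\<sigma> = Q + 2 * \<beta>"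
  have \<sigma>: "\<sigma> > 0" using Q_pos \<beta> by (simp add: \<sigma>_def)
  define c where "c x = (norm (fst (ninv x \<cdot> n)))\<^sup>2 / 4" for x
  define d where "d x = norm (snd (ninv x \<cdot> n))" for x
  have cd: "c x \<ge> 0" "d x \<ge> 0" for x by (auto simp: c_def d_def)
  have pg: "pgauge a (ninv x \<cdot> n) = norm (a + c x, d x)" for a x
    by (simp only: pgauge_eq_norm c_def d_def)
  have cc: "continuous_on A c" "continuous_on A d" for A
    unfolding c_def d_def by (intro continuous_intros; simp)+
  have bm: "borel_measurable (\<nu> j) = borel_measurable borel" for j
    by (rule measurable_cong_sets[OF sets refl])
  obtain C where C: "C \<ge> 1" "\<And>\<sigma> x y. \<sigma> > 0 \<Longrightarrow>
    pgauge 1 (ninv x \<cdot> y) powr - \<sigma> \<le> (C * pgauge 1 y) powr \<sigma> * pgauge 1 x powr - \<sigma>"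
    using pgauge_powr_translate by blast
  define D where "D = (C * pgauge 1 n) powr \<sigma>"
  \<comment> \<open>The factor depends on the region of heights and on n, while x enters only
    through the weight whose integral \<open>bnd\<close> controls.\<close>
  have dom: "norm (ckernel \<sigma> (c x) (d x) z) \<le> ((1 + Y) / x0 + 2) powr \<sigma> * D * pgauge 1 x powr - \<sigma>"
    if "x0 > 0" "Re z \<ge> x0" "\<bar>Im z\<bar> \<le> Y" for x z x0 Y
  proof -
    have "norm (ckernel \<sigma> (c x) (d x) z) \<le> ((1 + Y) / x0 + 2) powr \<sigma> * pgauge 1 (ninv x \<cdot> n) powr - \<sigma>"
      unfolding pg using cd \<sigma> that by (intro ckernel_bound) auto
    also have "\<dots> \<le> ((1 + Y) / x0 + 2) powr \<sigma> * (D * pgauge 1 x powr - \<sigma>)"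
      unfolding D_def using C(2)[OF \<sigma>] by (intro mult_left_mono) auto
    finally show ?thesis by (simp add: mult.assoc)
  qed
  have int1: "integrable (\<nu> j) (\<lambda>x. pgauge 1 x powr - \<sigma>)" for j
    using order.strict_trans1[OF bnd[of j] ennreal_less_top]
    by (intro integrableI_nonneg) (simp_all add: \<sigma>_def bm)
  \<comment> \<open>\<open>M\<close> may be negative, in which case \<open>ennreal M\<close> is 0;
    the absolute value covers both signs.\<close>
  have int1_le: "(LINT x|\<nu> j. pgauge 1 x powr - \<sigma>) \<le> \<bar>M\<bar>" for j
  proof -
    have "ennreal (LINT x|\<nu> j. pgauge 1 x powr - \<sigma>) = (\<integral>\<^sup>+x. ennreal (pgauge 1 x powr - \<sigma>) \<partial>\<nu> j)"
      by (rule nn_integral_eq_integral[symmetric]) (auto simp: int1)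
    also have "\<dots> \<le> ennreal \<bar>M\<bar>"
      using bnd[of j] unfolding \<sigma>_def by (rule order_trans) (auto intro: ennreal_leI)
    finally show ?thesis by simp
  qed
  define S where "S = {z. Re z > 0}"
  have S: "open S" "connected S"
    unfolding S_def by (auto intro: convex_connected convex_halfspace_Re_gt open_halfspace_Re_gt)
  define H where "H j z = (LINT x|\<nu> j. ckernel \<sigma> (c x) (d x) z)" for j z
  have meas: "(\<lambda>x. ckernel \<sigma> (c x) (d x) z) \<in> borel_measurable (\<nu> j)" if "z \<in> S" for j z
  proof -
    have ne: "Re z + c x \<noteq> 0" for x using that cd[of x] by (simp add: S_def)
    have "continuous_on UNIV (\<lambda>x. ckernel \<sigma> (c x) (d x) z)"
      unfolding ckernel_def Complex_eq
      by (intro continuous_intros continuous_on_powr_complex cc)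
         (use that cd ne in \<open>auto simp: S_def complex_eq_iff intro: add_nonneg_nonneg less_imp_le\<close>)
    then show ?thesis unfolding bm by (rule borel_measurable_continuous_onI)
  qed
  have nhd: "\<exists>r>0. cball z0 r \<subseteq> S \<and> (\<forall>z\<in>cball z0 r. Re z \<ge> Re z0 / 2 \<and> \<bar>Im z\<bar> \<le> \<bar>Im z0\<bar> + Re z0)" if "z0 \<in> S" for z0
  proof (intro exI[of _ "Re z0 / 2"] conjI ballI subsetI)
    show "Re z0 / 2 > 0" using that by (simp add: S_def)
    fix z assume "z \<in> cball z0 (Re z0 / 2)"
    then have "norm (z0 - z) \<le> Re z0 / 2" by (simp add: dist_norm)
    then have "\<bar>Re z0 - Re z\<bar> \<le> Re z0 / 2" "\<bar>Im z0 - Im z\<bar> \<le> Re z0 / 2"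
      using abs_Re_le_cmod[of "z0 - z"] abs_Im_le_cmod[of "z0 - z"] by auto
    moreover have "Re z0 > 0" using that by (simp add: S_def)
    ultimately show "Re z \<ge> Re z0 / 2" "\<bar>Im z\<bar> \<le> \<bar>Im z0\<bar> + Re z0" "z \<in> S"
      unfolding S_def mem_Collect_eq by linarith+
  qed
  have holH: "H j holomorphic_on S" for j
    unfolding H_def [abs_def]
  proof (rule holomorphic_on_lebesgue_integral[OF S(1)])
    show "(\<lambda>z. ckernel \<sigma> (c x) (d x) z) holomorphic_on S" for x
      unfolding S_def using ckernel_holomorphic cd by auto
    fix z0 assume z0: "z0 \<in> S"
    from nhd[OF z0] obtain r where r: "r > 0" "cball z0 r \<subseteq> S"
      "\<And>z. z \<in> cball z0 r \<Longrightarrow> Re z \<ge> Re z0 / 2 \<and> \<bar>Im z\<bar> \<le> \<bar>Im z0\<bar> + Re z0" by blast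
    show "\<exists>r>0. \<exists>g. cball z0 r \<subseteq> S \<and> integrable (\<nu> j) g \<and>
                (\<forall>z\<in>cball z0 r. \<forall>x\<in>space (\<nu> j). norm (ckernel \<sigma> (c x) (d x) z) \<le> g x)"
      using r z0 int1[of j] dom[of "Re z0 / 2" _ "\<bar>Im z0\<bar> + Re z0"] 
      by (intro exI[of _ r] exI[of _ "\<lambda>x. ((1 + (\<bar>Im z0\<bar> + Re z0)) / (Re z0 / 2) + 2) powr \<sigma> * D * pgauge 1 x powr - \<sigma>"] conjI)
         (auto simp: S_def)
  qed (rule meas)
  \<comment> \<open>\<open>H\<close> omits the prefactor and the mass of the kernel, so at real
    heights it differs from the Poisson integral by exactly these.\<close>
  have Ha: "H j (of_real b) = of_real (b powr - (2 * \<beta>) * pmass \<beta> * (LINT x|\<nu> j. pker \<beta> b (ninv x \<cdot> n)))" if "b > 0" for b j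
  proof -
    have "b powr - (2 * \<beta>) * pmass \<beta> * pker \<beta> b (ninv x \<cdot> n) = norm (b + c x, d x) powr - \<sigma>" for x
      unfolding pker_def pg \<sigma>_def using that pmass_pos[OF \<beta>] by (simp add: powr_minus)
    then have "b powr - (2 * \<beta>) * pmass \<beta> * (LINT x|\<nu> j. pker \<beta> b (ninv x \<cdot> n)) = (LINT x|\<nu> j. norm (b + c x, d x) powr - \<sigma>)"
      by (simp flip: integral_mult_right_zero)
    then show ?thesis
      unfolding H_def using that cd by (simp add: ckernel_of_real)
  qed
  \<comment> \<open>The constant limit \<open>L\<close>, divided by the omitted prefactor, becomes
    this holomorphic function.\<close>
  define G where "G z = z powr - of_real (2 * \<beta>) * of_real (pmass \<beta> * L)" for z :: complex
  have Gb: "G (of_real b) = of_real (b powr - (2 * \<beta>) * pmass \<beta> * L)" if "b > 0" for b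
    using that by (simp add: G_def powr_of_real flip: of_real_minus of_real_mult)
  \<comment> \<open>Every b > \<open>b1 - 1\<close> exceeds both a1 and 0, so the hypothesis applies
    on all of \<open>U\<close>, and \<open>b1\<close> lies inside that ray and is an accumulation
    point of it.\<close>
  define b1 where "b1 = max 1 (a1 + 1)"
  define U where "U = complex_of_real ` {b1 - 1<..}"
  have "(\<lambda>j. H j (of_real a)) \<longlonglongrightarrow> G (of_real a)"
  proof (rule vitali_convergence[OF S holH])
    show "G holomorphic_on S"
      unfolding G_def S_def by (intro holomorphic_intros) (auto simp: complex_nonpos_Reals_iff)
    show "\<exists>B. \<forall>j. \<forall>z\<in>K. norm (H j z) \<le> B" if K: "compact K" "K \<subseteq> S" for K
    proof (cases "K = {}")
      case False
      obtain z1 where z1: "z1 \<in> K" "\<And>z. z \<in> K \<Longrightarrow> Re z1 \<le> Re z"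
        using continuous_attains_inf[OF K(1) False continuous_on_Re[OF continuous_on_id]] by auto
      obtain Y where Y: "\<And>z. z \<in> K \<Longrightarrow> norm z \<le> Y"
        using compact_imp_bounded[OF K(1)] by (auto simp: bounded_iff)
      have p: "Re z1 > 0" using z1 K by (auto simp: S_def)
      let ?C = "((1 + Y) / Re z1 + 2) powr \<sigma> * D"
      have "norm (H j z) \<le> ?C * \<bar>M\<bar>" if z: "z \<in> K" for j z
      proof -
        have le: "norm (ckernel \<sigma> (c x) (d x) z) \<le> ?C * pgauge 1 x powr - \<sigma>" for x
          using p z1(2)[OF z] Y[OF z] abs_Im_le_cmod[of z] by (intro dom) auto
        have "norm (H j z) \<le> (LINT x|\<nu> j. ?C * pgauge 1 x powr - \<sigma>)"
          unfolding H_def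
          by (rule order_trans[OF integral_norm_bound integral_mono']) (use int1[of j] le in \<open>auto simp: D_def\<close>)
        also have "\<dots> = ?C * (LINT x|\<nu> j. pgauge 1 x powr - \<sigma>)" by simp
        also have "\<dots> \<le> ?C * \<bar>M\<bar>" using int1_le[of j] by (intro mult_left_mono) (auto simp: D_def)
        finally show ?thesis .
      qed
      then show ?thesis by blast
    qed simp
    show "U \<subseteq> S" by (auto simp: U_def S_def b1_def)
    show "of_real b1 \<in> S" "of_real a \<in> S" using a by (auto simp: S_def b1_def)
    show "complex_of_real b1 islimpt U"
      unfolding islimpt_sequential
    proof (intro exI[of _ "\<lambda>n. of_real (b1 + 1 / real (Suc n))"] conjI allI)
      show "complex_of_real (b1 + 1 / real (Suc n)) \<in> U - {complex_of_real b1}" for n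
      proof -
        have p: "1 / real (Suc n) > 0" by simp
        then have "b1 - 1 < b1 + 1 / real (Suc n)" by linarith
        then have "complex_of_real (b1 + 1 / real (Suc n)) \<in> U" unfolding U_def by blast
        moreover have "b1 + 1 / real (Suc n) \<noteq> b1" using p by linarith
        ultimately show ?thesis by (simp only: Diff_iff singleton_iff of_real_eq_iff) simp
      qed
      have "(\<lambda>n. b1 + 1 / real (Suc n)) \<longlonglongrightarrow> b1 + 0"
        by (intro tendsto_intros LIMSEQ_Suc[OF lim_1_over_n])
      then show "(\<lambda>n. complex_of_real (b1 + 1 / real (Suc n))) \<longlonglongrightarrow> complex_of_real b1"
        by (intro tendsto_of_real) simp
    qed
    fix z assume "z \<in> U"
    then obtain b where b: "z = of_real b" "b > a1" "b > 0" by (auto simp: U_def b1_def)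
    show "(\<lambda>j. H j z) \<longlonglongrightarrow> G z"
      unfolding b(1) Ha[OF b(3)] Gb[OF b(3)] by (intro tendsto_intros lim b)
  qed
  then have "(\<lambda>j. Re (H j (of_real a)) * (a powr (2 * \<beta>) / pmass \<beta>)) \<longlonglongrightarrow> Re (G (of_real a)) * (a powr (2 * \<beta>) / pmass \<beta>)"
    by (intro tendsto_intros)
  then show ?thesis
    unfolding Ha[OF a] Gb[OF a] using a pmass_pos[OF \<beta>] by (simp add: powr_minus field_simps)
qed

section \<open>Domination by the weight and finiteness on balls\<close>

lemma bounded_subset_hball:
  assumes "bounded A"
  obtains R where "R > 0" "A \<subseteq> hball br 0 R"
proof -
  have "compact (hg ` closure A)"
    using assms by (intro compact_continuous_image continuous_intros) simp
  then have "bounded (hg ` closure A)" by (rule compact_imp_bounded)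
  then obtain R where R: "\<And>x. x \<in> closure A \<Longrightarrow> \<bar>hg x\<bar> \<le> R" by (auto simp: bounded_iff)
  have "A \<subseteq> hball br 0 (\<bar>R\<bar> + 1)"
  proof
    fix x assume "x \<in> A"
    then have "\<bar>hg x\<bar> \<le> R" using R closure_subset by blast
    then show "x \<in> hball br 0 (\<bar>R\<bar> + 1)" by simp
  qed
  then show ?thesis using that[of "\<bar>R\<bar> + 1"] by simp
qed

lemma pgauge1_le_hg: "pgauge 1 x \<le> 1 + hg x / 4"
  using pgauge_add_le[of 1 0 x] by (simp add: hgauge_eq_pgauge)

text \<open>Separates the variables: the y-factor is bounded on balls and the x-factor is the
  weight, which gives integrability in x locally uniformly in y. Changing the height to 1 costs a
  power of \<open>min 1 a\<close>.\<close>

lemma pker_le: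
  assumes \<beta>: "\<beta> > 0" and a: "a > 0"
  obtains C where "C \<ge> 0" "\<And>x y. pker \<beta> a (ninv x \<cdot> y) \<le> C * pgauge 1 y powr (Q + 2 * \<beta>) * pgauge 1 x powr - (Q + 2 * \<beta>)"
proof -
  define \<sigma> where "\<sigma> = Q + 2 * \<beta>"
  have \<sigma>: "\<sigma> > 0" using Q_pos \<beta> by (simp add: \<sigma>_def)
  obtain C where C: "C \<ge> 1" "\<And>\<sigma> x y. \<sigma> > 0 \<Longrightarrow>
    pgauge 1 (ninv x \<cdot> y) powr - \<sigma> \<le> (C * pgauge 1 y) powr \<sigma> * pgauge 1 x powr - \<sigma>"
    using pgauge_powr_translate by blast
  define D where "D = a powr (2 * \<beta>) / pmass \<beta> * min 1 a powr - \<sigma> * C powr \<sigma>"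
  have m: "pmass \<beta> > 0" by (rule pmass_pos[OF \<beta>])
  show ?thesis
  proof
    show "D \<ge> 0" unfolding D_def using m by simp
    fix x y
    have "pgauge a (ninv x \<cdot> y) powr - \<sigma> \<le> (min 1 a * pgauge 1 (ninv x \<cdot> y)) powr - \<sigma>"
      using a \<sigma> pgauge_scale[OF a] pgauge_pos[of 1] by (intro powr_mono2') auto
    also have "\<dots> = min 1 a powr - \<sigma> * pgauge 1 (ninv x \<cdot> y) powr - \<sigma>"
      by (rule powr_mult)
    also have "\<dots> \<le> min 1 a powr - \<sigma> * (C powr \<sigma> * pgauge 1 y powr \<sigma> * pgauge 1 x powr - \<sigma>)"
      using C(2)[OF \<sigma>, of x y] C(1) by (intro mult_left_mono) (auto simp: powr_mult)
    finally have "a powr (2 * \<beta>) / pmass \<beta> * pgauge a (ninv x \<cdot> y) powr - \<sigma>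
        \<le> a powr (2 * \<beta>) / pmass \<beta> * (min 1 a powr - \<sigma> * (C powr \<sigma> * pgauge 1 y powr \<sigma> * pgauge 1 x powr - \<sigma>))"
      using m by (intro mult_left_mono) auto
    then show "pker \<beta> a (ninv x \<cdot> y) \<le> D * pgauge 1 y powr (Q + 2 * \<beta>) * pgauge 1 x powr - (Q + 2 * \<beta>)"
      by (simp only: pker_def D_def \<sigma>_def[symmetric] mult.assoc times_divide_eq_left)
  qed
qed

text \<open>Away from the diagonal \<open>pgauge 0\<close> is at least \<epsilon>/4, so 1 is at most
  4/\<epsilon> times \<open>pgauge 0\<close>, and \<open>pgauge 1\<close> is at most k times
  \<open>pgauge a\<close> for every height. The kernel is then comparable with height 1 uniformly in
  a, except for the small prefactor.\<close>

lemma pker_far_le: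
  assumes \<beta>: "\<beta> > 0" and \<epsilon>: "\<epsilon> > 0"
  obtains C where "C \<ge> 0" "\<And>a x y. a > 0 \<Longrightarrow> hg (ninv x \<cdot> y) \<ge> \<epsilon> \<Longrightarrow>
    pker \<beta> a (ninv x \<cdot> y) \<le> C * a powr (2 * \<beta>) * pgauge 1 y powr (Q + 2 * \<beta>) * pgauge 1 x powr - (Q + 2 * \<beta>)"
proof -
  define \<sigma> where "\<sigma> = Q + 2 * \<beta>"
  have \<sigma>: "\<sigma> > 0" using Q_pos \<beta> by (simp add: \<sigma>_def)
  obtain C where C: "C \<ge> 1" "\<And>\<sigma> x y. \<sigma> > 0 \<Longrightarrow>
    pgauge 1 (ninv x \<cdot> y) powr - \<sigma> \<le> (C * pgauge 1 y) powr \<sigma> * pgauge 1 x powr - \<sigma>"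
    using pgauge_powr_translate by blast
  define k where "k = 1 + 4 / \<epsilon>"
  have k: "k > 0" using \<epsilon> by (simp add: k_def add_pos_pos)
  define D where "D = 1 / pmass \<beta> * k powr \<sigma> * C powr \<sigma>"
  have m: "pmass \<beta> > 0" by (rule pmass_pos[OF \<beta>])
  show ?thesis
  proof
    show "D \<ge> 0" unfolding D_def using m by simp
    fix a :: real and x y assume a: "a > 0" and far: "hg (ninv x \<cdot> y) \<ge> \<epsilon>"
    let ?g = "ninv x \<cdot> y"
    have p0: "pgauge 0 ?g \<ge> \<epsilon> / 4" using far by (simp add: hgauge_eq_pgauge)
    have "pgauge 1 ?g \<le> pgauge 0 ?g + 1" using pgauge_add_le[of 1 0 ?g] by simp
    also have "\<dots> \<le> k * pgauge 0 ?g"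
      using mult_left_mono[OF p0, of "4 / \<epsilon>"] \<epsilon> by (simp add: k_def distrib_right)
    also have "\<dots> \<le> k * pgauge a ?g" using k a by (intro mult_left_mono pgauge_mono) auto
    finally have "pgauge 1 ?g / k \<le> pgauge a ?g" using k by (simp add: pos_divide_le_eq mult.commute)
    then have "pgauge a ?g powr - \<sigma> \<le> (pgauge 1 ?g / k) powr - \<sigma>"
      using k \<sigma> pgauge_pos[of 1] by (intro powr_mono2') auto
    also have "\<dots> = pgauge 1 ?g powr - \<sigma> / k powr - \<sigma>"
      using k by (intro powr_divide)
    also have "\<dots> = k powr \<sigma> * pgauge 1 ?g powr - \<sigma>" by (simp add: powr_minus divide_inverse)
    also have "\<dots> \<le> k powr \<sigma> * (C powr \<sigma> * pgauge 1 y powr \<sigma> * pgauge 1 x powr - \<sigma>)"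
      using C(2)[OF \<sigma>, of x y] C(1) by (intro mult_left_mono) (auto simp: powr_mult)
    finally have "a powr (2 * \<beta>) / pmass \<beta> * pgauge a ?g powr - \<sigma>
        \<le> a powr (2 * \<beta>) / pmass \<beta> * (k powr \<sigma> * (C powr \<sigma> * pgauge 1 y powr \<sigma> * pgauge 1 x powr - \<sigma>))"
      using m by (intro mult_left_mono) auto
    then show "pker \<beta> a ?g \<le> D * a powr (2 * \<beta>) * pgauge 1 y powr (Q + 2 * \<beta>) * pgauge 1 x powr - (Q + 2 * \<beta>)"
      unfolding pker_def D_def \<sigma>_def[symmetric] by (simp add: mult_ac)
  qed
qed

lemma sigma_finite_of_finite_on_hballs:
  fixes \<nu> :: "('v \<times> 'z) measure"
  assumes sets: "sets \<nu> = sets borel" and fin: "\<And>R. R > 0 \<Longrightarrow> emeasure \<nu> (hball br 0 R) < \<infinity>"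
  shows "sigma_finite_measure \<nu>"
proof
  show "\<exists>A. countable A \<and> A \<subseteq> sets \<nu> \<and> \<Union>A = space \<nu> \<and> (\<forall>a\<in>A. emeasure \<nu> a \<noteq> \<infinity>)"
  proof (intro exI[of _ "range (\<lambda>i::nat. hball br 0 (real (Suc i)))"] conjI ballI)
    have "x \<in> (\<Union>i::nat. hball br 0 (real (Suc i)))" for x :: "'v \<times> 'z"
    proof -
      obtain i :: nat where "hg x < real i" using reals_Archimedean2 by blast
      then have "x \<in> hball br 0 (real (Suc i))" by simp
      then show ?thesis by blast
    qed
    then show "\<Union> (range (\<lambda>i::nat. hball br 0 (real (Suc i)))) = space \<nu>"
      using sets_eq_imp_space_eq[OF sets] by auto
    show "emeasure \<nu> a \<noteq> \<infinity>" if "a \<in> range (\<lambda>i::nat. hball br 0 (real (Suc i)))" for a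
      using that fin by (auto simp: less_top[symmetric] simp del: of_nat_Suc)
  qed (auto simp: sets)
qed

text \<open>The weight is bounded below on every ball, so a finite weighted integral forces finite
  mass there.\<close>

lemma emeasure_hball_le:
  fixes \<nu> :: "('v \<times> 'z) measure"
  assumes sets: "sets \<nu> = sets borel" and \<sigma>: "\<sigma> > 0"
    and bnd: "(\<integral>\<^sup>+x. ennreal (pgauge 1 x powr - \<sigma>) \<partial>\<nu>) < \<infinity>"
  shows "emeasure \<nu> (hball br y R) < \<infinity>"
proof -
  obtain R' where R': "R' > 0" "hball br y R \<subseteq> hball br 0 R'"
    using bounded_subset_hball[OF bounded_hball] by blast
  have "emeasure \<nu> (hball br y R) \<le> emeasure \<nu> (hball br 0 R')"
    using R' sets by (intro emeasure_mono) auto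
  also have "\<dots> = (\<integral>\<^sup>+x. indicator (hball br 0 R') x \<partial>\<nu>)" using sets by simp
  also have "\<dots> \<le> (\<integral>\<^sup>+x. ennreal ((1 + R' / 4) powr \<sigma>) * ennreal (pgauge 1 x powr - \<sigma>) \<partial>\<nu>)"
  proof (rule nn_integral_mono)
    fix x
    show "indicator (hball br 0 R') x \<le> ennreal ((1 + R' / 4) powr \<sigma>) * ennreal (pgauge 1 x powr - \<sigma>)"
    proof (cases "hg x < R'")
      case True
      then have le: "pgauge 1 x \<le> 1 + R' / 4" using pgauge1_le_hg[of x] by simp
      have "1 = pgauge 1 x powr \<sigma> * pgauge 1 x powr - \<sigma>"
        using pgauge_pos[of 1 x] by (simp add: powr_add[symmetric])
      also have "\<dots> \<le> (1 + R' / 4) powr \<sigma> * pgauge 1 x powr - \<sigma>"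
        using le \<sigma> by (intro mult_right_mono powr_mono2) auto
      finally show ?thesis using True by (simp add: ennreal_mult[symmetric])
    qed simp
  qed
  also have "\<dots> = ennreal ((1 + R' / 4) powr \<sigma>) * (\<integral>\<^sup>+x. ennreal (pgauge 1 x powr - \<sigma>) \<partial>\<nu>)"
    by (rule nn_integral_cmult) (simp add: measurable_cong_sets[OF sets refl])
  also have "\<dots> < \<infinity>" using bnd by (simp add: ennreal_mult_less_top)
  finally show ?thesis .
qed

lemma nn_integral_pker_translate:
  assumes [measurable]: "E \<in> sets borel"
  shows "(\<integral>\<^sup>+y. indicator E (ninv x \<cdot> y) * ennreal (pker \<beta> a (ninv x \<cdot> y)) \<partial>lborel)
    = (\<integral>\<^sup>+y. indicator E y * ennreal (pker \<beta> a y) \<partial>lborel)"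
  by (rule nn_integral_mul_left[of "\<lambda>y. indicator E y * ennreal (pker \<beta> a y)"]) measurable

text \<open>By Tonelli, integrating the Poisson integral over a ball E gives the \<nu>-integral of
  the kernel mass that each x sends into E. Over a larger ball, a point of the given ball sends at
  least 1 - \<delta>; over a smaller ball, a point sends at most 1, and points outside the given
  ball send O(a^(2\<beta>)) times the weight. The height is fixed before j tends to infinity, so
  both errors are uniform in j.\<close>

lemma tauberian_balls:
  fixes \<nu> :: "nat \<Rightarrow> ('v \<times> 'z) measure"
  assumes sets: "\<And>j. sets (\<nu> j) = sets borel" and \<beta>: "\<beta> > 0" and M: "M \<ge> 0" and L: "L \<ge> 0"
    and bnd: "\<And>j. (\<integral>\<^sup>+x. ennreal (pgauge 1 x powr - (Q + 2 * \<beta>)) \<partial>\<nu> j) \<le> ennreal M"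
    and lim: "\<And>n a. a > 0 \<Longrightarrow> (\<lambda>j. LINT x|\<nu> j. pker \<beta> a (ninv x \<cdot> n)) \<longlonglongrightarrow> L"
    and s: "s > 0"
  shows "(\<lambda>j. measure (\<nu> j) (hball br n s)) \<longlonglongrightarrow> L * (s powr Q * vol)"
proof -
  define \<sigma> where "\<sigma> = Q + 2 * \<beta>"
  have \<sigma>: "\<sigma> > 0" using Q_pos \<beta> by (simp add: \<sigma>_def)
  note bnd' = bnd[folded \<sigma>_def]
  have bm: "borel_measurable (\<nu> j) = borel_measurable borel" for j
    by (rule measurable_cong_sets[OF sets refl])
  have fin: "emeasure (\<nu> j) (hball br y r) < \<infinity>" for j y r
    using sets[of j] \<sigma> order.strict_trans1[OF bnd'[of j] ennreal_less_top]
    by (intro emeasure_hball_le[of _ \<sigma>]) auto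
  then have em: "emeasure (\<nu> j) (hball br y r) = ennreal (measure (\<nu> j) (hball br y r))" for j y r
    by (intro emeasure_eq_ennreal_measure) (simp add: less_top)
  interpret \<nu>: sigma_finite_measure "\<nu> j" for j
    using sets fin by (intro sigma_finite_of_finite_on_hballs)
  interpret pair: pair_sigma_finite lborel "\<nu> j" for j ..
  have int1: "integrable (\<nu> j) (\<lambda>x. pgauge 1 x powr - \<sigma>)" for j
    using order.strict_trans1[OF bnd'[of j] ennreal_less_top]
    by (intro integrableI_nonneg) (simp_all add: bm)
  have int1_le: "(LINT x|\<nu> j. pgauge 1 x powr - \<sigma>) \<le> M" for j
  proof -
    have "ennreal (LINT x|\<nu> j. pgauge 1 x powr - \<sigma>) = (\<integral>\<^sup>+x. ennreal (pgauge 1 x powr - \<sigma>) \<partial>\<nu> j)"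
      by (rule nn_integral_eq_integral[symmetric]) (auto simp: int1)
    also have "\<dots> \<le> ennreal M" by (rule bnd')
    finally show ?thesis using M by simp
  qed
  define I where "I a j y = (LINT x|\<nu> j. pker \<beta> a (ninv x \<cdot> y))" for a j y
  have I_nonneg: "I a j y \<ge> 0" for a j y unfolding I_def using \<beta> by (intro integral_nonneg_AE) simp
  define N where "N a j E = (\<integral>\<^sup>+y. indicator E y * ennreal (I a j y) \<partial>lborel)" for a j and E :: "('v \<times> 'z) set"
  have mI[measurable]: "(\<lambda>x. pker \<beta> a (ninv x \<cdot> y)) \<in> borel_measurable (\<nu> j)" for a j y
    unfolding bm by measurable
  have intI: "integrable (\<nu> j) (\<lambda>x. pker \<beta> a (ninv x \<cdot> y))" if a: "a > 0" for a j y
  proof -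
    obtain C where C: "C \<ge> 0" "\<And>x y. pker \<beta> a (ninv x \<cdot> y) \<le> C * pgauge 1 y powr (Q + 2 * \<beta>) * pgauge 1 x powr - (Q + 2 * \<beta>)"
      using pker_le[OF \<beta> a] by blast
    show ?thesis
    proof (rule Bochner_Integration.integrable_bound)
      show "integrable (\<nu> j) (\<lambda>x. C * pgauge 1 y powr \<sigma> * pgauge 1 x powr - \<sigma>)"
        using int1 by simp
      show "AE x in \<nu> j. norm (pker \<beta> a (ninv x \<cdot> y)) \<le> norm (C * pgauge 1 y powr \<sigma> * pgauge 1 x powr - \<sigma>)"
        using C \<beta> by (intro AE_I2) (auto simp: \<sigma>_def intro: order_trans[OF _ abs_ge_self])
    qed (rule mI)
  qed
  have nnI: "ennreal (I a j y) = (\<integral>\<^sup>+x. ennreal (pker \<beta> a (ninv x \<cdot> y)) \<partial>\<nu> j)" if "a > 0" for a j y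
    unfolding I_def using \<beta> by (intro nn_integral_eq_integral[symmetric] intI that) auto
  have mpair: "(\<lambda>(y, x). indicator E y * ennreal (pker \<beta> a (ninv x \<cdot> y))) \<in> borel_measurable (lborel \<Otimes>\<^sub>M \<nu> j)"
    if [measurable]: "E \<in> sets borel" for E a j
  proof -
    have "(\<lambda>(y, x). indicator E y * ennreal (pker \<beta> a (ninv x \<cdot> y))) \<in> borel_measurable (borel \<Otimes>\<^sub>M borel)"
      by measurable
    moreover have eq: "sets (lborel \<Otimes>\<^sub>M \<nu> j) = sets ((borel :: ('v \<times> 'z) measure) \<Otimes>\<^sub>M borel)"
      by (intro sets_pair_measure_cong) (simp_all add: sets)
    ultimately show ?thesis unfolding measurable_cong_sets[OF eq refl] by simp
  qed
  have tonelli: "N a j E = (\<integral>\<^sup>+x. \<integral>\<^sup>+y. indicator E y * ennreal (pker \<beta> a (ninv x \<cdot> y)) \<partial>lborel \<partial>\<nu> j)"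
    if "a > 0" "E \<in> sets borel" for a j E
  proof -
    have "N a j E = (\<integral>\<^sup>+y. \<integral>\<^sup>+x. indicator E y * ennreal (pker \<beta> a (ninv x \<cdot> y)) \<partial>\<nu> j \<partial>lborel)"
      unfolding N_def using that by (intro nn_integral_cong) (simp add: nnI nn_integral_cmult)
    also have "\<dots> = (\<integral>\<^sup>+x. \<integral>\<^sup>+y. indicator E y * ennreal (pker \<beta> a (ninv x \<cdot> y)) \<partial>lborel \<partial>\<nu> j)"
      by (rule pair.Fubini'[symmetric]) (rule mpair[OF that(2)])
    finally show ?thesis .
  qed
  \<comment> \<open>Dominated convergence over a bounded ball: \<open>bnd\<close> bounds the Poisson
    integrals there by a constant independent of j.\<close>
  have N_lim: "(\<lambda>j. N a j (hball br n r)) \<longlonglongrightarrow> ennreal (L * (r powr Q * vol))" if a: "a > 0" and r: "r > 0" for a r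
  proof -
    obtain C where C: "C \<ge> 0" "\<And>x y. pker \<beta> a (ninv x \<cdot> y) \<le> C * pgauge 1 y powr (Q + 2 * \<beta>) * pgauge 1 x powr - (Q + 2 * \<beta>)"
      using pker_le[OF \<beta> a] by blast
    obtain R where R: "R > 0" "hball br n r \<subseteq> hball br 0 R"
      using bounded_subset_hball[OF bounded_hball] by blast
    define B where "B = C * (1 + R / 4) powr \<sigma> * M"
    have le: "I a j y \<le> B" if y: "y \<in> hball br n r" for j y
    proof -
      have "hg y < R" using y R by auto
      then have "pgauge 1 y \<le> 1 + R / 4" using pgauge1_le_hg[of y] by simp
      then have gy: "pgauge 1 y powr \<sigma> \<le> (1 + R / 4) powr \<sigma>" using \<sigma> by (intro powr_mono2) auto
      have "I a j y \<le> (LINT x|\<nu> j. C * pgauge 1 y powr \<sigma> * pgauge 1 x powr - \<sigma>)"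
        unfolding I_def using int1 C by (intro integral_mono intI a) (auto simp: \<sigma>_def)
      also have "\<dots> = C * pgauge 1 y powr \<sigma> * (LINT x|\<nu> j. pgauge 1 x powr - \<sigma>)" by simp
      also have "\<dots> \<le> C * (1 + R / 4) powr \<sigma> * M"
        using gy int1_le[of j] C(1) M
        by (intro mult_mono mult_left_mono) (auto intro: integral_nonneg_AE)
      finally show ?thesis by (simp add: B_def)
    qed
    have "(\<lambda>j. N a j (hball br n r)) \<longlonglongrightarrow> (\<integral>\<^sup>+y. indicator (hball br n r) y * ennreal L \<partial>lborel)"
      unfolding N_def
    proof (rule nn_integral_dominated_convergence)
      show "(\<lambda>y. indicator (hball br n r) y * ennreal (I a j y)) \<in> borel_measurable lborel" for j
      proof -
        have "(\<lambda>y. \<integral>\<^sup>+x. indicator (hball br n r) y * ennreal (pker \<beta> a (ninv x \<cdot> y)) \<partial>\<nu> j) \<in> borel_measurable lborel"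
          by (rule \<nu>.borel_measurable_nn_integral) (rule mpair, simp)
        then show ?thesis using a by (simp add: nnI nn_integral_cmult)
      qed
      show "AE y in lborel. indicator (hball br n r) y * ennreal (I a j y) \<le> indicator (hball br n r) y * ennreal B" for j
        using le by (intro AE_I2) (auto simp: indicator_def intro: ennreal_leI)
      show "(\<integral>\<^sup>+y. indicator (hball br n r) y * ennreal B \<partial>lborel) < \<infinity>"
        using r by (simp add: nn_integral_multc emeasure_lborel_hball ennreal_mult_less_top)
      show "AE y in lborel. (\<lambda>j. indicator (hball br n r) y * ennreal (I a j y)) \<longlonglongrightarrow> indicator (hball br n r) y * ennreal L"
      proof (rule AE_I2)
        fix y
        have "(\<lambda>j. ennreal (I a j y)) \<longlonglongrightarrow> ennreal L"
          unfolding I_def by (intro tendsto_ennrealI lim a)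
        then show "(\<lambda>j. indicator (hball br n r) y * ennreal (I a j y)) \<longlonglongrightarrow> indicator (hball br n r) y * ennreal L"
          by (auto simp: indicator_def)
      qed
    qed auto
    also have "(\<integral>\<^sup>+y. indicator (hball br n r) y * ennreal L \<partial>lborel) = ennreal (L * (r powr Q * vol))"
      using r L vol_pos
      by (subst nn_integral_multc) (simp_all add: emeasure_lborel_hball ennreal_mult[symmetric] mult.commute)
    finally show ?thesis .
  qed
  have cont: "((\<lambda>t. L * (t powr Q * vol)) \<longlongrightarrow> L * (s powr Q * vol)) (at s within A)" for A
    using s by (intro tendsto_intros) auto
  show ?thesis
  proof (rule order_tendstoI)
    fix c assume c: "L * (s powr Q * vol) < c"
    have "eventually (\<lambda>t. L * (t powr Q * vol) < c \<and> t > s) (at_right s)"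
      using order_tendstoD(2)[OF cont c] by (intro eventually_conj eventually_at_right_less) auto
    then obtain s' where s': "s' > s" "L * (s' powr Q * vol) < c"
      using eventually_happens by force
    have "0 \<le> L * (s' powr Q * vol)" using L vol_pos by simp
    then have c0: "c > 0" using s' by linarith
    \<comment> \<open>\<open>w\<close> < 1 is the ratio of the limit for the larger ball to the
      target c; \<delta> takes half of the gap, leaving the limit below (1 - \<delta>)c.\<close>
    define w where "w = L * (s' powr Q * vol) / c"
    have w: "w < 1" "0 \<le> w"
      using s' c0 L vol_pos by (auto simp: w_def)
    define \<delta> where "\<delta> = (1 - w) / 2"
    have \<delta>: "0 < \<delta>" "\<delta> < 1" "w < 1 - \<delta>" using w by (auto simp: \<delta>_def field_simps)
    obtain \<epsilon> where \<epsilon>: "\<epsilon> > 0" "\<And>x y. hg x < s \<Longrightarrow> hg y < \<epsilon> \<Longrightarrow> hg (x \<cdot> y) < s + (s' - s)"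
      using hgauge_mul_small[of "s' - s" s] s' by auto
    obtain C where C: "C \<ge> 0" "\<And>a. a > 0 \<Longrightarrow>
        (\<integral>\<^sup>+x. indicator {x. \<epsilon> \<le> hg x} x * ennreal (pker \<beta> a x) \<partial>lborel) \<le> ennreal (C * a powr (2 * \<beta>))"
      using nn_integral_pker_tail[OF \<beta> \<epsilon>(1)] by blast
    obtain a where a: "a > 0" "C * a powr (2 * \<beta>) \<le> \<delta>"
    proof
      let ?a = "(\<delta> / (C + 1)) powr (1 / (2 * \<beta>))"
      show "?a > 0" using \<delta> C by simp
      have "C * ?a powr (2 * \<beta>) = C / (C + 1) * \<delta>" using \<beta> \<delta> C by (simp add: powr_powr)
      also have "\<dots> \<le> 1 * \<delta>" using C \<delta> by (intro mult_right_mono) auto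
      finally show "C * ?a powr (2 * \<beta>) \<le> \<delta>" by simp
    qed
    \<comment> \<open>The kernel has total mass 1 and at most \<delta> of it lies outside the
      \<epsilon>-ball; left invariance carries this to every centre.\<close>
    have core: "ennreal (1 - \<delta>) \<le> (\<integral>\<^sup>+y. indicator (hball br 0 \<epsilon>) y * ennreal (pker \<beta> a y) \<partial>lborel)"
    proof -
      have "1 = (\<integral>\<^sup>+y. indicator (hball br 0 \<epsilon>) y * ennreal (pker \<beta> a y) + indicator {x. \<epsilon> \<le> hg x} y * ennreal (pker \<beta> a y) \<partial>lborel)"
        unfolding nn_integral_pker[OF \<beta> a(1), symmetric]
        by (intro nn_integral_cong) (auto simp: indicator_def)
      also have "\<dots> = (\<integral>\<^sup>+y. indicator (hball br 0 \<epsilon>) y * ennreal (pker \<beta> a y) \<partial>lborel) + (\<integral>\<^sup>+y. indicator {x. \<epsilon> \<le> hg x} y * ennreal (pker \<beta> a y) \<partial>lborel)"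
        by (intro nn_integral_add) measurable
      also have "\<dots> \<le> (\<integral>\<^sup>+y. indicator (hball br 0 \<epsilon>) y * ennreal (pker \<beta> a y) \<partial>lborel) + ennreal \<delta>"
        using C(2)[OF a(1)] a(2) by (intro add_left_mono) (auto intro: order_trans ennreal_leI)
      finally have "1 - ennreal \<delta> \<le> (\<integral>\<^sup>+y. indicator (hball br 0 \<epsilon>) y * ennreal (pker \<beta> a y) \<partial>lborel)"
        by (subst ennreal_minus_le_iff) (auto simp: add.commute)
      then show ?thesis using \<delta> by (simp add: ennreal_minus ennreal_1[symmetric] del: ennreal_1)
    qed
    have upper: "ennreal (1 - \<delta>) * emeasure (\<nu> j) (hball br n s) \<le> N a j (hball br n s')" for j
    proof -
      have "ennreal (1 - \<delta>) * emeasure (\<nu> j) (hball br n s) = (\<integral>\<^sup>+x. ennreal (1 - \<delta>) * indicator (hball br n s) x \<partial>\<nu> j)"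
        by (rule nn_integral_cmult_indicator[symmetric]) (simp add: sets)
      also have "\<dots> \<le> (\<integral>\<^sup>+x. \<integral>\<^sup>+y. indicator (hball br n s') y * ennreal (pker \<beta> a (ninv x \<cdot> y)) \<partial>lborel \<partial>\<nu> j)"
      proof (rule nn_integral_mono)
        fix x
        show "ennreal (1 - \<delta>) * indicator (hball br n s) x \<le> (\<integral>\<^sup>+y. indicator (hball br n s') y * ennreal (pker \<beta> a (ninv x \<cdot> y)) \<partial>lborel)"
        proof (cases "x \<in> hball br n s")
          case True
          have "ennreal (1 - \<delta>) \<le> (\<integral>\<^sup>+y. indicator (hball br 0 \<epsilon>) (ninv x \<cdot> y) * ennreal (pker \<beta> a (ninv x \<cdot> y)) \<partial>lborel)"
            using core by (simp add: nn_integral_pker_translate)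
          also have "\<dots> \<le> (\<integral>\<^sup>+y. indicator (hball br n s') y * ennreal (pker \<beta> a (ninv x \<cdot> y)) \<partial>lborel)"
          proof (intro nn_integral_mono mult_right_mono)
            fix y
            have "y \<in> hball br n s'" if "ninv x \<cdot> y \<in> hball br 0 \<epsilon>"
              using \<epsilon>(2)[of "ninv n \<cdot> x" "ninv x \<cdot> y"] that True by (simp add: mem_hball mul_assoc)
            then show "indicator (hball br 0 \<epsilon>) (ninv x \<cdot> y) \<le> (indicator (hball br n s') y :: ennreal)"
              by (auto simp: indicator_def simp del: mem_hball0)
          qed simp
          finally show ?thesis using True by simp
        qed simp
      qed
      also have "\<dots> = N a j (hball br n s')" using a by (simp add: tonelli)
      finally show ?thesis .
    qed
    have "L * (s' powr Q * vol) < (1 - \<delta>) * c" using \<delta>(3) c0 by (simp add: w_def divide_less_eq)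
    then have "ennreal (L * (s' powr Q * vol)) < ennreal ((1 - \<delta>) * c)"
      using L vol_pos by (intro ennreal_lessI) (auto intro: le_less_trans[rotated])
    from order_tendstoD(2)[OF N_lim[OF a(1)] this] s s'
    have "eventually (\<lambda>j. N a j (hball br n s') < ennreal ((1 - \<delta>) * c)) sequentially" by simp
    then show "eventually (\<lambda>j. measure (\<nu> j) (hball br n s) < c) sequentially"
    proof eventually_elim
      case (elim j)
      have "ennreal ((1 - \<delta>) * measure (\<nu> j) (hball br n s)) < ennreal ((1 - \<delta>) * c)"
        using le_less_trans[OF upper elim] \<delta> by (simp add: em ennreal_mult)
      then have "(1 - \<delta>) * measure (\<nu> j) (hball br n s) < (1 - \<delta>) * c"
        using \<delta> by (subst (asm) ennreal_less_iff) auto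
      then show ?case using \<delta> by simp
    qed
  next
    fix c assume c: "c < L * (s powr Q * vol)"
    show "eventually (\<lambda>j. c < measure (\<nu> j) (hball br n s)) sequentially"
    \<comment> \<open>Negative c is trivial since measures are nonnegative, and it is split off
      because \<open>ennreal\<close> truncates negative reals.\<close>
    proof (cases "c < 0")
      case True
      then show ?thesis by (intro always_eventually allI) (auto intro: less_le_trans)
    next
      case False
      have "eventually (\<lambda>t. t \<in> {0<..<s}) (at_left s)"
        using s by (intro eventually_at_leftI[of 0]) auto
      with order_tendstoD(1)[OF cont c]
      have "eventually (\<lambda>t. c < L * (t powr Q * vol) \<and> t \<in> {0<..<s}) (at_left s)"
        by (rule eventually_conj)
      then obtain s' where s': "0 < s'" "s' < s" "c < L * (s' powr Q * vol)"
        using eventually_happens by force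
      obtain \<epsilon> where \<epsilon>: "\<epsilon> > 0" "\<And>x y. hg x < s' \<Longrightarrow> hg y < \<epsilon> \<Longrightarrow> hg (x \<cdot> y) < s' + (s - s')"
        using hgauge_mul_small[of "s - s'" s'] s' by auto
      obtain C where C: "C \<ge> 0" "\<And>a x y. a > 0 \<Longrightarrow> hg (ninv x \<cdot> y) \<ge> \<epsilon> \<Longrightarrow>
          pker \<beta> a (ninv x \<cdot> y) \<le> C * a powr (2 * \<beta>) * pgauge 1 y powr (Q + 2 * \<beta>) * pgauge 1 x powr - (Q + 2 * \<beta>)"
        using pker_far_le[OF \<beta> \<epsilon>(1)] by blast
      obtain R where R: "R > 0" "hball br n s' \<subseteq> hball br 0 R"
        using bounded_subset_hball[OF bounded_hball] by blast
      define D where "D = C * (1 + R / 4) powr \<sigma>"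
      define v where "v = s' powr Q * vol"
      have D: "D \<ge> 0" "v \<ge> 0" using C vol_pos by (auto simp: D_def v_def)
      \<comment> \<open>The slack between the limit for the smaller ball and c; the height is chosen
        so that the far contribution \<open>K * a powr (2 * \<beta>)\<close> stays below it.\<close>
      define \<eta> where "\<eta> = L * v - c"
      have \<eta>: "\<eta> > 0" using s' by (simp add: \<eta>_def v_def)
      define K where "K = D * v * M"
      have K: "K \<ge> 0" using D M by (simp add: K_def)
      obtain a where a: "a > 0" "K * a powr (2 * \<beta>) < \<eta>"
      proof
        let ?a = "(\<eta> / (K + 1)) powr (1 / (2 * \<beta>))"
        show "?a > 0" using \<eta> K by simp
        have "K * ?a powr (2 * \<beta>) = K / (K + 1) * \<eta>" using \<beta> \<eta> K by (simp add: powr_powr)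
        also have "\<dots> < 1 * \<eta>" using K \<eta> by (intro mult_strict_right_mono) auto
        finally show "K * ?a powr (2 * \<beta>) < \<eta>" by simp
      qed
      have lower: "N a j (hball br n s') \<le> ennreal (measure (\<nu> j) (hball br n s) + K * a powr (2 * \<beta>))" for j
      proof -
        have "N a j (hball br n s') = (\<integral>\<^sup>+x. \<integral>\<^sup>+y. indicator (hball br n s') y * ennreal (pker \<beta> a (ninv x \<cdot> y)) \<partial>lborel \<partial>\<nu> j)"
          using a by (simp add: tonelli)
        also have "\<dots> \<le> (\<integral>\<^sup>+x. indicator (hball br n s) x + ennreal (D * v * a powr (2 * \<beta>)) * ennreal (pgauge 1 x powr - \<sigma>) \<partial>\<nu> j)"
        proof (rule nn_integral_mono)
          fix x
          show "(\<integral>\<^sup>+y. indicator (hball br n s') y * ennreal (pker \<beta> a (ninv x \<cdot> y)) \<partial>lborel)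
            \<le> indicator (hball br n s) x + ennreal (D * v * a powr (2 * \<beta>)) * ennreal (pgauge 1 x powr - \<sigma>)"
          proof (cases "x \<in> hball br n s")
            case True
            have "(\<integral>\<^sup>+y. indicator (hball br n s') y * ennreal (pker \<beta> a (ninv x \<cdot> y)) \<partial>lborel)
                \<le> (\<integral>\<^sup>+y. indicator UNIV (ninv x \<cdot> y) * ennreal (pker \<beta> a (ninv x \<cdot> y)) \<partial>lborel)"
              by (intro nn_integral_mono mult_right_mono) (auto simp: indicator_def)
            also have "\<dots> = 1" using nn_integral_pker[OF \<beta> a(1)]
              by (subst nn_integral_pker_translate) simp_all
            finally show ?thesis using True by (auto intro: order_trans)
          next
            case False
            have le: "pker \<beta> a (ninv x \<cdot> y) \<le> D * a powr (2 * \<beta>) * pgauge 1 x powr - \<sigma>" if y: "y \<in> hball br n s'" for y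
            proof -
              have "hg (ninv y \<cdot> x) \<ge> \<epsilon>"
              proof (rule ccontr)
                assume "\<not> ?thesis"
                then have "hg (ninv n \<cdot> y \<cdot> (ninv y \<cdot> x)) < s"
                  using \<epsilon>(2)[of "ninv n \<cdot> y" "ninv y \<cdot> x"] y by (simp add: mem_hball)
                then show False using False by (simp add: mem_hball mul_assoc)
              qed
              then have far: "hg (ninv x \<cdot> y) \<ge> \<epsilon>" using hdist_sym[of x y] by (simp add: hdist_def)
              have "hg y < R" using y R by auto
              then have "pgauge 1 y \<le> 1 + R / 4" using pgauge1_le_hg[of y] by simp
              then have gy: "pgauge 1 y powr \<sigma> \<le> (1 + R / 4) powr \<sigma>" using \<sigma> by (intro powr_mono2) auto
              have "pker \<beta> a (ninv x \<cdot> y) \<le> C * a powr (2 * \<beta>) * pgauge 1 y powr \<sigma> * pgauge 1 x powr - \<sigma>"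
                using C(2)[OF a(1) far] by (simp add: \<sigma>_def)
              also have "\<dots> \<le> C * a powr (2 * \<beta>) * (1 + R / 4) powr \<sigma> * pgauge 1 x powr - \<sigma>"
                using gy C(1) by (intro mult_right_mono mult_left_mono) auto
              finally show ?thesis by (simp add: D_def mult_ac)
            qed
            have "(\<integral>\<^sup>+y. indicator (hball br n s') y * ennreal (pker \<beta> a (ninv x \<cdot> y)) \<partial>lborel)
                \<le> (\<integral>\<^sup>+y. ennreal (D * a powr (2 * \<beta>) * pgauge 1 x powr - \<sigma>) * indicator (hball br n s') y \<partial>lborel)"
              using le by (intro nn_integral_mono) (auto simp: indicator_def intro: ennreal_leI)
            also have "\<dots> = ennreal (D * a powr (2 * \<beta>) * pgauge 1 x powr - \<sigma>) * ennreal v"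
              using s' by (subst nn_integral_cmult_indicator) (auto simp: emeasure_lborel_hball v_def)
            also have "\<dots> = ennreal (D * v * a powr (2 * \<beta>)) * ennreal (pgauge 1 x powr - \<sigma>)"
              using D by (simp add: ennreal_mult[symmetric] mult_ac)
            finally show ?thesis using False by simp
          qed
        qed
        also have "\<dots> = emeasure (\<nu> j) (hball br n s) + ennreal (D * v * a powr (2 * \<beta>)) * (\<integral>\<^sup>+x. ennreal (pgauge 1 x powr - \<sigma>) \<partial>\<nu> j)"
          by (subst nn_integral_add) (simp_all add: bm nn_integral_cmult sets)
        also have "\<dots> \<le> ennreal (measure (\<nu> j) (hball br n s)) + ennreal (D * v * a powr (2 * \<beta>)) * ennreal M"
          unfolding em using bnd'[of j] by (intro add_left_mono mult_left_mono) auto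
        also have "\<dots> = ennreal (measure (\<nu> j) (hball br n s) + K * a powr (2 * \<beta>))"
          using D M K by (simp add: ennreal_mult[symmetric] ennreal_plus[symmetric] K_def mult_ac del: ennreal_plus)
        finally show ?thesis .
      qed
      have "c + K * a powr (2 * \<beta>) < L * (s' powr Q * vol)" using a by (simp add: \<eta>_def v_def)
      then have "ennreal (c + K * a powr (2 * \<beta>)) < ennreal (L * (s' powr Q * vol))"
        using False K by (intro ennreal_lessI) (auto intro: le_less_trans[rotated])
      from order_tendstoD(1)[OF N_lim[OF a(1) s'(1)] this]
      show ?thesis
      proof eventually_elim
        case (elim j)
        have "ennreal (c + K * a powr (2 * \<beta>)) < ennreal (measure (\<nu> j) (hball br n s) + K * a powr (2 * \<beta>))"
          using less_le_trans[OF elim lower] .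
        then have "c + K * a powr (2 * \<beta>) < measure (\<nu> j) (hball br n s) + K * a powr (2 * \<beta>)"
          using False K by (subst (asm) ennreal_less_iff) auto
        then show ?case by simp
      qed
    qed
  qed
qed


section \<open>From balls to admissible limits\<close>

text \<open>The gauge inequality is raised to the power \<sigma>, with d chosen so that (1 +
  d)^\<sigma> = 1 + \<delta>. It perturbs on the right, so the kernel is first swapped and z^-1 x is
  written as (z^-1 y)(y^-1 x).\<close>

lemma pker_harnack:
  assumes \<beta>: "\<beta> > 0" and \<delta>: "\<delta> > 0"
  obtains \<epsilon> where "\<epsilon> > 0"
    "\<And>x y z. hg (ninv x \<cdot> y) < \<epsilon> \<Longrightarrow> pker \<beta> 1 (ninv y \<cdot> z) \<le> (1 + \<delta>) * pker \<beta> 1 (ninv x \<cdot> z)"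
proof -
  define \<sigma> where "\<sigma> = Q + 2 * \<beta>"
  have \<sigma>: "\<sigma> > 0" using Q_pos \<beta> by (simp add: \<sigma>_def)
  define d where "d = (1 + \<delta>) powr (1 / \<sigma>) - 1"
  have d: "d > 0" unfolding d_def using \<delta> \<sigma> by simp
  have d': "(1 + d) powr \<sigma> = 1 + \<delta>" using \<sigma> \<delta> by (simp add: d_def powr_powr)
  obtain \<epsilon> where \<epsilon>: "\<epsilon> > 0" "\<And>x y. hg y < \<epsilon> \<Longrightarrow> pgauge 1 (x \<cdot> y) \<le> (1 + d) * pgauge 1 x"
    using pgauge1_harnack[OF d] by blast
  show ?thesis
  proof
    show "\<epsilon> > 0" by fact
    fix x y z assume "hg (ninv x \<cdot> y) < \<epsilon>"
    then have "hg (ninv y \<cdot> x) < \<epsilon>" using hdist_sym[of x y] by (simp add: hdist_def)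
    from \<epsilon>(2)[OF this, of "ninv z \<cdot> y"]
    have "pgauge 1 (ninv z \<cdot> x) / (1 + d) \<le> pgauge 1 (ninv z \<cdot> y)"
      using d by (simp add: mul_assoc pos_divide_le_eq mult.commute)
    then have "pgauge 1 (ninv z \<cdot> y) powr - \<sigma> \<le> (pgauge 1 (ninv z \<cdot> x) / (1 + d)) powr - \<sigma>"
      using d \<sigma> pgauge_pos[of 1] by (intro powr_mono2') auto
    also have "\<dots> = pgauge 1 (ninv z \<cdot> x) powr - \<sigma> / (1 + d) powr - \<sigma>"
      using d by (intro powr_divide)
    also have "\<dots> = (1 + \<delta>) * pgauge 1 (ninv z \<cdot> x) powr - \<sigma>"
      by (simp add: powr_minus divide_inverse d' mult.commute)
    finally have "pgauge 1 (ninv z \<cdot> y) powr - \<sigma> / pmass \<beta> \<le> (1 + \<delta>) * pgauge 1 (ninv z \<cdot> x) powr - \<sigma> / pmass \<beta>"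
      using pmass_pos[OF \<beta>] by (intro divide_right_mono) auto
    then have "pker \<beta> 1 (ninv z \<cdot> y) \<le> (1 + \<delta>) * pker \<beta> 1 (ninv z \<cdot> x)"
      unfolding pker_def \<sigma>_def[symmetric] by simp
    then show "pker \<beta> 1 (ninv y \<cdot> z) \<le> (1 + \<delta>) * pker \<beta> 1 (ninv x \<cdot> z)"
      by (simp add: pker_swap[of \<beta> 1 _ z])
  qed
qed

lemma pker1_le: "\<beta> > 0 \<Longrightarrow> pker \<beta> 1 x \<le> 1 / pmass \<beta>"
proof -
  assume \<beta>: "\<beta> > 0"
  have "pgauge 1 x powr - (Q + 2 * \<beta>) \<le> 1 powr - (Q + 2 * \<beta>)"
    using \<beta> Q_pos pgauge_ge[of 1 x] by (intro powr_mono2') auto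
  then show ?thesis unfolding pker_def using pmass_pos[OF \<beta>] by (simp add: divide_right_mono)
qed

text \<open>The radius depends on the growth constant alone and is chosen before the measure, so it
  serves a whole family of blow-ups at once.\<close>

lemma pgauge1_tail:
  assumes \<tau>: "\<tau> > 0" and B: "B \<ge> 0" and \<delta>: "\<delta> > 0"
  obtains R where "R > 0"
    "\<And>\<nu>. sets \<nu> = sets borel \<Longrightarrow> (\<And>t. t > 0 \<Longrightarrow> emeasure \<nu> (hball br 0 t) \<le> ennreal (B * t powr Q)) \<Longrightarrow>
      (\<integral>\<^sup>+x. indicator {x. R \<le> hg x} x * ennreal (pgauge 1 x powr - (Q + \<tau>)) \<partial>\<nu>) \<le> ennreal \<delta>"
proof -
  define \<sigma> where "\<sigma> = Q + \<tau>"
  have \<sigma>: "\<sigma> > 0" using Q_pos \<tau> by (simp add: \<sigma>_def)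
  define D where "D = 4 powr \<sigma> * (B * 2 powr Q / (1 - 2 powr - \<tau>))"
  have "2 powr - \<tau> < 2 powr 0" using \<tau> by (intro powr_less_mono) auto
  then have D': "B * 2 powr Q / (1 - 2 powr - \<tau>) \<ge> 0" using B by simp
  then have D: "D \<ge> 0" unfolding D_def by (rule mult_nonneg_nonneg[rotated]) simp
  \<comment> \<open>Solves D R^-\<tau> = \<delta> D/(D + 1); the added 1 covers D = 0.\<close>
  define R where "R = (\<delta> / (D + 1)) powr - (1 / \<tau>)"
  have R: "R > 0" using \<delta> D by (simp add: R_def)
  have "D * R powr - \<tau> = D / (D + 1) * \<delta>" using \<tau> \<delta> D by (simp add: R_def powr_powr)
  also have "\<dots> \<le> 1 * \<delta>" using D \<delta> by (intro mult_right_mono) auto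
  finally have DR: "D * R powr - \<tau> \<le> \<delta>" by simp
  show ?thesis
  proof
    show "R > 0" by fact
    fix \<nu> :: "('v \<times> 'z) measure"
    assume sets: "sets \<nu> = sets borel"
      and gr: "\<And>t. t > 0 \<Longrightarrow> emeasure \<nu> (hball br 0 t) \<le> ennreal (B * t powr Q)"
    have bm: "borel_measurable \<nu> = borel_measurable borel"
      by (rule measurable_cong_sets[OF sets refl])
    have sp: "space \<nu> = UNIV" using sets_eq_imp_space_eq[OF sets] by simp
    have "(\<integral>\<^sup>+x. indicator {x. R \<le> hg x} x * ennreal (pgauge 1 x powr - \<sigma>) \<partial>\<nu>)
        \<le> (\<integral>\<^sup>+x. ennreal (4 powr \<sigma>) * (indicator {x. R \<le> hg x} x * ennreal (hg x powr - \<sigma>)) \<partial>\<nu>)"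
    proof (rule nn_integral_mono)
      fix x
      show "indicator {x. R \<le> hg x} x * ennreal (pgauge 1 x powr - \<sigma>)
          \<le> ennreal (4 powr \<sigma>) * (indicator {x. R \<le> hg x} x * ennreal (hg x powr - \<sigma>))"
        using pgauge_powr_le_hgauge[of 1 \<sigma> x] R \<sigma>
        by (auto simp: indicator_def ennreal_mult[symmetric] intro: ennreal_leI)
    qed
    also have "\<dots> = ennreal (4 powr \<sigma>) * (\<integral>\<^sup>+x. indicator {x. R \<le> hg x} x * ennreal (hg x powr - \<sigma>) \<partial>\<nu>)"
      by (rule nn_integral_cmult) (unfold bm, measurable)
    also have "\<dots> \<le> ennreal (4 powr \<sigma>) * ennreal (B * 2 powr Q / (1 - 2 powr - \<tau>) * R powr - \<tau>)"
    proof (intro mult_left_mono)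
      show "(\<integral>\<^sup>+x. indicator {x. R \<le> hg x} x * ennreal (hg x powr - \<sigma>) \<partial>\<nu>)
          \<le> ennreal (B * 2 powr Q / (1 - 2 powr - \<tau>) * R powr - \<tau>)"
        unfolding \<sigma>_def
      proof (rule nn_integral_tail_le)
        show "hg \<in> borel_measurable \<nu>" unfolding bm by measurable
        fix t :: real assume "t > 0"
        moreover have "{x \<in> space \<nu>. hg x < t} = hball br 0 t" by (auto simp: sp)
        ultimately show "emeasure \<nu> {x \<in> space \<nu>. hg x < t} \<le> ennreal (B * t powr Q)"
          using gr by simp
      qed (use \<tau> Q_pos B R in auto)
    qed simp
    also have "\<dots> = ennreal (4 powr \<sigma> * (B * 2 powr Q / (1 - 2 powr - \<tau>) * R powr - \<tau>))"
      by (rule ennreal_mult[symmetric, OF powr_ge_zero mult_nonneg_nonneg[OF D' powr_ge_zero]])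
    also have "4 powr \<sigma> * (B * 2 powr Q / (1 - 2 powr - \<tau>) * R powr - \<tau>) = D * R powr - \<tau>"
      by (simp only: D_def mult.assoc)
    also have "\<dots> \<le> ennreal \<delta>" using DR by (rule ennreal_leI)
    finally show "(\<integral>\<^sup>+x. indicator {x. R \<le> hg x} x * ennreal (pgauge 1 x powr - (Q + \<tau>)) \<partial>\<nu>) \<le> ennreal \<delta>"
      by (simp add: \<sigma>_def)
  qed
qed

text \<open>The kernel is compared with its averages over balls of a fixed small radius, which by
  the Harnack inequality changes the integral only by a factor close to 1.\<close>

lemma ball_limits_imp_pker_limit:
  fixes \<nu> :: "nat \<Rightarrow> ('v \<times> 'z) measure"
  assumes sets: "\<And>j. sets (\<nu> j) = sets borel" and \<beta>: "\<beta> > 0" and L: "L \<ge> 0"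
    and balls: "\<And>n s. s > 0 \<Longrightarrow> (\<lambda>j. measure (\<nu> j) (hball br n s)) \<longlonglongrightarrow> L * (s powr Q * vol)"
    and fin: "\<And>j R. R > 0 \<Longrightarrow> emeasure (\<nu> j) (hball br 0 R) < \<infinity>"
    and tail: "\<And>\<delta>. \<delta> > 0 \<Longrightarrow> \<exists>R>0. eventually (\<lambda>j. (\<integral>\<^sup>+x. indicator {x. R \<le> hg x} x *
        ennreal (pgauge 1 x powr - (Q + 2 * \<beta>)) \<partial>\<nu> j) \<le> ennreal \<delta>) sequentially"
    and \<xi>: "\<And>j. hg (\<xi> j) < \<alpha>"
  shows "(\<lambda>j. LINT x|\<nu> j. pker \<beta> 1 (ninv x \<cdot> \<xi> j)) \<longlonglongrightarrow> L"
proof -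
  define \<sigma> where "\<sigma> = Q + 2 * \<beta>"
  have \<sigma>: "\<sigma> > 0" using Q_pos \<beta> by (simp add: \<sigma>_def)
  have bm: "borel_measurable (\<nu> j) = borel_measurable borel" for j
    by (rule measurable_cong_sets[OF sets refl])
  have fin': "emeasure (\<nu> j) (hball br y r) < \<infinity>" for j y r
  proof -
    obtain R where R: "R > 0" "hball br y r \<subseteq> hball br 0 R"
      using bounded_subset_hball[OF bounded_hball] by blast
    have "emeasure (\<nu> j) (hball br y r) \<le> emeasure (\<nu> j) (hball br 0 R)"
      using R sets by (intro emeasure_mono) auto
    also have "\<dots> < \<infinity>" by (rule fin[OF R(1)])
    finally show ?thesis .
  qed
  then have em: "emeasure (\<nu> j) (hball br y r) = ennreal (measure (\<nu> j) (hball br y r))" for j y r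
    by (intro emeasure_eq_ennreal_measure) (simp add: less_top)
  interpret \<nu>: sigma_finite_measure "\<nu> j" for j
    using sets fin by (intro sigma_finite_of_finite_on_hballs)
  interpret pair: pair_sigma_finite lborel "\<nu> j" for j ..
  define f where "f j x = pker \<beta> 1 (ninv x \<cdot> \<xi> j)" for j x
  have f0: "f j x \<ge> 0" for j x using \<beta> by (simp add: f_def)
  have mf[measurable]: "f j \<in> borel_measurable borel" for j unfolding f_def by measurable
  have mf\<nu>[measurable]: "f j \<in> borel_measurable (\<nu> i)" for i j unfolding bm by measurable
  define q0 where "q0 = 1 / pmass \<beta>"
  have q0: "q0 > 0" using pmass_pos[OF \<beta>] by (simp add: q0_def)
  have fq: "f j x \<le> q0" for j x unfolding f_def q0_def by (rule pker1_le[OF \<beta>])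
  have \<alpha>: "\<alpha> > 0" using \<xi>[of 0] hgauge_nonneg[of "\<xi> 0"] by linarith
  obtain C0 where C0: "C0 \<ge> 0" "\<And>x y. pker \<beta> 1 (ninv x \<cdot> y) \<le> C0 * pgauge 1 y powr (Q + 2 * \<beta>) * pgauge 1 x powr - (Q + 2 * \<beta>)"
    using pker_le[OF \<beta>, of 1] by auto
  \<comment> \<open>Since \<open>\<xi> j\<close> stays in a fixed ball, the dependence of the kernel
    on it is absorbed into a constant, and the weight dominates all \<open>f j\<close> at
    once.\<close>
  define C where "C = C0 * (1 + \<alpha> / 4) powr \<sigma>"
  have C: "C \<ge> 0" using C0 by (simp add: C_def)
  have fC: "f j x \<le> C * pgauge 1 x powr - \<sigma>" for j x
  proof -
    have "pgauge 1 (\<xi> j) \<le> 1 + \<alpha> / 4" using pgauge1_le_hg[of "\<xi> j"] \<xi>[of j] by simp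
    then have "pgauge 1 (\<xi> j) powr \<sigma> \<le> (1 + \<alpha> / 4) powr \<sigma>" using \<sigma> by (intro powr_mono2) auto
    then have "C0 * pgauge 1 (\<xi> j) powr \<sigma> * pgauge 1 x powr - \<sigma> \<le> C * pgauge 1 x powr - \<sigma>"
      unfolding C_def using C0 by (intro mult_right_mono mult_left_mono) auto
    then show ?thesis using C0(2)[of x "\<xi> j"] unfolding f_def \<sigma>_def[symmetric] by linarith
  qed
  have f1: "(\<integral>\<^sup>+x. ennreal (f j x) \<partial>lborel) = 1" for j
  proof -
    have "(\<integral>\<^sup>+x. ennreal (f j x) \<partial>lborel) = (\<integral>\<^sup>+x. indicator UNIV (ninv (\<xi> j) \<cdot> x) * ennreal (pker \<beta> 1 (ninv (\<xi> j) \<cdot> x)) \<partial>lborel)"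
      unfolding f_def by (intro nn_integral_cong) (simp add: pker_swap[of \<beta> 1 _ "\<xi> j"])
    also have "\<dots> = 1"
      using nn_integral_pker[OF \<beta>, of 1] by (subst nn_integral_pker_translate) simp_all
    finally show ?thesis .
  qed
  define F where "F j = (\<integral>\<^sup>+x. ennreal (f j x) \<partial>\<nu> j)" for j
  \<comment> \<open>This holds without integrability, both sides being 0 when \<open>F j\<close> is
    infinite. Finiteness for large j is obtained in the course of \<open>key\<close>.\<close>
  have LF: "(LINT x|\<nu> j. pker \<beta> 1 (ninv x \<cdot> \<xi> j)) = enn2real (F j)" for j
    unfolding F_def f_def[symmetric] using f0 by (intro integral_eq_nn_integral) auto
  have key: "eventually (\<lambda>j. \<bar>enn2real (F j) - L\<bar> \<le> \<eta>) sequentially" if \<eta>: "\<eta> > 0" for \<eta>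
  proof -
    \<comment> \<open>The final estimates give total errors at most
      \<open>\<delta> * (2 * L + 4)\<close>, using \<delta> \<le> 1.\<close>
    define \<delta> where "\<delta> = min 1 (\<eta> / (2 * L + 4))"
    have \<delta>: "0 < \<delta>" "\<delta> \<le> 1" "\<delta> * (2 * L + 4) \<le> \<eta>"
    proof -
      show "0 < \<delta>" "\<delta> \<le> 1" using \<eta> L by (auto simp: \<delta>_def)
      have "\<delta> * (2 * L + 4) \<le> \<eta> / (2 * L + 4) * (2 * L + 4)"
        using L by (intro mult_right_mono) (auto simp: \<delta>_def)
      then show "\<delta> * (2 * L + 4) \<le> \<eta>" using L by simp
    qed
    have dC: "\<delta> / (C + 1) > 0" "C * (\<delta> / (C + 1)) \<le> \<delta>"
    proof -
      show "\<delta> / (C + 1) > 0" using \<delta> C by simp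
      have "C * (\<delta> / (C + 1)) = C / (C + 1) * \<delta>" by simp
      also have "\<dots> \<le> 1 * \<delta>" using C \<delta> by (intro mult_right_mono) auto
      finally show "C * (\<delta> / (C + 1)) \<le> \<delta>" by simp
    qed
    obtain R1 where R1: "R1 > 0" "eventually (\<lambda>j. (\<integral>\<^sup>+x. indicator {x. R1 \<le> hg x} x *
        ennreal (pgauge 1 x powr - \<sigma>) \<partial>\<nu> j) \<le> ennreal (\<delta> / (C + 1))) sequentially"
      using tail[OF dC(1)] unfolding \<sigma>_def by blast
    obtain R0 where R0: "R0 > 0"
      "(\<integral>\<^sup>+x. indicator {x. R0 \<le> hg x} x * ennreal (pgauge 1 x powr - \<sigma>) \<partial>lborel) \<le> ennreal (\<delta> / (C + 1))"
    proof -
      obtain R where R: "R > 0"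
        "\<And>\<nu>. sets \<nu> = sets borel \<Longrightarrow> (\<And>t. t > 0 \<Longrightarrow> emeasure \<nu> (hball br 0 t) \<le> ennreal (vol * t powr Q)) \<Longrightarrow>
          (\<integral>\<^sup>+x. indicator {x. R \<le> hg x} x * ennreal (pgauge 1 x powr - (Q + 2 * \<beta>)) \<partial>\<nu>) \<le> ennreal (\<delta> / (C + 1))"
        using pgauge1_tail[of "2 * \<beta>" vol "\<delta> / (C + 1)"] \<beta> vol_pos dC(1) by auto
      show ?thesis
        by (rule that[OF R(1)]) (use R(2)[of lborel] in \<open>simp add: \<sigma>_def emeasure_lborel_hball mult.commute\<close>)
    qed
    have tail_f: "(\<integral>\<^sup>+x. indicator {x. r \<le> hg x} x * ennreal (f j x) \<partial>M) \<le> ennreal \<delta>"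
      if "(\<integral>\<^sup>+x. indicator {x. r \<le> hg x} x * ennreal (pgauge 1 x powr - \<sigma>) \<partial>M) \<le> ennreal (\<delta> / (C + 1))"
        "sets M = sets borel" for r j M
    proof -
      have bM: "borel_measurable M = borel_measurable borel"
        by (rule measurable_cong_sets[OF that(2) refl])
      have "(\<integral>\<^sup>+x. indicator {x. r \<le> hg x} x * ennreal (f j x) \<partial>M)
          \<le> (\<integral>\<^sup>+x. ennreal C * (indicator {x. r \<le> hg x} x * ennreal (pgauge 1 x powr - \<sigma>)) \<partial>M)"
        using fC C by (intro nn_integral_mono) (auto simp: indicator_def ennreal_mult[symmetric] intro: ennreal_leI)
      also have "\<dots> = ennreal C * (\<integral>\<^sup>+x. indicator {x. r \<le> hg x} x * ennreal (pgauge 1 x powr - \<sigma>) \<partial>M)"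
        by (rule nn_integral_cmult) (unfold bM, measurable)
      also have "\<dots> \<le> ennreal C * ennreal (\<delta> / (C + 1))" by (intro mult_left_mono that) simp
      also have "\<dots> \<le> ennreal \<delta>" using dC C by (simp add: ennreal_mult[symmetric] ennreal_leI)
      finally show ?thesis .
    qed
    \<comment> \<open>\<open>R0\<close> controls the Lebesgue tail and \<open>R1\<close> the tails
      of the measures; the margin 1 ensures that \<epsilon>-balls centred in the ball of radius
      \<open>R1\<close> stay in the ball of radius \<open>R\<close>.\<close>
    define R where "R = max R0 (R1 + 1)"
    have R: "R > 0" "R \<ge> R0" "R \<ge> R1 + 1" using R0 by (auto simp: R_def)
    obtain \<epsilon>1 where \<epsilon>1: "\<epsilon>1 > 0"
      "\<And>x y z. hg (ninv x \<cdot> y) < \<epsilon>1 \<Longrightarrow> pker \<beta> 1 (ninv y \<cdot> z) \<le> (1 + \<delta>) * pker \<beta> 1 (ninv x \<cdot> z)"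
      using pker_harnack[OF \<beta> \<delta>(1)] by blast
    obtain \<epsilon>2 where \<epsilon>2: "\<epsilon>2 > 0" "\<And>x y. hg x < R1 \<Longrightarrow> hg y < \<epsilon>2 \<Longrightarrow> hg (x \<cdot> y) < R1 + 1"
      using hgauge_mul_small[of 1 R1] by auto
    obtain \<epsilon>3 where \<epsilon>3: "\<epsilon>3 > 0" "\<And>x y. hg x < R \<Longrightarrow> hg y < \<epsilon>3 \<Longrightarrow> hg (x \<cdot> y) < R + 1"
      using hgauge_mul_small[of 1 R] by auto
    define \<epsilon> where "\<epsilon> = min \<epsilon>1 (min \<epsilon>2 \<epsilon>3)"
    have \<epsilon>: "\<epsilon> > 0" using \<epsilon>1 \<epsilon>2 \<epsilon>3 by (simp add: \<epsilon>_def)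
    have harnack: "f j y \<le> (1 + \<delta>) * f j x" if "hg (ninv x \<cdot> y) < \<epsilon>" for j x y
      unfolding f_def using that by (intro \<epsilon>1) (simp add: \<epsilon>_def)
    have near: "hg y < r + 1" if "hg x < r" "hg (ninv x \<cdot> y) < \<epsilon>" "r = R1 \<or> r = R" for x y r
      using \<epsilon>2(2)[of x "ninv x \<cdot> y"] \<epsilon>3(2)[of x "ninv x \<cdot> y"] that by (auto simp: \<epsilon>_def)
    have sym: "hg (ninv x \<cdot> y) = hg (ninv y \<cdot> x)" for x y
      using hdist_sym[of x y] by (simp add: hdist_def)
    define m where "m = \<epsilon> powr Q * vol"
    have m: "m > 0" using \<epsilon> vol_pos by (simp add: m_def)
    \<comment> \<open>The density of \<open>\<nu> j\<close> on an \<epsilon>-ball. The hypothesis on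
      balls says exactly that it converges to \<open>L\<close> at each y.\<close>
    define A where "A j y = measure (\<nu> j) (hball br y \<epsilon>) / m" for j y
    have A0: "A j y \<ge> 0" for j y using m by (simp add: A_def)
    have emA: "emeasure (\<nu> j) (hball br y \<epsilon>) = ennreal (m * A j y)" for j y
      using m by (simp add: em A_def)
    have Alim: "(\<lambda>j. A j y) \<longlonglongrightarrow> L" for y
    proof -
      have "(\<lambda>j. A j y) \<longlonglongrightarrow> L * (\<epsilon> powr Q * vol) / m"
        unfolding A_def using m by (intro tendsto_divide balls[OF \<epsilon>] tendsto_const) auto
      then show ?thesis using m by (simp add: m_def[symmetric])
    qed
    have mind: "(\<lambda>(y, x). indicator {z. hg z < \<epsilon>} (ninv y \<cdot> x) :: ennreal) \<in> borel_measurable (borel \<Otimes>\<^sub>M borel)"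
      by measurable
    have eqs: "sets (lborel \<Otimes>\<^sub>M \<nu> j) = sets ((borel :: ('v \<times> 'z) measure) \<Otimes>\<^sub>M borel)" for j
      by (intro sets_pair_measure_cong) (simp_all add: sets)
    have ind: "indicator {z. hg z < \<epsilon>} (ninv y \<cdot> x) = (indicator (hball br y \<epsilon>) x :: ennreal)" for x y
      by (simp add: indicator_def mem_hball)
    have mA[measurable]: "A j \<in> borel_measurable borel" for j
    proof -
      have "(\<lambda>y. \<integral>\<^sup>+x. indicator {z. hg z < \<epsilon>} (ninv y \<cdot> x) \<partial>\<nu> j) \<in> borel_measurable lborel"
        by (rule \<nu>.borel_measurable_nn_integral) (unfold measurable_cong_sets[OF eqs refl], rule mind)
      then have "(\<lambda>y. emeasure (\<nu> j) (hball br y \<epsilon>)) \<in> borel_measurable borel"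
        unfolding ind by (simp add: sets)
      then have "(\<lambda>y. enn2real (emeasure (\<nu> j) (hball br y \<epsilon>)) / m) \<in> borel_measurable borel"
        by measurable
      then show ?thesis by (simp add: A_def [abs_def] measure_def)
    qed
    \<comment> \<open>The L1 distance from the averaged density to \<open>L\<close> on the ball of
      radius \<open>R\<close>. It tends to 0 by dominated convergence: the relevant \<epsilon>-balls
      lie in one ball whose masses converge and hence are bounded.\<close>
    define E where "E j = (\<integral>\<^sup>+y. indicator (hball br 0 R) y * ennreal \<bar>A j y - L\<bar> \<partial>lborel)" for j
    have E_lim: "E \<longlonglongrightarrow> 0"
    proof -
      have "Bseq (\<lambda>j. measure (\<nu> j) (hball br 0 (R + 1)))"
        using balls[of "R + 1" 0] R by (intro convergent_imp_Bseq) (auto simp: convergent_def)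
      then obtain B where B: "\<And>j. norm (measure (\<nu> j) (hball br 0 (R + 1))) \<le> B"
        unfolding Bseq_def by blast
      have le: "\<bar>A j y - L\<bar> \<le> B / m + L" if y: "y \<in> hball br 0 R" for j y
      proof -
        have "hball br y \<epsilon> \<subseteq> hball br 0 (R + 1)"
          using near[of y R] y by (auto simp: mem_hball simp del: split_paired_All)
        then have "measure (\<nu> j) (hball br y \<epsilon>) \<le> measure (\<nu> j) (hball br 0 (R + 1))"
          using fin' by (intro measure_mono_fmeasurable fmeasurableI) (auto simp: sets)
        also have "\<dots> \<le> B" using B[of j] by simp
        finally have "A j y \<le> B / m" using m by (simp add: A_def divide_right_mono)
        then show ?thesis using A0[of j y] L by linarith
      qed
      have "E \<longlonglongrightarrow> (\<integral>\<^sup>+y. 0 \<partial>(lborel :: ('v \<times> 'z) measure))"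
        unfolding E_def
      proof (rule nn_integral_dominated_convergence)
        show "AE y in lborel. indicator (hball br 0 R) y * ennreal \<bar>A j y - L\<bar> \<le> ennreal (B / m + L) * indicator (hball br 0 R) y" for j
          using le by (intro AE_I2) (auto simp: indicator_def intro: ennreal_leI)
        show "(\<integral>\<^sup>+y. ennreal (B / m + L) * indicator (hball br 0 R) y \<partial>lborel) < \<infinity>"
          using R by (subst nn_integral_cmult_indicator) (auto simp: emeasure_lborel_hball ennreal_mult_less_top)
        show "AE y in lborel. (\<lambda>j. indicator (hball br 0 R) y * ennreal \<bar>A j y - L\<bar>) \<longlonglongrightarrow> 0"
        proof (rule AE_I2)
          fix y
          have "(\<lambda>j. \<bar>A j y - L\<bar>) \<longlonglongrightarrow> \<bar>L - L\<bar>" by (intro tendsto_intros Alim)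
          then have "(\<lambda>j. ennreal \<bar>A j y - L\<bar>) \<longlonglongrightarrow> ennreal 0" by (intro tendsto_ennrealI) simp
          then show "(\<lambda>j. indicator (hball br 0 R) y * ennreal \<bar>A j y - L\<bar>) \<longlonglongrightarrow> 0"
            by (auto simp: indicator_def)
        qed
      qed auto
      then show ?thesis by simp
    qed
    \<comment> \<open>An integral seen from two sides. In y it involves only masses of balls; after
      Tonelli, each x sees f averaged over its own \<epsilon>-ball, which Harnack compares with m
      times f at x.\<close>
    define G where "G j = (\<integral>\<^sup>+y. indicator (hball br 0 R) y * ennreal (f j y) * emeasure (\<nu> j) (hball br y \<epsilon>) \<partial>lborel)" for j
    have G_eq: "G j = (\<integral>\<^sup>+x. \<integral>\<^sup>+y. indicator (hball br 0 R) y * ennreal (f j y) * indicator (hball br y \<epsilon>) x \<partial>lborel \<partial>\<nu> j)" for j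
    proof -
      have "G j = (\<integral>\<^sup>+y. \<integral>\<^sup>+x. indicator (hball br 0 R) y * ennreal (f j y) * indicator (hball br y \<epsilon>) x \<partial>\<nu> j \<partial>lborel)"
        unfolding G_def by (intro nn_integral_cong) (simp add: nn_integral_cmult_indicator sets)
      also have "\<dots> = (\<integral>\<^sup>+x. \<integral>\<^sup>+y. indicator (hball br 0 R) y * ennreal (f j y) * indicator (hball br y \<epsilon>) x \<partial>lborel \<partial>\<nu> j)"
      proof (rule pair.Fubini'[symmetric])
        have "(\<lambda>(y, x). indicator (hball br 0 R) y * ennreal (f j y) * indicator {z. hg z < \<epsilon>} (ninv y \<cdot> x)) \<in> borel_measurable (borel \<Otimes>\<^sub>M borel)"
          by measurable
        then show "(\<lambda>(y, x). indicator (hball br 0 R) y * ennreal (f j y) * indicator (hball br y \<epsilon>) x) \<in> borel_measurable (lborel \<Otimes>\<^sub>M \<nu> j)"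
          unfolding measurable_cong_sets[OF eqs refl] ind .
      qed
      finally show ?thesis .
    qed
    have vol_ball: "emeasure lborel (hball br x \<epsilon>) = ennreal m" for x
      using \<epsilon> by (simp add: emeasure_lborel_hball m_def)
    have G_le: "G j \<le> ennreal ((1 + \<delta>) * m) * F j" for j
    proof -
      have "G j \<le> (\<integral>\<^sup>+x. ennreal ((1 + \<delta>) * m) * ennreal (f j x) \<partial>\<nu> j)"
        unfolding G_eq
      proof (rule nn_integral_mono)
        fix x
        have "(\<integral>\<^sup>+y. indicator (hball br 0 R) y * ennreal (f j y) * indicator (hball br y \<epsilon>) x \<partial>lborel)
          \<le> (\<integral>\<^sup>+y. ennreal ((1 + \<delta>) * f j x) * indicator (hball br x \<epsilon>) y \<partial>lborel)"
        proof (rule nn_integral_mono)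
          fix y
          show "indicator (hball br 0 R) y * ennreal (f j y) * indicator (hball br y \<epsilon>) x \<le> ennreal ((1 + \<delta>) * f j x) * indicator (hball br x \<epsilon>) y"
            using harnack[of x y j] sym[of x y]
            by (cases "hg (ninv x \<cdot> y) < \<epsilon>") (auto simp: indicator_def mem_hball intro: ennreal_leI)
        qed
        also have "\<dots> = ennreal ((1 + \<delta>) * f j x) * ennreal m"
          by (subst nn_integral_cmult_indicator) (auto simp: vol_ball)
        also have "\<dots> = ennreal ((1 + \<delta>) * m) * ennreal (f j x)"
          using \<delta> f0 m by (simp add: ennreal_mult[symmetric] mult_ac)
        finally show "(\<integral>\<^sup>+y. indicator (hball br 0 R) y * ennreal (f j y) * indicator (hball br y \<epsilon>) x \<partial>lborel)
          \<le> ennreal ((1 + \<delta>) * m) * ennreal (f j x)" .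
      qed
      also have "\<dots> = ennreal ((1 + \<delta>) * m) * F j" unfolding F_def by (rule nn_integral_cmult) measurable
      finally show ?thesis .
    qed
    have G_ge: "ennreal m * (\<integral>\<^sup>+x. indicator (hball br 0 R1) x * ennreal (f j x) \<partial>\<nu> j) \<le> ennreal (1 + \<delta>) * G j" for j
    proof -
      have mm: "(\<lambda>x. \<integral>\<^sup>+y. indicator (hball br 0 R) y * ennreal (f j y) * indicator (hball br y \<epsilon>) x \<partial>lborel) \<in> borel_measurable (\<nu> j)"
      proof -
        have "(\<lambda>(x, y). indicator (hball br 0 R) y * ennreal (f j y) * indicator {z. hg z < \<epsilon>} (ninv y \<cdot> x)) \<in> borel_measurable (borel \<Otimes>\<^sub>M lborel)"
          by measurable
        then show ?thesis unfolding bm ind by (rule lborel.borel_measurable_nn_integral)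
      qed
      have "ennreal m * (\<integral>\<^sup>+x. indicator (hball br 0 R1) x * ennreal (f j x) \<partial>\<nu> j)
          = (\<integral>\<^sup>+x. ennreal m * (indicator (hball br 0 R1) x * ennreal (f j x)) \<partial>\<nu> j)"
        by (rule nn_integral_cmult[symmetric]) (unfold bm, measurable)
      also have "\<dots> \<le> (\<integral>\<^sup>+x. ennreal (1 + \<delta>) * (\<integral>\<^sup>+y. indicator (hball br 0 R) y * ennreal (f j y) * indicator (hball br y \<epsilon>) x \<partial>lborel) \<partial>\<nu> j)"
      proof (rule nn_integral_mono)
        fix x
        show "ennreal m * (indicator (hball br 0 R1) x * ennreal (f j x))
          \<le> ennreal (1 + \<delta>) * (\<integral>\<^sup>+y. indicator (hball br 0 R) y * ennreal (f j y) * indicator (hball br y \<epsilon>) x \<partial>lborel)"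
        proof (cases "hg x < R1")
          case True
          have "ennreal m * ennreal (f j x) = (\<integral>\<^sup>+y. ennreal (f j x) * indicator (hball br x \<epsilon>) y \<partial>lborel)"
            by (subst nn_integral_cmult_indicator) (auto simp: vol_ball mult.commute)
          also have "\<dots> \<le> (\<integral>\<^sup>+y. ennreal (1 + \<delta>) * (indicator (hball br 0 R) y * ennreal (f j y) * indicator (hball br y \<epsilon>) x) \<partial>lborel)"
          proof (rule nn_integral_mono)
            fix y
            show "ennreal (f j x) * indicator (hball br x \<epsilon>) y \<le> ennreal (1 + \<delta>) * (indicator (hball br 0 R) y * ennreal (f j y) * indicator (hball br y \<epsilon>) x)"
            proof (cases "hg (ninv x \<cdot> y) < \<epsilon>")
              case c: True
              have "hg y < R" using near[OF True c] R by auto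
              moreover have "f j x \<le> (1 + \<delta>) * f j y" using harnack[of y x j] c sym[of x y] by simp
              moreover from calculation(2) have "ennreal (f j x) \<le> ennreal (1 + \<delta>) * ennreal (f j y)"
                using \<delta> f0[of j y] by (subst ennreal_mult[symmetric]) (auto intro: ennreal_leI)
              ultimately show ?thesis using c sym[of x y]
                by (simp add: mem_hball del: ennreal_plus)
            qed (simp add: mem_hball)
          qed
          also have "\<dots> = ennreal (1 + \<delta>) * (\<integral>\<^sup>+y. indicator (hball br 0 R) y * ennreal (f j y) * indicator (hball br y \<epsilon>) x \<partial>lborel)"
          proof (rule nn_integral_cmult)
            show "(\<lambda>y. indicator (hball br 0 R) y * ennreal (f j y) * indicator (hball br y \<epsilon>) x) \<in> borel_measurable lborel"
              unfolding ind[symmetric] by measurable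
          qed
          finally show ?thesis using True by simp
        qed simp
      qed
      also have "\<dots> = ennreal (1 + \<delta>) * G j" unfolding G_eq by (rule nn_integral_cmult) (rule mm)
      finally show ?thesis .
    qed
    have Gm: "G j = ennreal m * (\<integral>\<^sup>+y. indicator (hball br 0 R) y * ennreal (f j y * A j y) \<partial>lborel)" for j
    proof -
      have "G j = (\<integral>\<^sup>+y. ennreal m * (indicator (hball br 0 R) y * ennreal (f j y * A j y)) \<partial>lborel)"
        unfolding G_def emA using f0 m A0 by (intro nn_integral_cong) (simp add: ennreal_mult mult_ac)
      also have "\<dots> = ennreal m * (\<integral>\<^sup>+y. indicator (hball br 0 R) y * ennreal (f j y * A j y) \<partial>lborel)"
        by (rule nn_integral_cmult) measurable
      finally show ?thesis .
    qed
    have q0E: "(\<integral>\<^sup>+y. ennreal q0 * (indicator (hball br 0 R) y * ennreal \<bar>A j y - L\<bar>) \<partial>lborel) = ennreal q0 * E j" for j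
      unfolding E_def by (rule nn_integral_cmult) measurable
    have fE: "\<bar>f j y * A j y - L * f j y\<bar> \<le> q0 * \<bar>A j y - L\<bar>" for j y
    proof -
      have "f j y * A j y - L * f j y = f j y * (A j y - L)" by (simp add: algebra_simps)
      then have "\<bar>f j y * A j y - L * f j y\<bar> = f j y * \<bar>A j y - L\<bar>"
        using f0[of j y] by (simp add: abs_mult)
      also have "\<dots> \<le> q0 * \<bar>A j y - L\<bar>" using fq by (intro mult_right_mono) auto
      finally show ?thesis .
    qed
    \<comment> \<open>Replacing \<open>A\<close> by \<open>L\<close> costs at most the maximum q0 of
      f times \<open>E\<close>; what remains is \<open>L\<close> times the mass of f, at most 1 here
      and at least 1 - \<delta> in the companion lower bound.\<close>
    have up: "(\<integral>\<^sup>+y. indicator (hball br 0 R) y * ennreal (f j y * A j y) \<partial>lborel) \<le> ennreal L + ennreal q0 * E j" for j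
    proof -
      have "(\<integral>\<^sup>+y. indicator (hball br 0 R) y * ennreal (f j y * A j y) \<partial>lborel)
          \<le> (\<integral>\<^sup>+y. ennreal L * ennreal (f j y) + ennreal q0 * (indicator (hball br 0 R) y * ennreal \<bar>A j y - L\<bar>) \<partial>lborel)"
      proof (rule nn_integral_mono)
        fix y
        have "f j y * A j y \<le> L * f j y + q0 * \<bar>A j y - L\<bar>" using fE[of j y] by linarith
        then show "indicator (hball br 0 R) y * ennreal (f j y * A j y) \<le> ennreal L * ennreal (f j y) + ennreal q0 * (indicator (hball br 0 R) y * ennreal \<bar>A j y - L\<bar>)"
          using L f0[of j y] q0 by (cases "hg y < R") (simp_all add: ennreal_mult[symmetric] ennreal_plus[symmetric] ennreal_leI del: ennreal_plus)
      qed
      also have "\<dots> = ennreal L * (\<integral>\<^sup>+y. ennreal (f j y) \<partial>lborel) + ennreal q0 * E j"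
        unfolding q0E[symmetric] by (subst nn_integral_add) (auto simp: nn_integral_cmult)
      finally show ?thesis by (simp add: f1)
    qed
    have low: "ennreal (L * (1 - \<delta>)) \<le> (\<integral>\<^sup>+y. indicator (hball br 0 R) y * ennreal (f j y * A j y) \<partial>lborel) + ennreal q0 * E j" for j
    proof -
      have "(\<integral>\<^sup>+x. indicator {x. R \<le> hg x} x * ennreal (f j x) \<partial>lborel) \<le> (\<integral>\<^sup>+x. indicator {x. R0 \<le> hg x} x * ennreal (f j x) \<partial>lborel)"
        using R by (intro nn_integral_mono mult_right_mono) (auto simp: indicator_def)
      also have "\<dots> \<le> ennreal \<delta>" by (rule tail_f[OF R0(2)]) simp
      finally have t: "(\<integral>\<^sup>+x. indicator {x. R \<le> hg x} x * ennreal (f j x) \<partial>lborel) \<le> ennreal \<delta>" .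
      have "1 = (\<integral>\<^sup>+y. indicator (hball br 0 R) y * ennreal (f j y) + indicator {x. R \<le> hg x} y * ennreal (f j y) \<partial>lborel)"
        unfolding f1[of j, symmetric] by (intro nn_integral_cong) (auto simp: indicator_def)
      also have "\<dots> = (\<integral>\<^sup>+y. indicator (hball br 0 R) y * ennreal (f j y) \<partial>lborel) + (\<integral>\<^sup>+y. indicator {x. R \<le> hg x} y * ennreal (f j y) \<partial>lborel)"
        by (intro nn_integral_add) measurable
      also have "\<dots> \<le> (\<integral>\<^sup>+y. indicator (hball br 0 R) y * ennreal (f j y) \<partial>lborel) + ennreal \<delta>"
        using t by (rule add_left_mono)
      finally have "1 - ennreal \<delta> \<le> (\<integral>\<^sup>+y. indicator (hball br 0 R) y * ennreal (f j y) \<partial>lborel)"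
        by (subst ennreal_minus_le_iff) (auto simp: add.commute)
      then have mass: "ennreal (1 - \<delta>) \<le> (\<integral>\<^sup>+y. indicator (hball br 0 R) y * ennreal (f j y) \<partial>lborel)"
        using \<delta> by (simp add: ennreal_minus ennreal_1[symmetric] del: ennreal_1)
      have "ennreal (L * (1 - \<delta>)) = ennreal L * ennreal (1 - \<delta>)" using L \<delta> by (simp add: ennreal_mult)
      also have "\<dots> \<le> ennreal L * (\<integral>\<^sup>+y. indicator (hball br 0 R) y * ennreal (f j y) \<partial>lborel)"
        using mass by (intro mult_left_mono) auto
      also have "\<dots> = (\<integral>\<^sup>+y. ennreal L * (indicator (hball br 0 R) y * ennreal (f j y)) \<partial>lborel)"
        by (rule nn_integral_cmult[symmetric]) measurable
      also have "\<dots> \<le> (\<integral>\<^sup>+y. indicator (hball br 0 R) y * ennreal (f j y * A j y) + ennreal q0 * (indicator (hball br 0 R) y * ennreal \<bar>A j y - L\<bar>) \<partial>lborel)"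
      proof (rule nn_integral_mono)
        fix y
        have "L * f j y \<le> f j y * A j y + q0 * \<bar>A j y - L\<bar>" using fE[of j y] by linarith
        then show "ennreal L * (indicator (hball br 0 R) y * ennreal (f j y)) \<le> indicator (hball br 0 R) y * ennreal (f j y * A j y) + ennreal q0 * (indicator (hball br 0 R) y * ennreal \<bar>A j y - L\<bar>)"
          using L f0[of j y] A0[of j y] q0 by (cases "hg y < R") (simp_all add: ennreal_mult[symmetric] ennreal_plus[symmetric] ennreal_leI del: ennreal_plus)
      qed
      also have "\<dots> = (\<integral>\<^sup>+y. indicator (hball br 0 R) y * ennreal (f j y * A j y) \<partial>lborel) + ennreal q0 * E j"
        unfolding q0E[symmetric] by (rule nn_integral_add) measurable
      finally show ?thesis .
    qed
    have "eventually (\<lambda>j. E j < ennreal (\<delta> / q0)) sequentially"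
      using order_tendstoD(2)[OF E_lim, of "ennreal (\<delta> / q0)"] \<delta> q0 by simp
    with R1(2) show ?thesis
    proof eventually_elim
      case (elim j)
      have "ennreal q0 * E j \<le> ennreal q0 * ennreal (\<delta> / q0)"
        using elim by (intro mult_left_mono) auto
      also have "\<dots> = ennreal \<delta>" using q0 \<delta> by (simp add: ennreal_mult[symmetric])
      finally have E\<delta>: "ennreal q0 * E j \<le> ennreal \<delta>" .
      define H where "H = (\<integral>\<^sup>+y. indicator (hball br 0 R) y * ennreal (f j y * A j y) \<partial>lborel)"
      have "H \<le> ennreal L + ennreal \<delta>"
        unfolding H_def by (rule order_trans[OF up add_left_mono[OF E\<delta>]])
      then have H1: "H \<le> ennreal (L + \<delta>)" using L \<delta> by simp
      \<comment> \<open>Finiteness must come before passing to real numbers; the same is done for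
        \<open>F j\<close> below.\<close>
      then have "H < top" by (rule order.strict_trans1) simp
      then obtain h where h: "h \<ge> 0" "H = ennreal h" by (metis ennreal_cases less_irrefl)
      have h1: "h \<le> L + \<delta>" using H1 L \<delta> by (simp add: h del: ennreal_plus)
      have "ennreal (L * (1 - \<delta>)) \<le> H + ennreal \<delta>"
        unfolding H_def by (rule order_trans[OF low add_left_mono[OF E\<delta>]])
      then have h2: "L * (1 - \<delta>) \<le> h + \<delta>"
        using h \<delta> by (simp add: ennreal_plus[symmetric] del: ennreal_plus)
      have "(\<integral>\<^sup>+x. indicator (hball br 0 R1) x * ennreal (f j x) \<partial>\<nu> j) \<le> ennreal ((1 + \<delta>) * h)"
      proof -
        define I where "I = (\<integral>\<^sup>+x. indicator (hball br 0 R1) x * ennreal (f j x) \<partial>\<nu> j)"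
        have "ennreal (1 / m) * (ennreal m * I) \<le> ennreal (1 / m) * (ennreal (1 + \<delta>) * (ennreal m * ennreal h))"
          using G_ge[of j] unfolding Gm H_def[symmetric] h(2) I_def[symmetric] by (intro mult_left_mono) auto
        also have "\<dots> = ennreal ((1 + \<delta>) * h)"
          using m h(1) \<delta> by (simp add: ennreal_mult[symmetric] del: ennreal_plus)
        also have "ennreal (1 / m) * (ennreal m * I) = I"
          using m by (simp add: mult.assoc[symmetric] ennreal_mult[symmetric])
        finally show ?thesis by (simp add: I_def)
      qed
      moreover have "F j = (\<integral>\<^sup>+x. indicator (hball br 0 R1) x * ennreal (f j x) \<partial>\<nu> j) + (\<integral>\<^sup>+x. indicator {x. R1 \<le> hg x} x * ennreal (f j x) \<partial>\<nu> j)"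
      proof -
        have "F j = (\<integral>\<^sup>+x. indicator (hball br 0 R1) x * ennreal (f j x) + indicator {x. R1 \<le> hg x} x * ennreal (f j x) \<partial>\<nu> j)"
          unfolding F_def by (intro nn_integral_cong) (auto simp: indicator_def)
        also have "\<dots> = (\<integral>\<^sup>+x. indicator (hball br 0 R1) x * ennreal (f j x) \<partial>\<nu> j) + (\<integral>\<^sup>+x. indicator {x. R1 \<le> hg x} x * ennreal (f j x) \<partial>\<nu> j)"
          by (intro nn_integral_add) (unfold bm, measurable)
        finally show ?thesis .
      qed
      ultimately have "F j \<le> ennreal ((1 + \<delta>) * h) + ennreal \<delta>"
        using tail_f[OF elim(1) sets] by (simp add: add_mono)
      then have F1: "F j \<le> ennreal ((1 + \<delta>) * h + \<delta>)" using h \<delta> by simp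
      then have "F j < top" by (rule order.strict_trans1) simp
      then obtain \<phi> where \<phi>: "\<phi> \<ge> 0" "F j = ennreal \<phi>" by (metis ennreal_cases less_irrefl)
      have p1: "\<phi> \<le> (1 + \<delta>) * h + \<delta>" using F1 h \<delta> by (simp add: \<phi> del: ennreal_plus)
      have "ennreal m * ennreal h \<le> ennreal ((1 + \<delta>) * m) * ennreal \<phi>"
        using G_le[of j] unfolding Gm H_def[symmetric] h(2) \<phi>(2) .
      then have "m * h \<le> (1 + \<delta>) * m * \<phi>" using m h \<phi> \<delta> by (simp add: ennreal_mult[symmetric] del: ennreal_plus)
      then have p2: "h \<le> (1 + \<delta>) * \<phi>" using m by (simp add: mult.commute mult.left_commute)
      have "(1 + \<delta>) * h \<le> (1 + \<delta>) * (L + \<delta>)" using h1 \<delta> by (intro mult_left_mono) auto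
      \<comment> \<open>(1 + \<delta>)(L + \<delta>) + \<delta> expands to this: one factor 1 +
        \<delta> from Harnack, one \<delta> from \<open>E\<close>, one from the tail of the
        measure.\<close>
      then have "\<phi> \<le> L + \<delta> * (L + 2 + \<delta>)" using p1 by (simp add: algebra_simps)
      also have "\<delta> * (L + 2 + \<delta>) \<le> \<delta> * (2 * L + 4)" using \<delta> L by (intro mult_left_mono) auto
      finally have u: "\<phi> \<le> L + \<eta>" using \<delta> by linarith
      have l: "L - \<eta> \<le> \<phi>"
      proof (rule ccontr)
        assume "\<not> ?thesis"
        then have "(1 + \<delta>) * \<phi> \<le> (1 + \<delta>) * (L - \<eta>)" using \<delta> by (intro mult_left_mono) auto
        then have "L * (1 - \<delta>) - \<delta> \<le> (1 + \<delta>) * (L - \<eta>)" using p2 h2 by linarith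
        then have "\<eta> + \<delta> * \<eta> \<le> \<delta> * (2 * L + 1)" by (simp add: algebra_simps)
        also have "\<dots> < \<delta> * (2 * L + 4)" using \<delta> by simp
        finally have "\<eta> + \<delta> * \<eta> < \<eta>" using \<delta> by linarith
        then show False using \<delta> \<eta> by (simp add: mult_less_0_iff)
      qed
      show ?case using u l \<phi> by (simp add: abs_le_iff)
    qed
  qed
  have "(\<lambda>j. enn2real (F j)) \<longlonglongrightarrow> L"
    unfolding tendsto_iff dist_real_def
  proof (intro allI impI)
    fix e :: real assume "e > 0"
    then show "eventually (\<lambda>j. \<bar>enn2real (F j) - L\<bar> < e) sequentially"
      using key[of "e / 2"] by (auto elim: eventually_mono)
  qed
  then show ?thesis by (simp add: LF)
qed


section \<open>Blowing up the boundary measure\<close>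

text \<open>The rescaling is pushed forward because the preimage of E under x -> dil (1/r) (n0^-1 x)
  is n0 dil r E; \<open>r powr - Q\<close> makes Lebesgue measure invariant under the
  operation.\<close>

definition blowup :: "('v \<times> 'z) measure \<Rightarrow> 'v \<times> 'z \<Rightarrow> real \<Rightarrow> ('v \<times> 'z) measure" where
  "blowup \<mu> n0 r = density (distr \<mu> borel (\<lambda>x. dil (1 / r) (ninv n0 \<cdot> x))) (\<lambda>_. ennreal (r powr - Q))"

lemma sets_blowup [simp]: "sets (blowup \<mu> n0 r) = sets borel"
  by (simp add: blowup_def)

lemma nn_integral_blowup:
  assumes \<mu>: "sets \<mu> = sets borel" and [measurable]: "f \<in> borel_measurable borel"
  shows "integral\<^sup>N (blowup \<mu> n0 r) f = ennreal (r powr - Q) * (\<integral>\<^sup>+x. f (dil (1 / r) (ninv n0 \<cdot> x)) \<partial>\<mu>)"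
proof -
  have "(\<lambda>x. dil (1 / r) (ninv n0 \<cdot> x)) \<in> measurable \<mu> borel"
    unfolding measurable_cong_sets[OF \<mu> refl] by measurable
  then show ?thesis
    by (simp add: blowup_def nn_integral_density nn_integral_distr nn_integral_cmult)
qed

lemma dil_translate_mem_hball:
  assumes r: "r > 0"
  shows "dil (1 / r) (ninv n0 \<cdot> x) \<in> hball br n s \<longleftrightarrow> x \<in> hball br (n0 \<cdot> dil r n) (r * s)"
proof -
  have "ninv (n0 \<cdot> dil r n) \<cdot> x = dil r (ninv n \<cdot> dil (1 / r) (ninv n0 \<cdot> x))"
    using r by (simp add: ninv_mul mul_assoc dil_mul dil_ninv dil_dil)
  then show ?thesis using r by (simp add: mem_hball hgauge_dil)
qed

lemma emeasure_blowup_hball: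
  assumes \<mu>: "sets \<mu> = sets borel" and r: "r > 0"
  shows "emeasure (blowup \<mu> n0 r) (hball br n s)
    = ennreal (r powr - Q) * emeasure \<mu> (hball br (n0 \<cdot> dil r n) (r * s))"
proof -
  have "emeasure (blowup \<mu> n0 r) (hball br n s) = integral\<^sup>N (blowup \<mu> n0 r) (indicator (hball br n s))"
    by simp
  also have "\<dots> = ennreal (r powr - Q) * (\<integral>\<^sup>+x. indicator (hball br n s) (dil (1 / r) (ninv n0 \<cdot> x)) \<partial>\<mu>)"
    by (rule nn_integral_blowup[OF \<mu>]) measurable
  also have "(\<integral>\<^sup>+x. indicator (hball br n s) (dil (1 / r) (ninv n0 \<cdot> x)) \<partial>\<mu>) = (\<integral>\<^sup>+x. indicator (hball br (n0 \<cdot> dil r n) (r * s)) x \<partial>\<mu>)"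
    using r by (intro nn_integral_cong) (simp add: indicator_def dil_translate_mem_hball)
  also have "\<dots> = emeasure \<mu> (hball br (n0 \<cdot> dil r n) (r * s))" by (simp add: \<mu>)
  finally show ?thesis .
qed

lemma measure_blowup_hball:
  assumes "sets \<mu> = sets borel" "r > 0"
  shows "measure (blowup \<mu> n0 r) (hball br n s) = r powr - Q * measure \<mu> (hball br (n0 \<cdot> dil r n) (r * s))"
  by (simp add: measure_def emeasure_blowup_hball[OF assms] enn2real_mult)

text \<open>Blowing up the boundary measure turns evaluation along the cone into evaluation at a fixed
  point of \<open>S\<close>.\<close>

lemma pker_blowup:
  assumes "r > 0" "a > 0"
  shows "r powr - Q * pker \<beta> a (ninv (dil (1 / r) (ninv n0 \<cdot> x)) \<cdot> n) = pker \<beta> (r * a) (ninv x \<cdot> (n0 \<cdot> dil r n))"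
proof -
  have "ninv x \<cdot> (n0 \<cdot> dil r n) = dil r (ninv (dil (1 / r) (ninv n0 \<cdot> x)) \<cdot> n)"
    using assms by (simp add: dil_mul dil_ninv[symmetric] dil_dil ninv_mul mul_assoc)
  then show ?thesis using pker_dil[OF assms] by simp
qed

lemma nn_integral_pker_blowup:
  assumes \<mu>: "sets \<mu> = sets borel" and \<beta>: "\<beta> > 0" and ra: "r > 0" "a > 0" and P: "P_defined br \<beta> \<mu>"
  shows "(\<integral>\<^sup>+x. ennreal (pker \<beta> a (ninv x \<cdot> n)) \<partial>blowup \<mu> n0 r)
    = ennreal (Q_transform br \<beta> \<mu> (n0 \<cdot> dil r n, r * a))"
proof -
  have bm: "borel_measurable \<mu> = borel_measurable borel"
    by (rule measurable_cong_sets[OF \<mu> refl])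
  have "(\<integral>\<^sup>+x. ennreal (pker \<beta> a (ninv x \<cdot> n)) \<partial>blowup \<mu> n0 r)
      = ennreal (r powr - Q) * (\<integral>\<^sup>+x. ennreal (pker \<beta> a (ninv (dil (1 / r) (ninv n0 \<cdot> x)) \<cdot> n)) \<partial>\<mu>)"
    by (rule nn_integral_blowup[OF \<mu>]) measurable
  also have "\<dots> = (\<integral>\<^sup>+x. ennreal (r powr - Q) * ennreal (pker \<beta> a (ninv (dil (1 / r) (ninv n0 \<cdot> x)) \<cdot> n)) \<partial>\<mu>)"
    by (rule nn_integral_cmult[symmetric]) (unfold bm, measurable)
  also have "\<dots> = (\<integral>\<^sup>+x. ennreal (pker \<beta> (r * a) (ninv x \<cdot> (n0 \<cdot> dil r n))) \<partial>\<mu>)"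
    using \<beta> ra by (intro nn_integral_cong) (simp add: ennreal_mult[symmetric] pker_blowup)
  also have "\<dots> = ennreal (LINT x|\<mu>. pker \<beta> (r * a) (ninv x \<cdot> (n0 \<cdot> dil r n)))"
  proof (rule nn_integral_eq_integral)
    show "integrable \<mu> (\<lambda>x. pker \<beta> (r * a) (ninv x \<cdot> (n0 \<cdot> dil r n)))"
      using P[unfolded P_defined_def, rule_format, of "r * a" "n0 \<cdot> dil r n"] ra \<beta> by (simp add: q_dil_eq)
  qed (use \<beta> in simp)
  finally show ?thesis using ra \<beta> by (simp add: Q_transform_def q_dil_eq)
qed

lemma Q_transform_nonneg: "\<beta> > 0 \<Longrightarrow> a > 0 \<Longrightarrow> Q_transform br \<beta> \<mu> (n, a) \<ge> 0"
  by (auto simp: Q_transform_def q_dil_eq intro: integral_nonneg_AE)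

lemma integral_pker_blowup:
  assumes "sets \<mu> = sets borel" "\<beta> > 0" "r > 0" "a > 0" "P_defined br \<beta> \<mu>"
  shows "(LINT x|blowup \<mu> n0 r. pker \<beta> a (ninv x \<cdot> n)) = Q_transform br \<beta> \<mu> (n0 \<cdot> dil r n, r * a)"
proof -
  have "(LINT x|blowup \<mu> n0 r. pker \<beta> a (ninv x \<cdot> n)) = enn2real (\<integral>\<^sup>+x. ennreal (pker \<beta> a (ninv x \<cdot> n)) \<partial>blowup \<mu> n0 r)"
    using assms(2) by (intro integral_eq_nn_integral) (auto simp: measurable_cong_sets[OF sets_blowup refl])
  then show ?thesis using assms by (simp add: nn_integral_pker_blowup Q_transform_nonneg)
qed

lemma pgauge_powr_eq_pker: "\<beta> > 0 \<Longrightarrow> pgauge 1 x powr - (Q + 2 * \<beta>) = pmass \<beta> * pker \<beta> 1 (ninv x \<cdot> 0)"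
  using pmass_pos[of \<beta>] by (simp add: pker_def)

text \<open>The weight is, up to the mass, the kernel at the point (0, 1), which rescaling carries
  to (n0, r). Thus a uniform weighted bound on blow-ups is the same as boundedness of the Poisson
  integral on the vertical line over \<open>n0\<close>.\<close>

lemma nn_integral_pgauge_blowup:
  assumes \<mu>: "sets \<mu> = sets borel" and \<beta>: "\<beta> > 0" and r: "r > 0" and P: "P_defined br \<beta> \<mu>"
  shows "(\<integral>\<^sup>+x. ennreal (pgauge 1 x powr - (Q + 2 * \<beta>)) \<partial>blowup \<mu> n0 r)
    = ennreal (pmass \<beta> * Q_transform br \<beta> \<mu> (n0, r))"
proof -
  have "(\<integral>\<^sup>+x. ennreal (pgauge 1 x powr - (Q + 2 * \<beta>)) \<partial>blowup \<mu> n0 r)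
      = (\<integral>\<^sup>+x. ennreal (pmass \<beta>) * ennreal (pker \<beta> 1 (ninv x \<cdot> 0)) \<partial>blowup \<mu> n0 r)"
    using \<beta> pmass_pos[OF \<beta>] by (intro nn_integral_cong, subst pgauge_powr_eq_pker) (auto simp: ennreal_mult)
  also have "\<dots> = ennreal (pmass \<beta>) * (\<integral>\<^sup>+x. ennreal (pker \<beta> 1 (ninv x \<cdot> 0)) \<partial>blowup \<mu> n0 r)"
    by (rule nn_integral_cmult) (unfold measurable_cong_sets[OF sets_blowup refl], measurable)
  also have "\<dots> = ennreal (pmass \<beta>) * ennreal (Q_transform br \<beta> \<mu> (n0 \<cdot> dil r 0, r * 1))"
    using nn_integral_pker_blowup[OF \<mu> \<beta> r zero_less_one P, where n = 0 and ?n0.0 = n0] by simp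
  finally show ?thesis using \<beta> r pmass_pos[OF \<beta>] Q_transform_nonneg[OF \<beta> r]
    by (simp add: ennreal_mult[symmetric])
qed

lemma emeasure_positive_measure_hball:
  assumes "positive_measure \<mu>"
  shows "emeasure \<mu> (hball br n s) < \<infinity>"
proof -
  have "emeasure \<mu> (hball br n s) \<le> emeasure \<mu> (closure (hball br n s))"
    using assms by (intro emeasure_mono closure_subset) (auto simp: positive_measure_def)
  also have "\<dots> < \<infinity>"
    using assms bounded_hball[of n s] by (auto simp: positive_measure_def)
  finally show ?thesis .
qed

text \<open>The factor r^Q in the Lebesgue measure of the moving ball is the normalisation of the
  blow-up, leaving the fixed constant \<open>s powr Q * vol\<close>.\<close>

lemma strong_derivative_iff:
  assumes \<mu>: "sets \<mu> = sets borel"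
  shows "strong_derivative br \<mu> n0 L \<longleftrightarrow> (\<forall>n s. s > 0 \<longrightarrow>
    ((\<lambda>r. measure (blowup \<mu> n0 r) (hball br n s)) \<longlongrightarrow> L * (s powr Q * vol)) (at_right 0))"
proof -
  have "((\<lambda>r. measure \<mu> (nmul br n0 ` dil r ` hball br n s) / measure lborel (nmul br n0 ` dil r ` hball br n s)) \<longlongrightarrow> L) (at_right 0)
    \<longleftrightarrow> ((\<lambda>r. measure (blowup \<mu> n0 r) (hball br n s)) \<longlongrightarrow> L * (s powr Q * vol)) (at_right 0)" (is "?A \<longleftrightarrow> ?B")
    if s: "s > 0" for n s
  proof -
    have v: "s powr Q * vol > 0" using s vol_pos by simp
    have eq: "measure \<mu> (nmul br n0 ` dil r ` hball br n s) / measure lborel (nmul br n0 ` dil r ` hball br n s)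
        = measure (blowup \<mu> n0 r) (hball br n s) / (s powr Q * vol)" if r: "r > 0" for r
      using r s by (simp add: image_hball measure_blowup_hball[OF \<mu> r] measure_lborel_hball powr_mult powr_minus divide_inverse)
    have "?A \<longleftrightarrow> ((\<lambda>r. measure (blowup \<mu> n0 r) (hball br n s) / (s powr Q * vol)) \<longlongrightarrow> L) (at_right 0)"
      by (intro tendsto_cong eventually_at_right_less[THEN eventually_mono] eq)
    also have "\<dots> \<longleftrightarrow> ?B" by (rule tendsto_divide_const_iff[OF v])
    finally show ?thesis .
  qed
  then show ?thesis unfolding strong_derivative_def by blast
qed

section \<open>The two implications for an eigenfunction and its boundary measure\<close>

lemma boundary_measure_eq:
  assumes "boundary_measure br \<beta> u \<mu>"
  obtains C where "C \<ge> 0"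
    "\<And>n a. a > 0 \<Longrightarrow> a powr (\<beta> - rho TYPE('v \<times> 'z)) * u (n, a) = C * a powr (2 * \<beta>) + Q_transform br \<beta> \<mu> (n, a)"
proof -
  from assms obtain C where C: "C \<ge> 0"
    "\<And>n a. a > 0 \<Longrightarrow> u (n, a) = C * a powr (\<beta> + rho TYPE('v \<times> 'z)) + P_transform br \<beta> \<mu> (n, a)"
    unfolding boundary_measure_def by blast
  have "a powr (\<beta> - rho TYPE('v \<times> 'z)) * u (n, a) = C * a powr (2 * \<beta>) + Q_transform br \<beta> \<mu> (n, a)" if a: "a > 0" for n a
  proof -
    let ?\<rho> = "rho TYPE('v \<times> 'z)"
    have "a powr (\<beta> - ?\<rho>) * u (n, a) = C * (a powr (\<beta> - ?\<rho>) * a powr (\<beta> + ?\<rho>)) + (a powr (\<beta> - ?\<rho>) * a powr (?\<rho> - \<beta>)) * Q_transform br \<beta> \<mu> (n, a)"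
      by (simp add: C(2)[OF a] P_transform_def distrib_left mult_ac)
    also have "a powr (\<beta> - ?\<rho>) * a powr (\<beta> + ?\<rho>) = a powr (2 * \<beta>)" by (simp add: powr_add[symmetric])
    also have "a powr (\<beta> - ?\<rho>) * a powr (?\<rho> - \<beta>) = 1" using a by (simp add: powr_add[symmetric])
    finally show ?thesis by simp
  qed
  with C(1) show ?thesis using that by blast
qed

lemma tendsto_powr_0: "\<beta> > 0 \<Longrightarrow> (X \<longlonglongrightarrow> 0) \<Longrightarrow> (\<And>j. X j > 0) \<Longrightarrow> (\<lambda>j. C * X j powr (2 * \<beta>)) \<longlonglongrightarrow> (0 :: real)"
  using tendsto_mult[OF tendsto_const[of C] tendsto_powr2[of X 0 sequentially "\<lambda>_. 2 * \<beta>" "2 * \<beta>"]]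
  by (auto simp: less_imp_le)

lemma cone_limit_imp_strong_derivative:
  assumes \<beta>: "\<beta> > 0" and bmu: "boundary_measure br \<beta> u \<mu>" and L: "L \<ge> 0" and \<theta>: "\<theta> > 0"
    and cone: "cone_limit br \<theta> (\<lambda>(n, a). a powr (\<beta> - rho TYPE('v \<times> 'z)) * u (n, a)) n0 L"
  shows "strong_derivative br \<mu> n0 L"
proof -
  obtain C where C: "C \<ge> 0"
    "\<And>n a. a > 0 \<Longrightarrow> a powr (\<beta> - rho TYPE('v \<times> 'z)) * u (n, a) = C * a powr (2 * \<beta>) + Q_transform br \<beta> \<mu> (n, a)"
    using boundary_measure_eq[OF bmu] by blast
  have \<mu>: "sets \<mu> = sets borel" "P_defined br \<beta> \<mu>"
    using bmu by (auto simp: boundary_measure_def positive_measure_def)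
  \<comment> \<open>The point lies in the cone exactly when \<open>hg n < \<theta> * a\<close>, a
    condition free of the scale; the term with \<open>C\<close> vanishes because \<beta> >
    0.\<close>
  have lim: "(\<lambda>j. Q_transform br \<beta> \<mu> (n0 \<cdot> dil (X j) n, X j * a)) \<longlonglongrightarrow> L"
    if X: "X \<longlonglongrightarrow> 0" "\<And>j. X j > 0" and na: "a > 0" "hg n < \<theta> * a" for X n a
  proof -
    let ?v = "\<lambda>j. C * (X j * a) powr (2 * \<beta>) + Q_transform br \<beta> \<mu> (n0 \<cdot> dil (X j) n, X j * a)"
    have Xa: "(\<lambda>j. X j * a) \<longlonglongrightarrow> 0" "\<And>j. X j * a > 0"
      using tendsto_mult[OF X(1) tendsto_const[of a]] X na by auto
    have "?v \<longlonglongrightarrow> L"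
      unfolding tendsto_iff dist_real_def
    proof (intro allI impI)
      fix e :: real assume "e > 0"
      with cone obtain a0 where a0: "a0 > 0"
        "\<And>n a. (n, a) \<in> cone br \<theta> n0 \<Longrightarrow> a < a0 \<Longrightarrow> \<bar>a powr (\<beta> - rho TYPE('v \<times> 'z)) * u (n, a) - L\<bar> < e"
        unfolding cone_limit_def by fast
      have inc: "(n0 \<cdot> dil (X j) n, X j * a) \<in> cone br \<theta> n0" for j
        using X(2)[of j] na by (simp add: cone_def hdist_def hgauge_dil)
      from order_tendstoD(2)[OF Xa(1) a0(1)]
      show "eventually (\<lambda>j. \<bar>?v j - L\<bar> < e) sequentially"
      proof eventually_elim
        case (elim j)
        then show ?case using a0(2)[OF inc elim] C(2)[OF Xa(2)] by simp
      qed
    qed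
    from tendsto_diff[OF this tendsto_powr_0[OF \<beta> Xa, of C]] show ?thesis by simp
  qed
  show ?thesis unfolding strong_derivative_iff[OF \<mu>(1)]
  proof (intro allI impI)
    fix n s assume s: "(s :: real) > 0"
    show "((\<lambda>r. measure (blowup \<mu> n0 r) (hball br n s)) \<longlongrightarrow> L * (s powr Q * vol)) (at_right 0)"
      unfolding tendsto_at_iff_sequentially comp_def
    proof (intro allI impI)
      fix X :: "nat \<Rightarrow> real" assume X: "\<forall>i. X i \<in> {0<..} - {0}" "X \<longlonglongrightarrow> 0"
      then have X0: "X j > 0" for j by simp
      have "(\<lambda>j. Q_transform br \<beta> \<mu> (n0, X j)) \<longlonglongrightarrow> L"
        using lim[OF X(2) X0, of 1 0] \<theta> by (simp add: hgauge_eq_pgauge)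
      from order_tendstoD(2)[OF this, of "L + 1"]
      obtain k where k: "\<And>j. j \<ge> k \<Longrightarrow> Q_transform br \<beta> \<mu> (n0, X j) < L + 1"
        by (auto simp: eventually_sequentially)
      \<comment> \<open>Dropping finitely many terms makes the bound \<open>L + 1\<close> on the
        vertical line hold for every index, as the uniform hypotheses require.\<close>
      define Y where "Y j = X (j + k)" for j
      have Y: "Y \<longlonglongrightarrow> 0" "\<And>j. Y j > 0"
        unfolding Y_def by (rule LIMSEQ_ignore_initial_segment[OF X(2)], rule X0)
      have bnd: "(\<integral>\<^sup>+x. ennreal (pgauge 1 x powr - (Q + 2 * \<beta>)) \<partial>blowup \<mu> n0 (Y j)) \<le> ennreal (pmass \<beta> * (L + 1))" for j
        using k[of "j + k"] pmass_pos[OF \<beta>]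
        by (subst nn_integral_pgauge_blowup[OF \<mu>(1) \<beta> Y(2) \<mu>(2)])
           (auto simp: Y_def intro!: ennreal_leI mult_left_mono)
      have "(\<lambda>j. measure (blowup \<mu> n0 (Y j)) (hball br n s)) \<longlonglongrightarrow> L * (s powr Q * vol)"
      proof (rule tauberian_balls[OF sets_blowup \<beta> _ L bnd _ s])
        show "pmass \<beta> * (L + 1) \<ge> 0" using pmass_pos[OF \<beta>] L by simp
        fix n' and a :: real assume a: "a > 0"
        show "(\<lambda>j. LINT x|blowup \<mu> n0 (Y j). pker \<beta> a (ninv x \<cdot> n')) \<longlonglongrightarrow> L"
        proof (rule pker_limit_extend[OF sets_blowup \<beta> bnd _ a])
          fix b assume b: "hg n' / \<theta> < b"
          have "0 \<le> hg n' / \<theta>" using \<theta> by simp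
          with b have "b > 0" by linarith
          with b \<theta> show "(\<lambda>j. LINT x|blowup \<mu> n0 (Y j). pker \<beta> b (ninv x \<cdot> n')) \<longlonglongrightarrow> L"
            using lim[OF Y, of b n'] by (simp add: integral_pker_blowup[OF \<mu>(1) \<beta> Y(2) _ \<mu>(2)] pos_divide_less_eq mult.commute)
        qed
      qed
      then show "(\<lambda>j. measure (blowup \<mu> n0 (X j)) (hball br n s)) \<longlonglongrightarrow> L * (s powr Q * vol)"
        unfolding Y_def by (rule LIMSEQ_offset)
    qed
  qed
qed

text \<open>The derivative gives growth t^Q only at small radii about \<open>n0\<close>. The part of
  \<mu> in such a ball has that growth at all radii, so its blow-ups share one tail radius; the part
  outside contributes a multiple of r^(2\<beta>), by the off-diagonal bound and the finite weighted
  mass of \<mu>.\<close>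

lemma blowup_tail:
  assumes \<beta>: "\<beta> > 0" and \<mu>: "positive_measure \<mu>" "P_defined br \<beta> \<mu>" and L: "L \<ge> 0"
    and der: "strong_derivative br \<mu> n0 L" and \<delta>: "\<delta> > 0"
  shows "\<exists>R>0. eventually (\<lambda>r. (\<integral>\<^sup>+x. indicator {x. R \<le> hg x} x *
        ennreal (pgauge 1 x powr - (Q + 2 * \<beta>)) \<partial>blowup \<mu> n0 r) \<le> ennreal \<delta>) (at_right 0)"
proof -
  define \<sigma> where "\<sigma> = Q + 2 * \<beta>"
  have sets: "sets \<mu> = sets borel" using \<mu> by (simp add: positive_measure_def)
  have bm: "borel_measurable \<mu> = borel_measurable borel"
    by (rule measurable_cong_sets[OF sets refl])
  \<comment> \<open>The limit for the unit ball is \<open>L * vol\<close>; the added 1 leaves room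
    for a strict inequality at small scales.\<close>
  define B where "B = L * vol + 1"
  have B: "B \<ge> 0" using L vol_pos by (simp add: B_def)
  have "((\<lambda>r. measure (blowup \<mu> n0 r) (hball br 0 1)) \<longlongrightarrow> L * (1 powr Q * vol)) (at_right 0)"
    by (rule der[unfolded strong_derivative_iff[OF sets], rule_format]) simp
  from order_tendstoD(2)[OF this, of B]
  have "eventually (\<lambda>r. measure (blowup \<mu> n0 r) (hball br 0 1) < B) (at_right 0)"
    by (simp add: B_def)
  then obtain t0 where t0: "t0 > 0" "\<And>t. 0 < t \<Longrightarrow> t < t0 \<Longrightarrow> measure (blowup \<mu> n0 t) (hball br 0 1) < B"
    unfolding eventually_at_right_field by blast
  define t1 where "t1 = t0 / 2"
  have t1: "0 < t1" "t1 < t0" using t0 by (auto simp: t1_def)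
  have growth: "emeasure \<mu> (hball br n0 t) \<le> ennreal (B * t powr Q)" if t: "0 < t" "t \<le> t1" for t
  proof -
    have "t powr - Q * measure \<mu> (hball br n0 t) \<le> B"
      using t0(2)[of t] t t1 by (simp add: measure_blowup_hball[OF sets t(1)])
    then have "t powr Q * (t powr - Q * measure \<mu> (hball br n0 t)) \<le> t powr Q * B"
      by (intro mult_left_mono) auto
    moreover have "t powr Q * t powr - Q = 1" using t by (simp add: powr_add[symmetric])
    ultimately have "measure \<mu> (hball br n0 t) \<le> B * t powr Q" by (simp add: mult.assoc[symmetric] mult.commute)
    moreover have "emeasure \<mu> (hball br n0 t) = ennreal (measure \<mu> (hball br n0 t))"
      using emeasure_positive_measure_hball[OF \<mu>(1)] by (intro emeasure_eq_ennreal_measure) (simp add: less_top)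
    ultimately show ?thesis by (simp add: ennreal_leI)
  qed
  define \<mu>' where "\<mu>' = density \<mu> (indicator (hball br n0 t1))"
  have sets': "sets \<mu>' = sets borel" by (simp add: \<mu>'_def sets)
  have mind: "indicator (hball br n0 t1) \<in> borel_measurable \<mu>"
    unfolding bm by measurable
  obtain R where R: "R > 0"
    "\<And>\<nu>. sets \<nu> = sets borel \<Longrightarrow> (\<And>t. t > 0 \<Longrightarrow> emeasure \<nu> (hball br 0 t) \<le> ennreal (B * t powr Q)) \<Longrightarrow>
      (\<integral>\<^sup>+x. indicator {x. R \<le> hg x} x * ennreal (pgauge 1 x powr - (Q + 2 * \<beta>)) \<partial>\<nu>) \<le> ennreal (\<delta> / 2)"
    using pgauge1_tail[of "2 * \<beta>" B "\<delta> / 2"] \<beta> B \<delta> by auto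
  have near: "(\<integral>\<^sup>+x. indicator {x. R \<le> hg x} x * ennreal (pgauge 1 x powr - (Q + 2 * \<beta>)) \<partial>blowup \<mu>' n0 r) \<le> ennreal (\<delta> / 2)"
    if r: "r > 0" for r
  proof (rule R(2)[OF sets_blowup])
    fix t :: real assume t: "t > 0"
    \<comment> \<open>The restricted measure sees of the ball of radius \<open>r * t\<close> only
      the part within \<open>t1\<close>, so its mass is that of a ball small enough for
      \<open>growth\<close>.\<close>
    define t' where "t' = min (r * t) t1"
    have t': "0 < t'" "t' \<le> t1" "t' \<le> r * t" using t r t1 by (auto simp: t'_def)
    have "emeasure \<mu>' (hball br n0 (r * t)) = emeasure \<mu> (hball br n0 t')"
      unfolding \<mu>'_def using mind
      by (subst emeasure_density)
         (auto simp: sets nn_integral_indicator[symmetric] t'_def indicator_def mem_hball simp del: nn_integral_indicator intro!: nn_integral_cong)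
    also have "\<dots> \<le> ennreal (B * t' powr Q)" by (rule growth[OF t'(1,2)])
    also have "\<dots> \<le> ennreal (B * (r * t) powr Q)"
      using t' B Q_pos by (intro ennreal_leI mult_left_mono powr_mono2) auto
    finally have "emeasure (blowup \<mu>' n0 r) (hball br 0 t) \<le> ennreal (r powr - Q) * ennreal (B * (r * t) powr Q)"
      unfolding emeasure_blowup_hball[OF sets' r] by (intro mult_left_mono) auto
    also have "\<dots> = ennreal (B * t powr Q * (r powr - Q * r powr Q))"
      using B r t by (simp add: ennreal_mult[symmetric] powr_mult less_imp_le mult_ac)
    also have "r powr - Q * r powr Q = 1" using r by (simp add: powr_add[symmetric])
    finally show "emeasure (blowup \<mu>' n0 r) (hball br 0 t) \<le> ennreal (B * t powr Q)" by simp
  qed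
  obtain C where C: "C \<ge> 0" "\<And>a x y. a > 0 \<Longrightarrow> hg (ninv x \<cdot> y) \<ge> t1 \<Longrightarrow>
    pker \<beta> a (ninv x \<cdot> y) \<le> C * a powr (2 * \<beta>) * pgauge 1 y powr (Q + 2 * \<beta>) * pgauge 1 x powr - (Q + 2 * \<beta>)"
    using pker_far_le[OF \<beta> t1(1)] by blast
  \<comment> \<open>The weighted mass of \<mu> itself, obtained as the blow-up at the identity with
    scale 1.\<close>
  define W where "W = pmass \<beta> * Q_transform br \<beta> \<mu> (0, 1)"
  have W0: "W \<ge> 0" using pmass_pos[OF \<beta>] Q_transform_nonneg[OF \<beta>] by (simp add: W_def)
  have W: "(\<integral>\<^sup>+x. ennreal (pgauge 1 x powr - \<sigma>) \<partial>\<mu>) = ennreal W"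
  proof -
    have "(\<integral>\<^sup>+x. ennreal (pgauge 1 x powr - \<sigma>) \<partial>\<mu>) = (\<integral>\<^sup>+x. ennreal (pgauge 1 x powr - (Q + 2 * \<beta>)) \<partial>blowup \<mu> 0 1)"
      by (subst nn_integral_blowup[OF sets]) (auto simp: \<sigma>_def)
    then show ?thesis using nn_integral_pgauge_blowup[OF sets \<beta> _ \<mu>(2), of 1 0] by (simp add: W_def)
  qed
  define D where "D = pmass \<beta> * C * pgauge 1 n0 powr \<sigma>"
  have D: "D \<ge> 0" using C(1) pmass_pos[OF \<beta>] by (simp add: D_def)
  have main: "(\<integral>\<^sup>+x. indicator {x. R \<le> hg x} x * ennreal (pgauge 1 x powr - \<sigma>) \<partial>blowup \<mu> n0 r)
      \<le> ennreal (\<delta> / 2 + D * W * r powr (2 * \<beta>))" if r: "r > 0" for r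
  proof -
    let ?T = "\<lambda>x. dil (1 / r) (ninv n0 \<cdot> x)"
    let ?g = "\<lambda>x. indicator {x. R \<le> hg x} x * ennreal (pgauge 1 x powr - \<sigma>)"
    have mg: "?g \<in> borel_measurable borel" by measurable
    have mgT: "(\<lambda>x. ?g (?T x)) \<in> borel_measurable \<mu>" unfolding bm by measurable
    have "(\<integral>\<^sup>+x. ?g x \<partial>blowup \<mu> n0 r) = (\<integral>\<^sup>+x. ennreal (r powr - Q) * ?g (?T x) \<partial>\<mu>)"
      by (subst nn_integral_blowup[OF sets mg]) (rule nn_integral_cmult[OF mgT, symmetric])
    also have "\<dots> \<le> (\<integral>\<^sup>+x. ennreal (r powr - Q) * (indicator (hball br n0 t1) x * ?g (?T x)) + ennreal (D * r powr (2 * \<beta>)) * ennreal (pgauge 1 x powr - \<sigma>) \<partial>\<mu>)"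
    proof (rule nn_integral_mono)
      fix x
      show "ennreal (r powr - Q) * ?g (?T x) \<le> ennreal (r powr - Q) * (indicator (hball br n0 t1) x * ?g (?T x)) + ennreal (D * r powr (2 * \<beta>)) * ennreal (pgauge 1 x powr - \<sigma>)"
      proof (cases "x \<in> hball br n0 t1")
        case True
        then show ?thesis by simp
      next
        case False
        then have far: "hg (ninv x \<cdot> n0) \<ge> t1"
          using hdist_sym[of x n0] by (simp add: mem_hball hdist_def)
        have "r powr - Q * pgauge 1 (?T x) powr - \<sigma> = pmass \<beta> * (r powr - Q * pker \<beta> 1 (ninv (?T x) \<cdot> 0))"
          unfolding \<sigma>_def pgauge_powr_eq_pker[OF \<beta>] by simp
        also have "\<dots> = pmass \<beta> * pker \<beta> r (ninv x \<cdot> n0)"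
          using pker_blowup[OF r, of 1 \<beta> n0 x 0] by simp
        also have "\<dots> \<le> pmass \<beta> * (C * r powr (2 * \<beta>) * pgauge 1 n0 powr \<sigma> * pgauge 1 x powr - \<sigma>)"
          using C(2)[OF r far] pmass_pos[OF \<beta>] unfolding \<sigma>_def by (intro mult_left_mono) auto
        also have "\<dots> = D * r powr (2 * \<beta>) * pgauge 1 x powr - \<sigma>" by (simp add: D_def mult_ac)
        finally have "ennreal (r powr - Q) * ennreal (pgauge 1 (?T x) powr - \<sigma>) \<le> ennreal (D * r powr (2 * \<beta>)) * ennreal (pgauge 1 x powr - \<sigma>)"
          using D by (simp add: ennreal_mult[symmetric] ennreal_leI)
        moreover have "?g (?T x) \<le> ennreal (pgauge 1 (?T x) powr - \<sigma>)" by (simp add: indicator_def)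
        ultimately show ?thesis using False by (simp add: order_trans[OF mult_left_mono])
      qed
    qed
    also have "\<dots> = ennreal (r powr - Q) * (\<integral>\<^sup>+x. indicator (hball br n0 t1) x * ?g (?T x) \<partial>\<mu>) + ennreal (D * r powr (2 * \<beta>)) * ennreal W"
      unfolding W[symmetric] using mgT mind
      by (subst nn_integral_add) (auto simp: nn_integral_cmult bm)
    also have "(\<integral>\<^sup>+x. indicator (hball br n0 t1) x * ?g (?T x) \<partial>\<mu>) = (\<integral>\<^sup>+x. ?g (?T x) \<partial>\<mu>')"
      unfolding \<mu>'_def by (rule nn_integral_density[symmetric, OF mind mgT])
    also have "ennreal (r powr - Q) * (\<integral>\<^sup>+x. ?g (?T x) \<partial>\<mu>') = (\<integral>\<^sup>+x. ?g x \<partial>blowup \<mu>' n0 r)"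
      by (rule nn_integral_blowup[OF sets' mg, symmetric])
    also have "(\<integral>\<^sup>+x. ?g x \<partial>blowup \<mu>' n0 r) + ennreal (D * r powr (2 * \<beta>)) * ennreal W
        \<le> ennreal (\<delta> / 2) + ennreal (D * r powr (2 * \<beta>)) * ennreal W"
      using near[OF r] unfolding \<sigma>_def by (rule add_right_mono)
    also have "\<dots> = ennreal (\<delta> / 2 + D * W * r powr (2 * \<beta>))"
      using \<delta> D W0 by (simp add: ennreal_mult[symmetric] mult_ac)
    finally show ?thesis .
  qed
  have "((\<lambda>r. D * W * r powr (2 * \<beta>)) \<longlongrightarrow> D * W * 0 powr (2 * \<beta>)) (at_right 0)"
    using \<beta> by (intro tendsto_mult tendsto_const tendsto_powr2 tendsto_ident_at) (auto simp: eventually_at_right_less[THEN eventually_mono] less_imp_le)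
  then have "((\<lambda>r. D * W * r powr (2 * \<beta>)) \<longlongrightarrow> 0) (at_right 0)" by simp
  from order_tendstoD(2)[OF this, of "\<delta> / 2"] \<delta>
  have "eventually (\<lambda>r. D * W * r powr (2 * \<beta>) < \<delta> / 2) (at_right 0)" by simp
  moreover have "eventually (\<lambda>r::real. 0 < r) (at_right 0)" by (rule eventually_at_right_less)
  ultimately have "eventually (\<lambda>r. (\<integral>\<^sup>+x. indicator {x. R \<le> hg x} x *
        ennreal (pgauge 1 x powr - (Q + 2 * \<beta>)) \<partial>blowup \<mu> n0 r) \<le> ennreal \<delta>) (at_right 0)"
  proof eventually_elim
    case (elim r)
    have "ennreal (\<delta> / 2 + D * W * r powr (2 * \<beta>)) \<le> ennreal \<delta>"
      using elim by (intro ennreal_leI) linarith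
    with main[OF elim(2)] show ?case unfolding \<sigma>_def by (rule order_trans)
  qed
  with R(1) show ?thesis by blast
qed

text \<open>A failure of the limit gives cone points of height tending to 0 that stay away from
  \<open>L\<close>. Rescaling each by its own height puts it at height 1 over a point of the fixed
  ball of radius \<alpha>, so uniformity over the cone becomes convergence at the moving points
  \<open>\<xi> j\<close>.\<close>

lemma strong_derivative_imp_admissible_limit:
  assumes \<beta>: "\<beta> > 0" and bmu: "boundary_measure br \<beta> u \<mu>" and L: "L \<ge> 0"
    and der: "strong_derivative br \<mu> n0 L"
  shows "admissible_limit br (\<lambda>(n, a). a powr (\<beta> - rho TYPE('v \<times> 'z)) * u (n, a)) n0 L"
proof (rule ccontr)
  assume "\<not> ?thesis"
  then obtain \<alpha> e where "\<alpha> > 0" and e: "e > 0" and ex: "\<And>a0. a0 > 0 \<Longrightarrow> \<exists>n a. (n, a) \<in> cone br \<alpha> n0 \<and> a < a0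
      \<and> \<not> \<bar>a powr (\<beta> - rho TYPE('v \<times> 'z)) * u (n, a) - L\<bar> < e"
    unfolding admissible_limit_def cone_limit_def by fast
  obtain C where C: "C \<ge> 0"
    "\<And>n a. a > 0 \<Longrightarrow> a powr (\<beta> - rho TYPE('v \<times> 'z)) * u (n, a) = C * a powr (2 * \<beta>) + Q_transform br \<beta> \<mu> (n, a)"
    using boundary_measure_eq[OF bmu] by blast
  have \<mu>: "positive_measure \<mu>" "P_defined br \<beta> \<mu>"
    using bmu by (auto simp: boundary_measure_def)
  then have sets: "sets \<mu> = sets borel" by (simp add: positive_measure_def)
  have "\<forall>j. \<exists>p. p \<in> cone br \<alpha> n0 \<and> snd p < 1 / real (Suc j)
      \<and> \<not> \<bar>snd p powr (\<beta> - rho TYPE('v \<times> 'z)) * u p - L\<bar> < e"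
    using ex[of "1 / real (Suc j)" for j] by (fastforce simp del: of_nat_Suc)
  from choice[OF this] obtain p where p: "\<And>j. p j \<in> cone br \<alpha> n0 \<and> snd (p j) < 1 / real (Suc j)
      \<and> \<not> \<bar>snd (p j) powr (\<beta> - rho TYPE('v \<times> 'z)) * u (p j) - L\<bar> < e" by blast
  define N X where "N j = fst (p j)" and "X j = snd (p j)" for j
  have NX: "(N j, X j) \<in> cone br \<alpha> n0" "X j < 1 / real (Suc j)"
    "\<not> \<bar>X j powr (\<beta> - rho TYPE('v \<times> 'z)) * u (N j, X j) - L\<bar> < e" for j
    using p[of j] by (simp_all add: N_def X_def del: of_nat_Suc)
  have X0: "X j > 0" for j using NX(1)[of j] by (simp add: cone_def)
  have X: "X \<longlonglongrightarrow> 0"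
  proof (rule tendsto_sandwich)
    show "eventually (\<lambda>j. 0 \<le> X j) sequentially" using X0 by (simp add: less_imp_le)
    show "eventually (\<lambda>j. X j \<le> 1 / real (Suc j)) sequentially"
      by (rule always_eventually) (intro allI less_imp_le NX(2))
    show "(\<lambda>j. 1 / real (Suc j)) \<longlonglongrightarrow> 0" by (rule LIMSEQ_Suc[OF lim_1_over_n])
  qed simp
  have Xr: "filterlim X (at_right 0) sequentially"
    by (rule filterlim_at_withinI[OF X always_eventually]) (use X0 in \<open>simp add: less_imp_neq[THEN not_sym]\<close>)
  define \<xi> where "\<xi> j = dil (1 / X j) (ninv n0 \<cdot> N j)" for j
  have \<xi>: "hg (\<xi> j) < \<alpha>" for j
    using NX(1)[of j] X0[of j] by (simp add: \<xi>_def hgauge_dil cone_def hdist_def pos_divide_less_eq)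
  have N: "n0 \<cdot> dil (X j) (\<xi> j) = N j" for j
    using X0[of j] by (simp add: \<xi>_def dil_dil)
  have "(\<lambda>j. LINT x|blowup \<mu> n0 (X j). pker \<beta> 1 (ninv x \<cdot> \<xi> j)) \<longlonglongrightarrow> L"
  proof (rule ball_limits_imp_pker_limit[OF sets_blowup \<beta> L _ _ _ \<xi>])
    fix n s assume "(s :: real) > 0"
    then have "((\<lambda>r. measure (blowup \<mu> n0 r) (hball br n s)) \<longlongrightarrow> L * (s powr Q * vol)) (at_right 0)"
      using der unfolding strong_derivative_iff[OF sets] by blast
    from filterlim_compose[OF this Xr]
    show "(\<lambda>j. measure (blowup \<mu> n0 (X j)) (hball br n s)) \<longlonglongrightarrow> L * (s powr Q * vol)" .
  next
    show "emeasure (blowup \<mu> n0 (X j)) (hball br 0 R) < \<infinity>" for j R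
      unfolding emeasure_blowup_hball[OF sets X0]
      using emeasure_positive_measure_hball[OF \<mu>(1)] by (simp add: ennreal_mult_less_top)
  next
    fix \<delta> :: real assume "\<delta> > 0"
    from blowup_tail[OF \<beta> \<mu> L der this] eventually_compose_filterlim[OF _ Xr]
    show "\<exists>R>0. eventually (\<lambda>j. (\<integral>\<^sup>+x. indicator {x. R \<le> hg x} x *
        ennreal (pgauge 1 x powr - (Q + 2 * \<beta>)) \<partial>blowup \<mu> n0 (X j)) \<le> ennreal \<delta>) sequentially"
      by blast
  qed
  then have "(\<lambda>j. Q_transform br \<beta> \<mu> (N j, X j)) \<longlonglongrightarrow> L"
    by (simp add: integral_pker_blowup[OF sets \<beta> X0 _ \<mu>(2)] N)
  from tendsto_add[OF tendsto_powr_0[OF \<beta> X X0, of C] this]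
  have "(\<lambda>j. X j powr (\<beta> - rho TYPE('v \<times> 'z)) * u (N j, X j)) \<longlonglongrightarrow> L"
    by (simp add: C(2)[OF X0])
  then have "eventually (\<lambda>j. \<bar>X j powr (\<beta> - rho TYPE('v \<times> 'z)) * u (N j, X j) - L\<bar> < e) sequentially"
    using e by (simp add: tendsto_iff dist_real_def)
  then show False using NX(3) by (auto simp: eventually_sequentially)
qed

end


text \<open>X -> (X, 0) and \<open>snd\<close> are linear, so \<open>vbr\<close> inherits
  bilinearity and alternation from the bracket; in finite dimension bilinear maps are
  bounded.\<close>

lemma H_type_step_two_group:
  fixes br :: "('v::euclidean_space, 'z::euclidean_space) bracket"
  assumes "H_type br"
  shows "step_two_group br (hdim TYPE('v \<times> 'z))"
proof -
  have bil: "bilinear br" and alt: "\<And>x. br x x = 0"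
    using assms by (auto simp: H_type_def lie_bracket_def)
  have add: "(X + Y, 0 :: 'z) = (X, 0) + (Y, 0)" and scale: "(c *\<^sub>R X, 0 :: 'z) = c *\<^sub>R (X, 0)"
    for X Y :: 'v and c :: real
    by simp_all
  have "linear (vbr br X)" "linear (\<lambda>Y. vbr br Y X)" for X
    unfolding vbr_def
    by (intro linearI; simp only: add scale bilinear_radd[OF bil] bilinear_rmul[OF bil]
        bilinear_ladd[OF bil] bilinear_lmul[OF bil] snd_add snd_scaleR)+
  then have "bounded_bilinear (vbr br)"
    by (simp add: bilinear_def bilinear_conv_bounded_bilinear[symmetric])
  moreover have "vbr br X X = 0" for X by (simp add: vbr_def alt)
  ultimately show ?thesis by (simp add: step_two_group_def)
qed

theorem theorem4p2:
  fixes br :: "('v::euclidean_space, 'z::euclidean_space) bracket"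
    and u :: "('v \<times> 'z) \<times> real \<Rightarrow> real"
    and \<mu> :: "('v \<times> 'z) measure"
    and n0 :: "'v \<times> 'z"
    and \<beta> L :: real
  assumes "H_type br"
    and "\<beta> > 0"
    and "positive_eigenfunction br (\<beta>\<^sup>2 - (rho TYPE('v \<times> 'z))\<^sup>2) u"
    and "boundary_measure br \<beta> u \<mu>"
    and "L \<ge> 0"
  shows "((\<exists>\<theta>>0. cone_limit br \<theta> (\<lambda>(n, a). a powr (\<beta> - rho TYPE('v \<times> 'z)) * u (n, a)) n0 L)
            \<longrightarrow> strong_derivative br \<mu> n0 L)
       \<and> (strong_derivative br \<mu> n0 L
            \<longrightarrow> admissible_limit br (\<lambda>(n, a). a powr (\<beta> - rho TYPE('v \<times> 'z)) * u (n, a)) n0 L)"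
proof -
  interpret step_two_group br "hdim TYPE('v \<times> 'z)"
    by (rule H_type_step_two_group) fact
  show ?thesis
    using cone_limit_imp_strong_derivative strong_derivative_imp_admissible_limit assms(2,4,5) by blast
qed

end
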